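(* Let $\underline q>0$ and $l\ge 3$ be an integer. Assume that the support of the prior $\pi$ is included in $\Theta(\underline q)$ and that the fixed initial distribution $\mu$ satisfies $\mu_i\ge\underline q$ for all $1\le i\le k$. (a) If Assumption (A1) holds, then for every neighborhood $U$ of $P_l^{\theta^*}$ in the weak topology on probability measures on $(\mathbb R^d)^l$, $$\mathbb P^{\theta^*}\Big(\lim_{n\to\infty}\pi\big(\{\theta: P_l^{\theta}\in U\}\mid Y_{1:n}\big)=1\Big)=1.$$ (b) If Assumptions (A1) and (A2) hold, then for every $\epsilon>0$, $$\mathbb P^{\theta^*}\Big(\lim_{n\to\infty}\pi\big(\{\theta: D_l(\theta,\theta^* )<\epsilon\}\mid Y_{1:n}\big)=1\Big)=1.$$
   Context: Fix integers $k\ge1$, $d\ge1$. $\lambda$ is a $\sigma$-finite reference measure on $\mathbb R^d$ (Borel $\sigma$-field) and $\mathcal F$ is the set of probability densities with respect to $\lambda$. $\Delta_k=\{x\in[0,\infty)^k:\sum_i x_i=1\}$; a transition matrix is an element $Q\in\Delta_k^k$ (each row lies in $\Delta_k$). For $\underline q\ge0$, $\Delta^k(\underline q)=\{Q\in\Delta_k^k:\min_{i,j}Q_{i,j}\ge\underline q\}$, $\Theta=\Delta_k^k\times\mathcal F^k$ and $\Theta(\underline q)=\Delta^k(\underline q)\times\mathcal F^k$. For $\underline q>0$ and $Q\in\Delta^k(\underline q)$, $\mu^Q$ denotes the unique stationary distribution of $Q$. For $\theta=(Q,f)$, $f=(f_1,\dots,f_k)\in\mathcal F^k$, and an initial distribution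 $\nu\in\Delta_k$, $\mathbb P^{\theta,\nu}$ is the law of the hidden Markov model $(X_t,Y_t)_{t\ge1}$: $(X_t)$ is a Markov chain on $\{1,\dots,k\}$ with initial law $\nu$ and transition matrix $Q$, and conditionally on $(X_t)_t$ the variables $Y_t\in\mathbb R^d$ are independent, $Y_t$ having density $f_{X_t}$ with respect to $\lambda$. $\mathbb P^\theta:=\mathbb P^{\theta,\mu^Q}$ (stationary version). The density of $Y_{1:l}$ with respect to $\lambda^{\otimes l}$ is $p_l^{\theta,\nu}(y_{1:l})=\sum_{x_1,\dots,x_l=1}^k\nu_{x_1}Q_{x_1,x_2}\cdots Q_{x_{l-1},x_l}f_{x_1}(y_1)\cdots f_{x_l}(y_l)$; $p_l^\theta:=p_l^{\theta,\mu^Q}$ and $P_l^\theta:=p_l^\theta\,\lambda^{\otimes l}$. The prior is $\pi=\pi_Q\otimes\pi_f$ on $\Theta$ ($\pi_Q$ a probability on $\Delta_k^k$, $\pi_f$ a probability on $\mathcal F^k$) together with a fixed initial distribution $\mu\in\Delta_k$; the posterior is $\pi(A\mid Y_{1:n})=\int_A p_n^{\theta,\mu}(Y_{1:n})\pi(d\theta)\big/\int_\Theta p_n^{\theta,\mu}(Y_{1:n})\pi(d\theta)$. The observations $Y_1,Y_2,\dots$ are distributed according to $\mathbb P^{\theta^*}$ with $\theta^*=(Q^*,f^* )$, $f^*=(f_1^*,\dots,f_k^* )$. Notation: $\|M\|=\max_{i,j}|M_{i,j}|$ for $k\times k$ matrices; $d(g,\tilde g)=\max_{1\le j\le k}\|g_j-\tilde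 g_j\|_{L_1(\lambda)}$ on $\mathcal F^k$; $D_l(\theta,\theta')=\|p_l^\theta-p_l^{\theta'}\|_{L_1(\lambda^{\otimes l})}$; $N(\delta,A,D)$ is the minimal number $N$ of points $a_1,\dots,a_N$ such that every $a\in A$ satisfies $D(a,a_i)\le\delta$ for some $i$. Assumption (A1) (for given $\underline q>0$): there is $\epsilon_0>0$ such that for every $\epsilon\in(0,\epsilon_0)$ there is a set $\Theta_\epsilon\subset\Theta(\underline q)$ with $\pi(\Theta_\epsilon)>0$ such that every $\theta=(Q,f)\in\Theta_\epsilon$ satisfies: (A1a) $\|Q-Q^*\|<\epsilon$; (A1b) $\max_{1\le i\le k}\int f_i^*(y)\max_{1\le j\le k}\log\big(f_j^*(y)/f_j(y)\big)\lambda(dy)<\epsilon$; (A1c) for all $y$ with $\sum_i f_i^*(y)>0$, $\sum_j f_j(y)>0$; (A1d) $\sup_{y:\sum_i f_i^*(y)>0}\max_j f_j(y)<\infty$; (A1e) $\sum_{i=1}^k\int f_i^*(y)\,\big|\log\big(\sum_{j=1}^k f_j(y)\big)\big|\lambda(dy)<\infty$. Assumption (A2) (for given $\underline q>0$ and $l$): for every $\delta>0$ there exist sets $\mathcal F_n\subset\mathcal F^k$ ($n\ge1$) and constants $r_1>0$, $C>0$ such that $\pi_f(\mathcal F^k\setminus\mathcal F_n)\le Ce^{-nr_1}$ for all $n$ and $\sum_{n\ge1}N\big(\tfrac{\delta}{36l},\mathcal F_n,d\big)\exp\big(-\tfrac{n\delta^2k^2\underline q^2}{32l}\big)<\infty$.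 *)

theory Defs
  imports "HOL-Probability.Probability"
begin

text \<open>Hidden states are 0,...,k-1 (the paper's 1,...,k); matrices and vectors are
  functions on nat, only the entries with indices below k are relevant.
  Observation sequences y_{1:n} are functions ys with ys t = y_{t+1} for t < n.\<close>

definition prob_vecs :: "nat \<Rightarrow> (nat \<Rightarrow> real) set" where
  "prob_vecs k = {\<nu>. (\<forall>i<k. 0 \<le> \<nu> i) \<and> (\<forall>i\<ge>k. \<nu> i = 0) \<and> (\<Sum>i<k. \<nu> i) = 1}"

definition trans_mat :: "nat \<Rightarrow> (nat \<Rightarrow> nat \<Rightarrow> real) \<Rightarrow> bool" where
  "trans_mat k Q \<longleftrightarrow> (\<forall>i<k. (\<forall>j<k. 0 \<le> Q i j) \<and> (\<Sum>j<k. Q i j) = 1)"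

definition trans_mat_lb :: "nat \<Rightarrow> real \<Rightarrow> (nat \<Rightarrow> nat \<Rightarrow> real) \<Rightarrow> bool" where
  "trans_mat_lb k q Q \<longleftrightarrow> trans_mat k Q \<and> (\<forall>i<k. \<forall>j<k. q \<le> Q i j)"

text \<open>The (unique, when entries are positive) stationary distribution of Q.\<close>
definition stat_dist :: "nat \<Rightarrow> (nat \<Rightarrow> nat \<Rightarrow> real) \<Rightarrow> (nat \<Rightarrow> real)" where
  "stat_dist k Q = (THE \<nu>. \<nu> \<in> prob_vecs k \<and> (\<forall>j<k. (\<Sum>i<k. \<nu> i * Q i j) = \<nu> j))"

definition is_density :: "'y measure \<Rightarrow> ('y \<Rightarrow> real) \<Rightarrow> bool" where
  "is_density lam f \<longleftrightarrow> f \<in> borel_measurable lam \<and> (\<forall>y. 0 \<le> f y) \<and>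
     (\<integral>\<^sup>+ y. ennreal (f y) \<partial>lam) = 1"

definition densities :: "nat \<Rightarrow> 'y measure \<Rightarrow> (nat \<Rightarrow> 'y \<Rightarrow> real) \<Rightarrow> bool" where
  "densities k lam fs \<longleftrightarrow> (\<forall>j<k. is_density lam (fs j))"

definition Theta :: "nat \<Rightarrow> 'y measure \<Rightarrow> ((nat \<Rightarrow> nat \<Rightarrow> real) \<times> (nat \<Rightarrow> 'y \<Rightarrow> real)) set" where
  "Theta k lam = {(Q, fs). trans_mat k Q \<and> densities k lam fs}"

definition Theta_lb :: "nat \<Rightarrow> real \<Rightarrow> 'y measure \<Rightarrow> ((nat \<Rightarrow> nat \<Rightarrow> real) \<times> (nat \<Rightarrow> 'y \<Rightarrow> real)) set" where
  "Theta_lb k q lam = {(Q, fs). trans_mat_lb k q Q \<and> densities k lam fs}"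

definition hmm_dens :: "nat \<Rightarrow> (nat \<Rightarrow> nat \<Rightarrow> real) \<Rightarrow> (nat \<Rightarrow> 'y \<Rightarrow> real) \<Rightarrow> (nat \<Rightarrow> real)
    \<Rightarrow> nat \<Rightarrow> (nat \<Rightarrow> 'y) \<Rightarrow> real" where
  "hmm_dens k Q fs \<nu> n ys =
     (\<Sum>x\<in>(\<Pi>\<^sub>E t\<in>{..<n}. {..<k}).
        \<nu> (x 0) * (\<Prod>t\<in>{1..<n}. Q (x (t - 1)) (x t)) * (\<Prod>t<n. fs (x t) (ys t)))"

definition stat_dens :: "nat \<Rightarrow> (nat \<Rightarrow> nat \<Rightarrow> real) \<times> (nat \<Rightarrow> 'y \<Rightarrow> real) \<Rightarrow> nat \<Rightarrow> (nat \<Rightarrow> 'y) \<Rightarrow> real" where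
  "stat_dens k \<theta> n ys = hmm_dens k (fst \<theta>) (snd \<theta>) (stat_dist k (fst \<theta>)) n ys"

definition stat_law :: "nat \<Rightarrow> 'y measure \<Rightarrow> (nat \<Rightarrow> nat \<Rightarrow> real) \<times> (nat \<Rightarrow> 'y \<Rightarrow> real) \<Rightarrow> nat \<Rightarrow> (nat \<Rightarrow> 'y) measure" where
  "stat_law k lam \<theta> l = density (\<Pi>\<^sub>M t\<in>{..<l}. lam) (\<lambda>ys. ennreal (stat_dens k \<theta> l ys))"

definition D_dist :: "nat \<Rightarrow> 'y measure \<Rightarrow> nat \<Rightarrow> (nat \<Rightarrow> nat \<Rightarrow> real) \<times> (nat \<Rightarrow> 'y \<Rightarrow> real)
    \<Rightarrow> (nat \<Rightarrow> nat \<Rightarrow> real) \<times> (nat \<Rightarrow> 'y \<Rightarrow> real) \<Rightarrow> real" where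
  "D_dist k lam l \<theta> \<theta>' =
     (\<integral> ys. \<bar>stat_dens k \<theta> l ys - stat_dens k \<theta>' l ys\<bar> \<partial>(\<Pi>\<^sub>M t\<in>{..<l}. lam))"

definition posterior :: "nat \<Rightarrow> (nat \<Rightarrow> real) \<Rightarrow> ((nat \<Rightarrow> nat \<Rightarrow> real) \<times> (nat \<Rightarrow> 'y \<Rightarrow> real)) measure
    \<Rightarrow> nat \<Rightarrow> ((nat \<Rightarrow> nat \<Rightarrow> real) \<times> (nat \<Rightarrow> 'y \<Rightarrow> real)) set \<Rightarrow> (nat \<Rightarrow> 'y) \<Rightarrow> ennreal" where
  "posterior k \<mu> \<pi> n A ys =
     (\<integral>\<^sup>+ \<theta>. indicator A \<theta> * ennreal (hmm_dens k (fst \<theta>) (snd \<theta>) \<mu> n ys) \<partial>\<pi>) /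
     (\<integral>\<^sup>+ \<theta>. ennreal (hmm_dens k (fst \<theta>) (snd \<theta>) \<mu> n ys) \<partial>\<pi>)"

definition mat_norm :: "nat \<Rightarrow> (nat \<Rightarrow> nat \<Rightarrow> real) \<Rightarrow> real" where
  "mat_norm k M = Max {\<bar>M i j\<bar> | i j. i < k \<and> j < k}"

definition dens_dist :: "nat \<Rightarrow> 'y measure \<Rightarrow> (nat \<Rightarrow> 'y \<Rightarrow> real) \<Rightarrow> (nat \<Rightarrow> 'y \<Rightarrow> real) \<Rightarrow> real" where
  "dens_dist k lam g g' = Max ((\<lambda>j. \<integral> y. \<bar>g j y - g' j y\<bar> \<partial>lam) ` {..<k})"

text \<open>Covering number N(delta, A, D) with centres in the ambient set S
  (infinity if no finite cover exists).\<close>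
definition covering_number :: "'a set \<Rightarrow> ('a \<Rightarrow> 'a \<Rightarrow> real) \<Rightarrow> real \<Rightarrow> 'a set \<Rightarrow> ennreal" where
  "covering_number S D \<delta> A =
     (INF T \<in> {T. finite T \<and> T \<subseteq> S \<and> (\<forall>a\<in>A. \<exists>t\<in>T. D a t \<le> \<delta>)}. of_nat (card T))"

definition log_ratio :: "real \<Rightarrow> real \<Rightarrow> ereal" where
  "log_ratio a b = (if a = 0 then -\<infinity> else if b = 0 then \<infinity> else ereal (ln (a / b)))"

text \<open>The integral in (A1b): int f*_i(y) max_j log(f*_j(y)/f_j(y)) lam(dy), as an extended real
  (positive part minus negative part).\<close>
definition A1b_integral :: "nat \<Rightarrow> 'y measure \<Rightarrow> (nat \<Rightarrow> 'y \<Rightarrow> real) \<Rightarrow> (nat \<Rightarrow> 'y \<Rightarrow> real) \<Rightarrow> nat \<Rightarrow> ereal" where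
  "A1b_integral k lam fstar f i =
     (let g = (\<lambda>y. Max ((\<lambda>j. log_ratio (fstar j y) (f j y)) ` {..<k})) in
       enn2ereal (\<integral>\<^sup>+ y. ennreal (fstar i y) * e2ennreal (g y) \<partial>lam) -
       enn2ereal (\<integral>\<^sup>+ y. ennreal (fstar i y) * e2ennreal (- g y) \<partial>lam))"

definition assumption_A1 :: "nat \<Rightarrow> real \<Rightarrow> 'y measure \<Rightarrow> ((nat \<Rightarrow> nat \<Rightarrow> real) \<times> (nat \<Rightarrow> 'y \<Rightarrow> real)) measure
    \<Rightarrow> (nat \<Rightarrow> nat \<Rightarrow> real) \<Rightarrow> (nat \<Rightarrow> 'y \<Rightarrow> real) \<Rightarrow> bool" where
  "assumption_A1 k q lam \<pi> Qstar fstar \<longleftrightarrow>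
    (\<exists>\<epsilon>0>0. \<forall>\<epsilon>. 0 < \<epsilon> \<and> \<epsilon> < \<epsilon>0 \<longrightarrow>
      (\<exists>Th. Th \<subseteq> Theta_lb k q lam \<and> Th \<in> sets \<pi> \<and> emeasure \<pi> Th > 0 \<and>
        (\<forall>(Q, f)\<in>Th.
           mat_norm k (\<lambda>i j. Q i j - Qstar i j) < \<epsilon> \<and>
           Max ((\<lambda>i. A1b_integral k lam fstar f i) ` {..<k}) < ereal \<epsilon> \<and>
           (\<forall>y. (\<Sum>i<k. fstar i y) > 0 \<longrightarrow> (\<Sum>j<k. f j y) > 0) \<and>
           (\<exists>C. \<forall>y. (\<Sum>i<k. fstar i y) > 0 \<longrightarrow> (\<forall>j<k. f j y \<le> C)) \<and>
           (\<Sum>i<k. \<integral>\<^sup>+ y. ennreal (fstar i y * \<bar>ln (\<Sum>j<k. f j y)\<bar>) \<partial>lam) < \<infinity>)))"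

definition assumption_A2 :: "nat \<Rightarrow> real \<Rightarrow> nat \<Rightarrow> 'y measure \<Rightarrow> (nat \<Rightarrow> 'y \<Rightarrow> real) measure \<Rightarrow> bool" where
  "assumption_A2 k q l lam \<pi>f \<longleftrightarrow>
    (\<forall>\<delta>>0. \<exists>F :: nat \<Rightarrow> (nat \<Rightarrow> 'y \<Rightarrow> real) set. \<exists>r1>0. \<exists>C>0.
       (\<forall>n\<ge>1. F n \<subseteq> Collect (densities k lam) \<and>
          (\<exists>B\<in>sets \<pi>f. space \<pi>f - F n \<subseteq> B \<and> emeasure \<pi>f B \<le> ennreal (C * exp (- real n * r1)))) \<and>
       (\<Sum>n. covering_number (Collect (densities k lam)) (dens_dist k lam) (\<delta> / (36 * real l)) (F (Suc n))
              * ennreal (exp (- real (Suc n) * \<delta>^2 * real k^2 * q^2 / (32 * real l)))) < \<infinity>)"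

definition bounded_cont :: "nat \<Rightarrow> ((nat \<Rightarrow> 'y::topological_space) \<Rightarrow> real) \<Rightarrow> bool" where
  "bounded_cont l g \<longleftrightarrow> continuous_on (\<Pi>\<^sub>E t\<in>{..<l}. UNIV) g \<and> (\<exists>B. \<forall>x. \<bar>g x\<bar> \<le> B)"

definition weak_nhd :: "nat \<Rightarrow> (nat \<Rightarrow> 'y::topological_space) measure \<Rightarrow> (nat \<Rightarrow> 'y) measure set \<Rightarrow> bool" where
  "weak_nhd l P U \<longleftrightarrow>
    (\<exists>G \<epsilon>. finite G \<and> 0 < \<epsilon> \<and> (\<forall>g\<in>G. bounded_cont l g) \<and>
      {M. prob_space M \<and> sets M = sets (\<Pi>\<^sub>M t\<in>{..<l}. (borel :: 'y measure)) \<and>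
          (\<forall>g\<in>G. \<bar>(\<integral>x. g x \<partial>M) - (\<integral>x. g x \<partial>P)\<bar> < \<epsilon>)} \<subseteq> U)"

end

theory Submission
  imports Defs
begin

text \<open>
  Both parts compare numerator and denominator of the posterior with the true density \<open>p*\<^sub>n\<close>.

  Denominator: for \<open>\<theta>\<close> in the set \<open>\<Theta>\<^sub>\<epsilon>\<close> of (A1), comparing the sums over hidden paths term by term gives
  \<open>p\<^sub>n \<ge> q (1 - \<epsilon>/q)\<^sup>n exp (- \<Sum>\<^sub>t r (Y\<^sub>t)) p*\<^sub>n\<close>, where \<open>r\<close> is the positive part of the maximal log ratio in
  (A1b). The negative part is controlled by a Kullback-Leibler argument, so \<open>E r = O(\<surd>\<epsilon>)\<close>, and the maximal
  inequality for stationary sequences bounds \<open>\<Sum>\<^sub>t r (Y\<^sub>t)\<close> by \<open>c n\<close> for all \<open>n\<close> simultaneously, off an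
  event of probability \<open>O(\<surd>\<epsilon>)\<close>. Integrating over \<open>\<Theta>\<^sub>\<epsilon>\<close> and letting \<open>\<epsilon>\<close> tend to 0 yields an almost sure
  lower bound \<open>exp (- \<kappa> n) p*\<^sub>n\<close> for every \<open>\<kappa> > 0\<close>; no ergodic theorem is needed.

  Numerator: since all entries of \<open>Q\<close> are at least \<open>q\<close>, the hidden chain forgets its past geometrically,
  uniformly in \<open>\<theta>\<close>. Averages of a bounded function over windows of length \<open>l\<close> separated by a long enough gap
  therefore satisfy an exponential inequality, which gives exponentially powerful tests. Part (a) uses the
  functions that define the weak neighbourhood, part (b) the Scheffe sets of finitely many centres. As (A2) is
  assumed for every \<open>\<delta>\<close>, its constants play no role: a small \<open>\<delta>\<close> is chosen after the test exponent.
\<close>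

section \<open>Finite Markov chains\<close>

text \<open>Three obstacles shape the development. The likelihood is a sum over hidden paths, so its
  logarithm is not a sum over observations; taking the maximum of the log ratio over the states
  charges each observation one loss that is the same on every path. Only an upper bound on the
  accumulated loss is wanted, hence the positive part, to which a weak-type maximal inequality
  applies at a cost proportional to its mean. The exceptional event still depends on \<theta>;
  Fubini trades it for one event off which half of the prior mass of
  \<open>\<Theta>\<^sub>\<epsilon>\<close> is good at all sample sizes. Tests compare stationary
  laws, while the likelihood in the posterior starts from \<mu>. A block of \<open>g + l\<close>
  observations therefore discards its first \<open>g\<close>, and every one-block estimate is
  demanded for all initial laws, so that the Markov property can iterate it. Finally, sets of
  parameters must be measurable although \<open>stat_dist\<close> is a definite description. On
  \<open>Theta_lb\<close> it agrees with a limit of iterates, which depends measurably on the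
  transition matrix.\<close>

abbreviation seq_space :: "'y measure \<Rightarrow> nat \<Rightarrow> (nat \<Rightarrow> 'y) measure" where
  "seq_space lam n \<equiv> \<Pi>\<^sub>M t\<in>{..<n}. lam"

abbreviation paths :: "nat \<Rightarrow> nat \<Rightarrow> (nat \<Rightarrow> nat) set" where
  "paths k n \<equiv> \<Pi>\<^sub>E t\<in>{..<n}. {..<k}"

text \<open>Expectation of \<open>G (X\<^sub>1, \<dots>, X\<^sub>n)\<close> for the chain with initial law \<open>v\<close> and transition matrix \<open>Q\<close>.\<close>

fun chain_exp :: "nat \<Rightarrow> (nat \<Rightarrow> nat \<Rightarrow> real) \<Rightarrow> nat \<Rightarrow> (nat \<Rightarrow> real) \<Rightarrow> (nat list \<Rightarrow> real) \<Rightarrow> real" where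
  "chain_exp k Q 0 v G = G []"
| "chain_exp k Q (Suc n) v G = (\<Sum>i<k. v i * chain_exp k Q n (Q i) (\<lambda>xs. G (i # xs)))"

text \<open>Nothing is required outside the indices below \<open>k\<close>, unlike in
  \<open>prob_vecs\<close>: rows of a matrix satisfying \<open>trans_mat\<close> are constrained
  only there, and they must qualify as initial laws.\<close>

definition prob_row :: "nat \<Rightarrow> (nat \<Rightarrow> real) \<Rightarrow> bool" where
  "prob_row k v \<longleftrightarrow> (\<forall>i<k. 0 \<le> v i) \<and> (\<Sum>i<k. v i) = 1"

text \<open>The value 0 outside the state space puts the result into \<open>prob_vecs\<close>, so
  that stationarity becomes an equation between functions.\<close>

definition chain_step :: "nat \<Rightarrow> (nat \<Rightarrow> nat \<Rightarrow> real) \<Rightarrow> (nat \<Rightarrow> real) \<Rightarrow> nat \<Rightarrow> real" where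
  "chain_step k Q v = (\<lambda>j. if j < k then (\<Sum>i<k. v i * Q i j) else 0)"

definition path_weight :: "(nat \<Rightarrow> nat \<Rightarrow> real) \<Rightarrow> (nat \<Rightarrow> real) \<Rightarrow> nat \<Rightarrow> (nat \<Rightarrow> nat) \<Rightarrow> real" where
  "path_weight Q v n x = v (x 0) * (\<Prod>t\<in>{1..<n}. Q (x (t - 1)) (x t))"

lemma trans_mat_prob_row: "trans_mat k Q \<Longrightarrow> i < k \<Longrightarrow> prob_row k (Q i)"
  by (auto simp: trans_mat_def prob_row_def)

lemma prob_vecs_prob_row: "v \<in> prob_vecs k \<Longrightarrow> prob_row k v"
  by (auto simp: prob_vecs_def prob_row_def)

lemma trans_mat_lb_trans_mat: "trans_mat_lb k q Q \<Longrightarrow> trans_mat k Q"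
  by (simp add: trans_mat_lb_def)

text \<open>\<open>case_nat i x\<close> puts the state \<open>i\<close> in front of the path
  \<open>x\<close>. The first coordinate is split off, not the last, to match the recursion of
  \<open>chain_exp\<close>.\<close>

lemma sum_PiE_lessThan_Suc:
  fixes h :: "(nat \<Rightarrow> nat) \<Rightarrow> 'a::comm_monoid_add"
  shows "(\<Sum>x\<in>paths k (Suc n). h x)
    = (\<Sum>i<k. \<Sum>x\<in>paths k n. h (case_nat i x))"
proof -
  have "bij_betw (\<lambda>(i, x). case_nat i x) ({..<k} \<times> paths k n) (paths k (Suc n))"
    (is "bij_betw ?f ?A ?B")
  proof (rule bij_betw_byWitness[where f' = "\<lambda>x. (x 0, \<lambda>t. x (Suc t))"])
    show "\<forall>a\<in>?A. (case (?f a) of x \<Rightarrow> (x 0, \<lambda>t. x (Suc t))) = a" by auto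
    show "\<forall>x\<in>?B. ?f (x 0, \<lambda>t. x (Suc t)) = x"
      by (auto simp: fun_eq_iff split: nat.split)
    show "?f ` ?A \<subseteq> ?B"
    proof (clarsimp, intro PiE_I)
      fix i x t assume x: "i < k" "x \<in> paths k n"
      show "case_nat i x t \<in> {..<k}" if "t \<in> {..<Suc n}"
        using x that by (cases t) (auto dest: PiE_mem)
      show "case_nat i x t = undefined" if "t \<notin> {..<Suc n}"
        using that PiE_arb[OF x(2), of "t - 1"] by (cases t) auto
    qed
    show "(\<lambda>x. (x 0, \<lambda>t. x (Suc t))) ` ?B \<subseteq> ?A"
    proof (clarsimp, intro conjI PiE_I)
      fix x t assume x: "x \<in> paths k (Suc n)"
      show "x 0 < k" using PiE_mem[OF x, of 0] by simp
      show "x (Suc t) \<in> {..<k}" if "t \<in> {..<n}" using PiE_mem[OF x, of "Suc t"] that by simp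
      show "x (Suc t) = undefined" if "t \<notin> {..<n}" using PiE_arb[OF x, of "Suc t"] that by simp
    qed
  qed
  from sum.reindex_bij_betw[OF this, of h]
  show ?thesis by (simp add: sum.cartesian_product split_def)
qed

lemma path_weight_case_nat:
  assumes "n \<noteq> 0" shows "path_weight Q v (Suc n) (case_nat i x) = v i * path_weight Q (Q i) n x"
proof -
  obtain m where n: "n = Suc m" using assms by (cases n) auto
  have "(\<Prod>t\<in>{1..<Suc n}. Q (case_nat i x (t - 1)) (case_nat i x t))
     = (\<Prod>t<n. Q (case_nat i x t) (x t))"
    by (rule prod.reindex_bij_witness[of _ Suc "\<lambda>t. t - 1"]) (auto split: nat.split)
  also have "\<dots> = Q i (x 0) * (\<Prod>t<m. Q (x t) (x (Suc t)))"
    unfolding n by (subst prod.lessThan_Suc_shift) simp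
  also have "(\<Prod>t<m. Q (x t) (x (Suc t))) = (\<Prod>t\<in>{1..<n}. Q (x (t - 1)) (x t))"
    unfolding n by (rule prod.reindex_bij_witness[of _ "\<lambda>t. t - 1" Suc]) auto
  finally show ?thesis by (simp add: path_weight_def)
qed

text \<open>Links the recursive form, on which the inductions run, with the sum over paths in
  \<open>hmm_dens\<close>. For \<open>n = 0\<close> the only path is undefined everywhere and its
  weight would be a meaningless value of \<open>v\<close>.\<close>

lemma chain_exp_eq_sum:
  assumes "n \<noteq> 0"
  shows "chain_exp k Q n v G
    = (\<Sum>x\<in>paths k n. path_weight Q v n x * G (map x [0..<n]))"
  using assms
proof (induction n arbitrary: v G)
  case (Suc n)
  have m: "map (case_nat i x) [0..<Suc n] = i # map x [0..<n]" for i and x :: "nat \<Rightarrow> nat"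
    by (simp add: map_upt_Suc del: upt_Suc)
  show ?case
  proof (cases "n = 0")
    case True
    then show ?thesis unfolding sum_PiE_lessThan_Suc by (simp add: path_weight_def)
  next
    case False
    show ?thesis unfolding sum_PiE_lessThan_Suc m
      by (simp add: Suc.IH[OF False] path_weight_case_nat[OF False] sum_distrib_left mult.assoc)
  qed
qed simp

lemma hmm_dens_eq:
  "hmm_dens k Q fs v n ys
    = (\<Sum>x\<in>paths k n. path_weight Q v n x * (\<Prod>t<n. fs (x t) (ys t)))"
  by (simp add: hmm_dens_def path_weight_def)

lemma path_weight_nonneg:
  assumes "trans_mat k Q" "prob_row k v" "x \<in> paths k n" "n \<noteq> 0"
  shows "0 \<le> path_weight Q v n x"
proof -
  have "x t < k" if "t < n" for t using assms(3) that by auto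
  then show ?thesis using assms unfolding path_weight_def
    by (intro mult_nonneg_nonneg prod_nonneg) (auto simp: trans_mat_def prob_row_def)
qed

lemma chain_exp_mono:
  assumes "trans_mat k Q" "prob_row k v"
    and "\<And>xs. length xs = n \<Longrightarrow> set xs \<subseteq> {..<k} \<Longrightarrow> G xs \<le> G' xs"
  shows "chain_exp k Q n v G \<le> chain_exp k Q n v G'"
  using assms(2,3)
proof (induction n arbitrary: v G G')
  case (Suc n)
  show ?case unfolding chain_exp.simps
    using Suc.prems trans_mat_prob_row[OF assms(1)]
    by (intro sum_mono mult_left_mono Suc.IH) (auto simp: prob_row_def)
qed simp

lemma chain_exp_cong:
  assumes "\<And>xs. length xs = n \<Longrightarrow> set xs \<subseteq> {..<k} \<Longrightarrow> G xs = G' xs"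
  shows "chain_exp k Q n v G = chain_exp k Q n v G'"
  using assms
proof (induction n arbitrary: v G G')
  case (Suc n)
  show ?case unfolding chain_exp.simps
    using Suc.prems by (intro sum.cong refl arg_cong2[of _ _ _ _ "(*)"] Suc.IH) auto
qed simp

lemma chain_exp_const:
  assumes "trans_mat k Q" "prob_row k v"
  shows "chain_exp k Q n v (\<lambda>_. c) = c"
  using assms(2)
proof (induction n arbitrary: v)
  case (Suc n)
  have "chain_exp k Q (Suc n) v (\<lambda>_. c) = (\<Sum>i<k. v i * c)"
    using Suc.IH trans_mat_prob_row[OF assms(1)] by simp
  with Suc.prems show ?case by (simp add: prob_row_def flip: sum_distrib_right)
qed simp

lemma chain_exp_affine:
  assumes "trans_mat k Q" "prob_row k v"
  shows "chain_exp k Q n v (\<lambda>xs. a + b * G xs) = a + b * chain_exp k Q n v G"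
  using assms(2)
proof (induction n arbitrary: v G)
  case (Suc n)
  have "chain_exp k Q (Suc n) v (\<lambda>xs. a + b * G xs) = (\<Sum>i<k. v i * (a + b * chain_exp k Q n (Q i) (\<lambda>xs. G (i # xs))))"
    using Suc.IH trans_mat_prob_row[OF assms(1)] by simp
  also have "\<dots> = (\<Sum>i<k. v i) * a + b * (\<Sum>i<k. v i * chain_exp k Q n (Q i) (\<lambda>xs. G (i # xs)))"
    by (simp add: algebra_simps sum.distrib sum_distrib_left)
  finally show ?case using Suc.prems by (simp add: prob_row_def)
qed simp

lemma chain_exp_take:
  assumes "trans_mat k Q" "prob_row k v"
  shows "chain_exp k Q (n + m) v (\<lambda>xs. G (take n xs)) = chain_exp k Q n v G"
  using assms(2)
proof (induction n arbitrary: v G)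
  case 0
  then show ?case using chain_exp_const[OF assms(1), of v m "G []"] by simp
next
  case (Suc n)
  show ?case using Suc.IH[OF trans_mat_prob_row[OF assms(1)], of _ "\<lambda>xs. G (_ # xs)"] by simp
qed

text \<open>Interchanging two finite sums averages over the first state, which turns
  \<open>v\<close> into the law of the second state.\<close>

lemma chain_exp_step:
  assumes "trans_mat k Q" "prob_row k v"
  shows "chain_exp k Q (Suc n) v (\<lambda>xs. G (tl xs)) = chain_exp k Q n (chain_step k Q v) G"
proof (cases n)
  case 0
  then show ?thesis using assms(2) by (simp add: prob_row_def flip: sum_distrib_right)
next
  case (Suc m)
  show ?thesis unfolding Suc
    by (simp add: chain_step_def sum_distrib_left sum_distrib_right mult.assoc, subst sum.swap, simp)
qed

lemma prob_vecs_chain_step: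
  assumes "trans_mat k Q" "prob_row k v" shows "chain_step k Q v \<in> prob_vecs k"
proof -
  have "(\<Sum>j<k. \<Sum>i<k. v i * Q i j) = (\<Sum>i<k. v i * (\<Sum>j<k. Q i j))"
    by (subst sum.swap) (simp add: sum_distrib_left)
  also have "\<dots> = 1" using assms by (simp add: trans_mat_def prob_row_def)
  finally show ?thesis using assms
    by (auto simp: prob_vecs_def chain_step_def trans_mat_def prob_row_def intro!: sum_nonneg)
qed

lemma prob_row_chain_step_iter:
  assumes "trans_mat k Q" "prob_row k v" shows "prob_row k ((chain_step k Q ^^ g) v)"
  using assms(2) by (induction g) (auto intro: prob_vecs_prob_row prob_vecs_chain_step[OF assms(1)])

lemma chain_exp_drop:
  assumes "trans_mat k Q" "prob_row k v"
  shows "chain_exp k Q (g + n) v (\<lambda>xs. G (drop g xs)) = chain_exp k Q n ((chain_step k Q ^^ g) v) G"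
  using assms(2)
proof (induction g arbitrary: v)
  case (Suc g)
  have "chain_exp k Q (Suc g + n) v (\<lambda>xs. G (drop (Suc g) xs))
      = chain_exp k Q (Suc (g + n)) v (\<lambda>xs. (\<lambda>xs. G (drop g xs)) (tl xs))"
    by (simp add: drop_Suc)
  also have "\<dots> = chain_exp k Q (g + n) (chain_step k Q v) (\<lambda>xs. G (drop g xs))"
    using chain_exp_step[OF assms(1) Suc.prems] .
  also have "\<dots> = chain_exp k Q n ((chain_step k Q ^^ g) (chain_step k Q v)) G"
    by (rule Suc.IH) (intro prob_vecs_prob_row prob_vecs_chain_step assms Suc.prems)
  finally show ?case by (simp add: funpow_swap1)
qed simp

text \<open>Given the first \<open>m\<close> states, the remaining ones form a chain started from a
  row of \<open>Q\<close> (from \<open>v\<close> if \<open>m = 0\<close>). A bound on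
  \<open>B\<close> that is uniform in the initial law can therefore be pulled out, and nonnegativity
  of \<open>A\<close> preserves the inequality.\<close>

lemma chain_exp_le_product:
  assumes "trans_mat k Q" "prob_row k v"
    and "\<And>v. prob_row k v \<Longrightarrow> chain_exp k Q n v B \<le> C"
    and "\<And>xs. 0 \<le> A xs"
  shows "chain_exp k Q (m + n) v (\<lambda>xs. A (take m xs) * B (drop m xs)) \<le> C * chain_exp k Q m v A"
  using assms(2,4)
proof (induction m arbitrary: v A)
  case 0
  have "chain_exp k Q n v (\<lambda>xs. 0 + A [] * B xs) = 0 + A [] * chain_exp k Q n v B"
    by (rule chain_exp_affine[OF assms(1) 0(1)])
  then show ?case using mult_left_mono[OF assms(3)[OF 0(1)], of "A []"] 0(2) by (simp add: mult.commute)
next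
  case (Suc m)
  have "chain_exp k Q (Suc m + n) v (\<lambda>xs. A (take (Suc m) xs) * B (drop (Suc m) xs))
    = (\<Sum>i<k. v i * chain_exp k Q (m + n) (Q i) (\<lambda>xs. A (i # take m xs) * B (drop m xs)))"
    by simp
  also have "\<dots> \<le> (\<Sum>i<k. v i * (C * chain_exp k Q m (Q i) (\<lambda>xs. A (i # xs))))"
    using Suc.prems trans_mat_prob_row[OF assms(1)]
    by (intro sum_mono mult_left_mono Suc.IH) (auto simp: prob_row_def)
  finally show ?case by (simp add: sum_distrib_left mult.left_commute)
qed

lemma chain_exp_bounds:
  assumes "trans_mat k Q" "prob_row k v" "\<And>xs. length xs = n \<Longrightarrow> set xs \<subseteq> {..<k} \<Longrightarrow> 0 \<le> G xs \<and> G xs \<le> 1"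
  shows "0 \<le> chain_exp k Q n v G" "chain_exp k Q n v G \<le> 1"
  using chain_exp_mono[OF assms(1,2), of n "\<lambda>_. 0" G] chain_exp_mono[OF assms(1,2), of n G "\<lambda>_. 1"]
    chain_exp_const[OF assms(1,2)] assms(3) by auto

text \<open>The initial law acts only through the first state: conditionally on it both expectations
  coincide and lie between 0 and 1.\<close>

lemma chain_exp_diff_le:
  assumes "trans_mat k Q" "n \<noteq> 0" "\<And>xs. length xs = n \<Longrightarrow> set xs \<subseteq> {..<k} \<Longrightarrow> 0 \<le> G xs \<and> G xs \<le> 1"
  shows "\<bar>chain_exp k Q n v G - chain_exp k Q n w G\<bar> \<le> (\<Sum>i<k. \<bar>v i - w i\<bar>)"
proof -
  obtain m where n: "n = Suc m" using assms(2) by (cases n) auto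
  let ?c = "\<lambda>i. chain_exp k Q m (Q i) (\<lambda>xs. G (i # xs))"
  have c: "\<bar>?c i\<bar> \<le> 1" if "i < k" for i
    using chain_exp_bounds[OF assms(1) trans_mat_prob_row[OF assms(1) that], of m "\<lambda>xs. G (i # xs)"]
      assms(3) n that by auto
  have "\<bar>chain_exp k Q n v G - chain_exp k Q n w G\<bar> = \<bar>\<Sum>i<k. (v i - w i) * ?c i\<bar>"
    unfolding n by (simp add: sum_subtractf algebra_simps)
  also have "\<dots> \<le> (\<Sum>i<k. \<bar>(v i - w i) * ?c i\<bar>)" by (rule sum_abs)
  also have "\<dots> \<le> (\<Sum>i<k. \<bar>v i - w i\<bar>)"
    using c by (intro sum_mono) (auto simp: abs_mult mult_left_le)
  finally show ?thesis .
qed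

section \<open>Geometric forgetting and the stationary distribution\<close>

definition vec_dist :: "nat \<Rightarrow> (nat \<Rightarrow> real) \<Rightarrow> (nat \<Rightarrow> real) \<Rightarrow> real" where
  "vec_dist k v w = (\<Sum>i<k. \<bar>v i - w i\<bar>)"

lemma vec_dist_le_2:
  assumes "prob_row k v" "prob_row k w" shows "vec_dist k v w \<le> 2"
proof -
  have "vec_dist k v w \<le> (\<Sum>i<k. v i + w i)"
    unfolding vec_dist_def using assms by (intro sum_mono) (auto simp: prob_row_def abs_le_iff)
  also have "\<dots> = 2" using assms by (simp add: sum.distrib prob_row_def)
  finally show ?thesis .
qed

lemma trans_mat_lb_rate:
  assumes "trans_mat_lb k q Q" "1 \<le> k" shows "k * q \<le> 1"
proof -
  have "(\<Sum>j<k. q) \<le> (\<Sum>j<k. Q 0 j)"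
    using assms by (intro sum_mono) (auto simp: trans_mat_lb_def)
  then show ?thesis using assms by (simp add: trans_mat_lb_def trans_mat_def)
qed

text \<open>Doeblin's argument: \<open>v - w\<close> has total mass 0, so subtracting
  \<open>q\<close> from every entry of \<open>Q\<close> changes nothing, and the remaining matrix is
  nonnegative with row sums \<open>1 - k * q\<close>.\<close>

lemma vec_dist_chain_step:
  assumes "trans_mat_lb k q Q" "prob_row k v" "prob_row k w"
  shows "vec_dist k (chain_step k Q v) (chain_step k Q w) \<le> (1 - k * q) * vec_dist k v w"
proof -
  have z: "(\<Sum>i<k. v i - w i) = 0" using assms by (simp add: sum_subtractf prob_row_def)
  have "vec_dist k (chain_step k Q v) (chain_step k Q w) = (\<Sum>j<k. \<bar>\<Sum>i<k. (v i - w i) * (Q i j - q)\<bar>)"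
    unfolding vec_dist_def
  proof (rule sum.cong[OF refl])
    fix j assume "j \<in> {..<k}"
    have "(\<Sum>i<k. (v i - w i) * (Q i j - q)) = (\<Sum>i<k. (v i - w i) * Q i j) - (\<Sum>i<k. v i - w i) * q"
      unfolding sum_distrib_right sum_subtractf[symmetric] by (simp only: right_diff_distrib)
    then show "\<bar>chain_step k Q v j - chain_step k Q w j\<bar> = \<bar>\<Sum>i<k. (v i - w i) * (Q i j - q)\<bar>"
      using \<open>j \<in> {..<k}\<close> z by (simp add: chain_step_def sum_subtractf algebra_simps)
  qed
  also have "\<dots> \<le> (\<Sum>j<k. \<Sum>i<k. \<bar>v i - w i\<bar> * (Q i j - q))"
    using assms(1)
    by (intro sum_mono order_trans[OF sum_abs]) (auto simp: abs_mult trans_mat_lb_def)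
  also have "\<dots> = (\<Sum>i<k. \<bar>v i - w i\<bar> * (\<Sum>j<k. Q i j - q))"
    by (subst sum.swap) (simp add: sum_distrib_left)
  also have "\<dots> = (\<Sum>i<k. \<bar>v i - w i\<bar> * (1 - k * q))"
    using assms(1) by (simp add: sum_subtractf trans_mat_lb_def trans_mat_def)
  finally show ?thesis by (simp add: vec_dist_def sum_distrib_left mult.commute)
qed

lemma vec_dist_chain_step_iter:
  assumes "trans_mat_lb k q Q" "1 \<le> k" "prob_row k v" "prob_row k w"
  shows "vec_dist k ((chain_step k Q ^^ g) v) ((chain_step k Q ^^ g) w) \<le> 2 * (1 - k * q) ^ g"
proof (induction g)
  case 0
  then show ?case using vec_dist_le_2[OF assms(3,4)] by simp
next
  case (Suc g)
  note t = trans_mat_lb_trans_mat[OF assms(1)]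
  have "vec_dist k ((chain_step k Q ^^ Suc g) v) ((chain_step k Q ^^ Suc g) w)
     \<le> (1 - k * q) * vec_dist k ((chain_step k Q ^^ g) v) ((chain_step k Q ^^ g) w)"
    using vec_dist_chain_step[OF assms(1) prob_row_chain_step_iter[OF t assms(3)] prob_row_chain_step_iter[OF t assms(4)]]
    by simp
  also have "\<dots> \<le> (1 - k * q) * (2 * (1 - k * q) ^ g)"
    using trans_mat_lb_rate[OF assms(1,2)] Suc by (intro mult_left_mono) auto
  finally show ?case by simp
qed

lemma chain_step_fixed_iff:
  assumes "v \<in> prob_vecs k"
  shows "(\<forall>j<k. (\<Sum>i<k. v i * Q i j) = v j) \<longleftrightarrow> chain_step k Q v = v"
  using assms by (auto simp: chain_step_def fun_eq_iff prob_vecs_def not_less)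

text \<open>The stationary distribution as the limit of the laws of the chain started in state 0. In
  this form it is visibly measurable in \<open>Q\<close>, which the definite description
  \<open>stat_dist\<close> is not.\<close>

definition stat_limit :: "nat \<Rightarrow> (nat \<Rightarrow> nat \<Rightarrow> real) \<Rightarrow> nat \<Rightarrow> real" where
  "stat_limit k Q j = lim (\<lambda>n. (chain_step k Q ^^ n) (\<lambda>i. if i = 0 then 1 else 0) j)"

lemma vec_component_le: "j < k \<Longrightarrow> \<bar>v j - w j\<bar> \<le> vec_dist k v w"
  unfolding vec_dist_def using member_le_sum[of j "{..<k}" "\<lambda>i. \<bar>v i - w i\<bar>"] by auto

lemma stat_limit_stationary:
  assumes Q: "trans_mat_lb k q Q" and k: "1 \<le> k" and q: "0 < q"
  shows "stat_limit k Q \<in> prob_vecs k" "chain_step k Q (stat_limit k Q) = stat_limit k Q"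
proof -
  note t = trans_mat_lb_trans_mat[OF Q]
  define e where "e = (\<lambda>i::nat. if i = 0 then 1 else 0 :: real)"
  define a where "a n = (chain_step k Q ^^ n) e" for n
  have e: "prob_row k e" using k by (auto simp: prob_row_def e_def)
  have e': "e \<in> prob_vecs k" using k by (auto simp: prob_vecs_def e_def)
  have ap: "a n \<in> prob_vecs k" for n
    by (cases n) (auto simp: a_def e' intro!: prob_vecs_chain_step[OF t] prob_row_chain_step_iter[OF t e])
  have aS: "a (Suc n) = chain_step k Q (a n)" for n by (simp add: a_def)
  have r: "0 \<le> 1 - k * q" "1 - k * q < 1" using trans_mat_lb_rate[OF Q k] k q by auto
  have conv: "convergent (\<lambda>n. a n j)" if "j < k" for j
  proof -
    \<comment> \<open>The iterates with index \<open>n + 1\<close> and \<open>n\<close> are the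
      \<open>n\<close>-step images of \<open>a 1\<close> and of \<open>e\<close>, so the contraction
      makes the increments geometrically small and hence summable.\<close>
    have d: "\<bar>a (Suc n) j - a n j\<bar> \<le> 2 * (1 - k * q) ^ n" for n
    proof -
      have "vec_dist k ((chain_step k Q ^^ n) (a 1)) ((chain_step k Q ^^ n) e) \<le> 2 * (1 - k * q) ^ n"
        by (rule vec_dist_chain_step_iter[OF Q k prob_vecs_prob_row[OF ap] e])
      then show ?thesis using vec_component_le[OF that, of "a (Suc n)" "a n"]
        by (simp add: a_def funpow_swap1)
    qed
    have s: "summable (\<lambda>n. 2 * (1 - k * q) ^ n)"
      using r by (intro summable_mult summable_geometric) simp
    have "summable (\<lambda>n. a (Suc n) j - a n j)"
      by (rule summable_comparison_test'[OF s, of 0]) (simp only: real_norm_def d)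
    then have "convergent (\<lambda>n. a 0 j + (\<Sum>i<n. a (Suc i) j - a i j))"
      by (intro convergent_add convergent_const) (simp add: summable_iff_convergent)
    moreover have "a 0 j + (\<Sum>i<n. a (Suc i) j - a i j) = a n j" for n
      by (induction n) auto
    ultimately show ?thesis by simp
  qed
  have lim: "(\<lambda>n. a n j) \<longlonglongrightarrow> stat_limit k Q j" for j
  proof (cases "j < k")
    case True
    then show ?thesis using conv[OF True] unfolding stat_limit_def a_def e_def
      by (simp add: convergent_LIMSEQ_iff)
  next
    case False
    then have "(\<lambda>n. a n j) = (\<lambda>_. 0)" using ap by (auto simp: prob_vecs_def)
    then show ?thesis unfolding stat_limit_def a_def[symmetric] e_def[symmetric] by simp
  qed
  have "0 \<le> stat_limit k Q j" if "j < k" for j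
    using ap that by (intro LIMSEQ_le_const[OF lim]) (auto simp: prob_vecs_def)
  moreover have "stat_limit k Q j = 0" if "j \<ge> k" for j
    using lim[of j] ap that by (intro LIMSEQ_unique[OF lim]) (auto simp: prob_vecs_def)
  moreover have "(\<Sum>j<k. stat_limit k Q j) = 1"
  proof (rule LIMSEQ_unique)
    show "(\<lambda>n. \<Sum>j<k. a n j) \<longlonglongrightarrow> (\<Sum>j<k. stat_limit k Q j)" by (intro tendsto_sum lim)
    show "(\<lambda>n. \<Sum>j<k. a n j) \<longlonglongrightarrow> 1" using ap by (simp add: prob_vecs_def)
  qed
  ultimately show P: "stat_limit k Q \<in> prob_vecs k" by (auto simp: prob_vecs_def)
  show "chain_step k Q (stat_limit k Q) = stat_limit k Q"
  proof
    fix j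
    have "(\<lambda>n. chain_step k Q (a n) j) \<longlonglongrightarrow> chain_step k Q (stat_limit k Q) j"
      unfolding chain_step_def by (auto intro!: tendsto_sum tendsto_mult lim)
    moreover have "(\<lambda>n. chain_step k Q (a n) j) \<longlonglongrightarrow> stat_limit k Q j"
      using LIMSEQ_Suc[OF lim[of j]] by (simp add: aS)
    ultimately show "chain_step k Q (stat_limit k Q) j = stat_limit k Q j"
      by (rule LIMSEQ_unique)
  qed
qed

lemma stat_dist_eq_limit:
  assumes Q: "trans_mat_lb k q Q" and k: "1 \<le> k" and q: "0 < q"
  shows "stat_dist k Q = stat_limit k Q"
  unfolding stat_dist_def
proof (rule the_equality)
  note s = stat_limit_stationary[OF assms]
  show "stat_limit k Q \<in> prob_vecs k \<and> (\<forall>j<k. (\<Sum>i<k. stat_limit k Q i * Q i j) = stat_limit k Q j)"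
    using s chain_step_fixed_iff[OF s(1), of Q] by simp
  fix v assume v: "v \<in> prob_vecs k \<and> (\<forall>j<k. (\<Sum>i<k. v i * Q i j) = v j)"
  then have f: "chain_step k Q v = v" using chain_step_fixed_iff[of v k Q] by simp
  \<comment> \<open>Uniqueness: one step fixes both vectors and yet contracts their distance by a
    factor below 1.\<close>
  have "vec_dist k v (stat_limit k Q) \<le> (1 - k * q) * vec_dist k v (stat_limit k Q)"
    using vec_dist_chain_step[OF Q, of v "stat_limit k Q"] v s f prob_vecs_prob_row by auto
  then have "k * q * vec_dist k v (stat_limit k Q) \<le> 0" by (simp add: algebra_simps)
  moreover have "0 < k * q" using k q by simp
  ultimately have "vec_dist k v (stat_limit k Q) \<le> 0"
    by (meson linorder_not_less mult_pos_pos)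
  then have "v j = stat_limit k Q j" if "j < k" for j
    using vec_component_le[OF that, of v "stat_limit k Q"] by auto
  then show "v = stat_limit k Q" using v s by (auto simp: prob_vecs_def fun_eq_iff) (metis not_less)
qed

lemma stat_dist_stationary:
  assumes "trans_mat_lb k q Q" "1 \<le> k" "0 < q"
  shows "stat_dist k Q \<in> prob_vecs k" "chain_step k Q (stat_dist k Q) = stat_dist k Q"
  using stat_limit_stationary[OF assms] by (simp_all add: stat_dist_eq_limit[OF assms])

lemma stat_dist_iter:
  assumes "trans_mat_lb k q Q" "1 \<le> k" "0 < q"
  shows "(chain_step k Q ^^ n) (stat_dist k Q) = stat_dist k Q"
  by (induction n) (simp_all add: stat_dist_stationary[OF assms])

section \<open>Laws of the observations as mixtures over hidden paths\<close>

definition hmm_law :: "nat \<Rightarrow> 'y measure \<Rightarrow> (nat \<Rightarrow> nat \<Rightarrow> real) \<Rightarrow> (nat \<Rightarrow> 'y \<Rightarrow> real) \<Rightarrow> (nat \<Rightarrow> real)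
    \<Rightarrow> nat \<Rightarrow> (nat \<Rightarrow> 'y) measure" where
  "hmm_law k lam Q fs v n = density (seq_space lam n) (\<lambda>ys. ennreal (hmm_dens k Q fs v n ys))"

text \<open>The default state 0 beyond the end of the list gives a valid state at every time, so
  that the factors of \<open>path_law\<close> are probability measures at all indices, as
  \<open>product_prob_space\<close> demands. \<open>path_law\<close> is the conditional law of the
  observations given the hidden path.\<close>

definition state_at :: "nat list \<Rightarrow> nat \<Rightarrow> nat" where
  "state_at xs t = (if t < length xs then xs ! t else 0)"

definition path_law :: "'y measure \<Rightarrow> (nat \<Rightarrow> 'y \<Rightarrow> real) \<Rightarrow> nat list \<Rightarrow> (nat \<Rightarrow> 'y) measure" where
  "path_law lam fs xs = (\<Pi>\<^sub>M t\<in>{..<length xs}. density lam (\<lambda>y. ennreal (fs (state_at xs t) y)))"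

text \<open>The restriction makes the result a point of the space of \<open>seq_space lam l\<close>,
  whose points are undefined from index \<open>l\<close> on.\<close>

definition window :: "nat \<Rightarrow> nat \<Rightarrow> (nat \<Rightarrow> 'y) \<Rightarrow> nat \<Rightarrow> 'y" where
  "window s l ys = (\<lambda>t\<in>{..<l}. ys (s + t))"

lemma measurable_window[measurable]:
  "s + l \<le> n \<Longrightarrow> window s l \<in> measurable (seq_space lam n) (seq_space lam l)"
  unfolding window_def by (intro measurable_restrict measurable_component_singleton) auto

lemma sets_hmm_law[simp, measurable_cong]: "sets (hmm_law k lam Q fs v n) = sets (seq_space lam n)"
  by (simp add: hmm_law_def)

lemma space_hmm_law[simp]: "space (hmm_law k lam Q fs v n) = space (seq_space lam n)"
  by (simp add: hmm_law_def)

lemma sets_path_law[simp, measurable_cong]: "sets (path_law lam fs xs) = sets (seq_space lam (length xs))"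
  unfolding path_law_def by (intro sets_PiM_cong) auto

lemma space_path_law[simp]: "space (path_law lam fs xs) = space (seq_space lam (length xs))"
  by (rule sets_eq_imp_space_eq) simp

text \<open>Contains neither a transition matrix nor an initial law, since these vary inside the
  proofs. It is interpreted at \<open>fstar\<close> and at \<open>snd \<theta>\<close> for
  individual parameters.\<close>

locale emission = sigma_finite_measure lam for lam :: "'y measure" +
  fixes k :: nat and fs :: "nat \<Rightarrow> 'y \<Rightarrow> real"
  assumes k: "1 \<le> k" and dens: "densities k lam fs"
begin

sublocale PF: product_sigma_finite "\<lambda>_::nat. lam"
  by (unfold_locales)

lemma measurable_fs[measurable]: "i < k \<Longrightarrow> fs i \<in> borel_measurable lam"
  using dens by (auto simp: densities_def is_density_def)

lemma fs_nonneg: "i < k \<Longrightarrow> 0 \<le> fs i y"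
  using dens by (auto simp: densities_def is_density_def)

lemma prob_space_fs: "i < k \<Longrightarrow> prob_space (density lam (\<lambda>y. ennreal (fs i y)))"
  using dens by (intro prob_spaceI) (auto simp: emeasure_density densities_def is_density_def cong: nn_integral_cong)

lemma state_at_less: "set xs \<subseteq> {..<k} \<Longrightarrow> state_at xs t < k"
  using k by (auto simp: state_at_def subset_iff)

lemma prob_space_path_law: "set xs \<subseteq> {..<k} \<Longrightarrow> prob_space (path_law lam fs xs)"
  unfolding path_law_def by (intro prob_space_PiM prob_space_fs state_at_less)

text \<open>Checked on rectangles, where density and indicator both factor over time, so that the
  integral is a product of one-dimensional ones.\<close>

lemma path_law_density:
  assumes xs: "set xs \<subseteq> {..<k}"
  shows "path_law lam fs xs
    = density (seq_space lam (length xs)) (\<lambda>ys. ennreal (\<Prod>t<length xs. fs (xs ! t) (ys t)))"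
proof -
  let ?n = "length xs" and ?M = "\<lambda>t. density lam (\<lambda>y. ennreal (fs (state_at xs t) y))"
  have lt: "xs ! t < k" if "t < ?n" for t using xs that by (auto simp: subset_iff)
  interpret P: product_prob_space ?M
    by (intro product_prob_spaceI prob_space_fs state_at_less xs)
  have [measurable]: "(\<lambda>ys. \<Prod>t<?n. fs (xs ! t) (ys t)) \<in> borel_measurable (seq_space lam ?n)"
  proof (rule borel_measurable_prod)
    fix t assume t: "t \<in> {..<?n}"
    then have [measurable]: "fs (xs ! t) \<in> borel_measurable lam" using lt by auto
    have [measurable]: "(\<lambda>ys. ys t) \<in> measurable (seq_space lam ?n) lam" using t by measurable
    show "(\<lambda>ys. fs (xs ! t) (ys t)) \<in> borel_measurable (seq_space lam ?n)" by measurable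
  qed
  have "density (seq_space lam ?n) (\<lambda>ys. ennreal (\<Prod>t<?n. fs (xs ! t) (ys t))) = PiM {..<?n} ?M"
  proof (rule P.PiM_eqI)
    show "sets (density (seq_space lam ?n) (\<lambda>ys. ennreal (\<Prod>t<?n. fs (xs ! t) (ys t)))) = sets (PiM {..<?n} ?M)"
      by (simp cong: sets_PiM_cong)
    fix A assume A': "\<And>i. i \<in> {..<?n} \<Longrightarrow> A i \<in> sets (?M i)"
    then have A: "\<And>i. i < ?n \<Longrightarrow> A i \<in> sets lam" by simp
    then have [measurable]: "PiE {..<?n} A \<in> sets (seq_space lam ?n)"
      by (intro sets_PiM_I_finite) auto
    have "emeasure (density (seq_space lam ?n) (\<lambda>ys. ennreal (\<Prod>t<?n. fs (xs ! t) (ys t)))) (PiE {..<?n} A)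
      = (\<integral>\<^sup>+ys. ennreal (\<Prod>t<?n. fs (xs ! t) (ys t)) * indicator (PiE {..<?n} A) ys \<partial>(seq_space lam ?n))"
      by (rule emeasure_density) measurable
    also have "\<dots> = (\<integral>\<^sup>+ys. (\<Prod>t<?n. ennreal (fs (xs ! t) (ys t)) * indicator (A t) (ys t)) \<partial>(seq_space lam ?n))"
    proof (rule nn_integral_cong)
      fix ys assume ys: "ys \<in> space (seq_space lam ?n)"
      have "indicator (PiE {..<?n} A) ys = (\<Prod>t<?n. indicator (A t) (ys t) :: ennreal)"
        using ys by (auto simp: indicator_def PiE_iff space_PiM prod.neutral intro!: prod_zero)
      then show "ennreal (\<Prod>t<?n. fs (xs ! t) (ys t)) * indicator (PiE {..<?n} A) ys
        = (\<Prod>t<?n. ennreal (fs (xs ! t) (ys t)) * indicator (A t) (ys t))"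
        using lt fs_nonneg prod_ennreal[of "{..<?n}" "\<lambda>t. fs (xs ! t) (ys t)"]
        by (simp add: prod.distrib)
    qed
    also have "\<dots> = (\<Prod>t<?n. \<integral>\<^sup>+y. ennreal (fs (xs ! t) y) * indicator (A t) y \<partial>lam)"
    proof (rule PF.product_nn_integral_prod)
      fix i assume "i \<in> {..<?n}"
      then have [measurable]: "A i \<in> sets lam" "fs (xs ! i) \<in> borel_measurable lam" using A lt by auto
      show "(\<lambda>y. ennreal (fs (xs ! i) y) * indicator (A i) y) \<in> borel_measurable lam" by measurable
    qed simp
    also have "\<dots> = (\<Prod>t<?n. emeasure (?M t) (A t))"
      using A lt by (intro prod.cong refl) (auto simp: emeasure_density state_at_def)
    finally show "emeasure (density (seq_space lam ?n) (\<lambda>ys. ennreal (\<Prod>t<?n. fs (xs ! t) (ys t)))) (PiE {..<?n} A)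
       = (\<Prod>i\<in>{..<?n}. emeasure (?M i) (A i))" .
  qed simp
  then show ?thesis by (simp add: path_law_def)
qed

lemma measurable_path_dens[measurable]:
  assumes "x \<in> paths k n"
  shows "(\<lambda>ys. \<Prod>t<n. fs (x t) (ys t)) \<in> borel_measurable (seq_space lam n)"
proof (rule borel_measurable_prod)
  fix t assume t: "t \<in> {..<n}"
  then have [measurable]: "fs (x t) \<in> borel_measurable lam" using assms by (intro measurable_fs) auto
  have [measurable]: "(\<lambda>ys. ys t) \<in> measurable (seq_space lam n) lam" using t by measurable
  show "(\<lambda>ys. fs (x t) (ys t)) \<in> borel_measurable (seq_space lam n)" by measurable
qed

lemma measurable_hmm_dens[measurable]:
  "hmm_dens k Q fs v n \<in> borel_measurable (seq_space lam n)"
  unfolding hmm_dens_eq[abs_def]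
  by (intro borel_measurable_sum borel_measurable_times borel_measurable_const measurable_path_dens)

lemma hmm_dens_nonneg:
  assumes "trans_mat k Q" "prob_row k v" "n \<noteq> 0"
  shows "0 \<le> hmm_dens k Q fs v n ys"
  unfolding hmm_dens_eq
proof (intro sum_nonneg mult_nonneg_nonneg prod_nonneg)
  fix x assume x: "x \<in> paths k n"
  then show "0 \<le> path_weight Q v n x" using path_weight_nonneg assms by blast
  show "0 \<le> fs (x t) (ys t)" if "t \<in> {..<n}" for t
    using fs_nonneg[of "x t"] that x by auto
qed

lemma set_map_path: "x \<in> (\<Pi>\<^sub>E t\<in>{..<n}. S) \<Longrightarrow> set (map x [0..<n]) \<subseteq> S"
  by (metis PiE_mem atLeast_upt image_subsetI list.set_map)

lemma path_law_map:
  assumes "x \<in> paths k n"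
  shows "path_law lam fs (map x [0..<n]) = density (seq_space lam n) (\<lambda>ys. ennreal (\<Prod>t<n. fs (x t) (ys t)))"
proof -
  from path_law_density[OF set_map_path[OF assms]] show ?thesis by simp
qed

lemma integrable_path_law:
  fixes F :: "_ \<Rightarrow> real"
  assumes "set xs \<subseteq> {..<k}" "F \<in> borel_measurable (seq_space lam (length xs))" "\<And>ys. \<bar>F ys\<bar> \<le> B"
  shows "integrable (path_law lam fs xs) F"
proof -
  interpret prob_space "path_law lam fs xs" by (rule prob_space_path_law[OF assms(1)])
  show ?thesis using assms by (intro integrable_const_bound[of _ B]) auto
qed

text \<open>The density is a finite mixture over hidden paths, so integral and sum can be exchanged:
  first integrate the observations given the path, then average over the path. Boundedness of
  \<open>F\<close> supplies the integrability.\<close>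

lemma
  fixes F :: "_ \<Rightarrow> real"
  assumes Q: "trans_mat k Q" "prob_row k v" and n: "n \<noteq> 0"
    and F[measurable]: "F \<in> borel_measurable (seq_space lam n)" and B: "\<And>ys. \<bar>F ys\<bar> \<le> B"
  shows integral_hmm_law: "(\<integral>ys. F ys \<partial>hmm_law k lam Q fs v n)
      = chain_exp k Q n v (\<lambda>xs. \<integral>ys. F ys \<partial>path_law lam fs xs)"
    and integrable_hmm_law: "integrable (hmm_law k lam Q fs v n) F"
    and integrable_hmm_dens_mult: "integrable (seq_space lam n) (\<lambda>ys. hmm_dens k Q fs v n ys * F ys)"
proof -
  let ?L = "seq_space lam n" and ?E = "paths k n"
  have int: "integrable ?L (\<lambda>ys. (\<Prod>t<n. fs (x t) (ys t)) * F ys)"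
    and eq: "(\<integral>ys. F ys \<partial>path_law lam fs (map x [0..<n])) = (\<integral>ys. (\<Prod>t<n. fs (x t) (ys t)) * F ys \<partial>?L)"
    if x: "x \<in> ?E" for x
  proof -
    note [measurable] = measurable_path_dens[OF x]
    have nn: "0 \<le> (\<Prod>t<n. fs (x t) (ys t))" for ys
      using x fs_nonneg by (intro prod_nonneg) auto
    have "integrable (path_law lam fs (map x [0..<n])) F"
      by (intro integrable_path_law[OF set_map_path[OF x] _ B]) simp
    then show "integrable ?L (\<lambda>ys. (\<Prod>t<n. fs (x t) (ys t)) * F ys)"
      unfolding path_law_map[OF x] using nn by (subst (asm) integrable_density) auto
    show "(\<integral>ys. F ys \<partial>path_law lam fs (map x [0..<n])) = (\<integral>ys. (\<Prod>t<n. fs (x t) (ys t)) * F ys \<partial>?L)"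
      unfolding path_law_map[OF x] using nn by (subst integral_density) auto
  qed
  have split: "hmm_dens k Q fs v n ys * F ys
      = (\<Sum>x\<in>?E. path_weight Q v n x * ((\<Prod>t<n. fs (x t) (ys t)) * F ys))" for ys
    by (simp add: hmm_dens_eq sum_distrib_right mult.assoc)
  show I: "integrable ?L (\<lambda>ys. hmm_dens k Q fs v n ys * F ys)"
    unfolding split using int by (intro Bochner_Integration.integrable_sum integrable_mult_right) auto
  then show "integrable (hmm_law k lam Q fs v n) F"
    unfolding hmm_law_def using hmm_dens_nonneg[OF Q n] by (subst integrable_density) auto
  have "(\<integral>ys. F ys \<partial>hmm_law k lam Q fs v n) = (\<integral>ys. hmm_dens k Q fs v n ys * F ys \<partial>?L)"
    unfolding hmm_law_def using hmm_dens_nonneg[OF Q n] by (subst integral_density) auto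
  also have "\<dots> = (\<Sum>x\<in>?E. path_weight Q v n x * (\<integral>ys. (\<Prod>t<n. fs (x t) (ys t)) * F ys \<partial>?L))"
    unfolding split using int by (subst Bochner_Integration.integral_sum) auto
  also have "\<dots> = chain_exp k Q n v (\<lambda>xs. \<integral>ys. F ys \<partial>path_law lam fs xs)"
    unfolding chain_exp_eq_sum[OF n] using eq by (intro sum.cong) auto
  finally show "(\<integral>ys. F ys \<partial>hmm_law k lam Q fs v n)
      = chain_exp k Q n v (\<lambda>xs. \<integral>ys. F ys \<partial>path_law lam fs xs)" .
qed

lemma prob_space_hmm_law:
  assumes Q: "trans_mat k Q" "prob_row k v" and n: "n \<noteq> 0"
  shows "prob_space (hmm_law k lam Q fs v n)"
proof -
  have "integrable (hmm_law k lam Q fs v n) (\<lambda>_. 1::real)"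
    by (rule integrable_hmm_law[OF assms, of _ 1]) auto
  then interpret finite_measure "hmm_law k lam Q fs v n"
    by (intro finite_measureI) (auto simp: integrable_iff_bounded)
  have "(\<integral>ys. 1 \<partial>hmm_law k lam Q fs v n) = chain_exp k Q n v (\<lambda>xs. \<integral>ys. (1::real) \<partial>path_law lam fs xs)"
    by (rule integral_hmm_law[OF assms, of _ 1]) auto
  also have "\<dots> = chain_exp k Q n v (\<lambda>_. 1)"
    by (rule chain_exp_cong) (use prob_space.prob_space prob_space_path_law in fastforce)
  also have "\<dots> = 1" by (rule chain_exp_const[OF Q])
  finally have "measure (hmm_law k lam Q fs v n) (space (hmm_law k lam Q fs v n)) = 1" by simp
  then show ?thesis by (intro prob_spaceI) (simp add: emeasure_eq_measure)
qed

text \<open>Given the path, the law is a product indexed by time. Shifting the index and dropping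
  the other factors leaves those belonging to the states in the window.\<close>

lemma distr_path_law_window:
  assumes xs: "set xs \<subseteq> {..<k}" and s: "s + l \<le> length xs"
  shows "distr (path_law lam fs xs) (seq_space lam l) (window s l) = path_law lam fs (take l (drop s xs))"
proof -
  let ?M = "\<lambda>t. density lam (\<lambda>y. ennreal (fs (state_at xs t) y))"
  have "distr (PiM {..<length xs} ?M) (\<Pi>\<^sub>M t\<in>{..<l}. ?M (s + t)) (\<lambda>\<omega>. \<lambda>t\<in>{..<l}. \<omega> (s + t)) = (\<Pi>\<^sub>M t\<in>{..<l}. ?M (s + t))"
    using s by (intro distr_PiM_reindex prob_space_fs state_at_less xs) auto
  moreover have "(\<Pi>\<^sub>M t\<in>{..<l}. ?M (s + t)) = path_law lam fs (take l (drop s xs))"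
  proof -
    have "length (take l (drop s xs)) = l" using s by simp
    then show ?thesis unfolding path_law_def using s
      by (intro PiM_cong) (auto simp: state_at_def)
  qed
  moreover have "distr (PiM {..<length xs} ?M) (\<Pi>\<^sub>M t\<in>{..<l}. ?M (s + t)) (\<lambda>\<omega>. \<lambda>t\<in>{..<l}. \<omega> (s + t))
     = distr (path_law lam fs xs) (seq_space lam l) (window s l)"
    by (rule distr_cong) (auto simp: path_law_def window_def cong: sets_PiM_cong)
  ultimately show ?thesis by simp
qed

lemma integral_path_law_window:
  fixes F :: "_ \<Rightarrow> real"
  assumes xs: "set xs \<subseteq> {..<k}" and s: "s + l \<le> length xs" and [measurable]: "F \<in> borel_measurable (seq_space lam l)"
  shows "(\<integral>ys. F (window s l ys) \<partial>path_law lam fs xs) = (\<integral>ys. F ys \<partial>path_law lam fs (take l (drop s xs)))"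
  unfolding distr_path_law_window[OF xs s, symmetric]
  using s by (subst integral_distr) auto

lemma indep_vars_path_law:
  assumes xs: "set xs \<subseteq> {..<k}" "xs \<noteq> []"
  shows "prob_space.indep_vars (path_law lam fs xs) (\<lambda>_. lam) (\<lambda>t ys. ys t) {..<length xs}"
proof -
  interpret prob_space "path_law lam fs xs" by (rule prob_space_path_law[OF xs(1)])
  let ?M = "\<lambda>t. density lam (\<lambda>y. ennreal (fs (state_at xs t) y))"
  let ?I = "{..<length xs}"
  interpret P: product_prob_space ?M
    by (intro product_prob_spaceI prob_space_fs state_at_less xs)
  have rv: "(\<lambda>ys. ys t) \<in> measurable (path_law lam fs xs) lam" if "t \<in> ?I" for t
    using that by (simp cong: measurable_cong_sets)
  have "distr (path_law lam fs xs) (\<Pi>\<^sub>M i\<in>?I. lam) (\<lambda>x. \<lambda>i\<in>?I. x i) = distr (path_law lam fs xs) (path_law lam fs xs) (\<lambda>x. x)"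
    by (rule distr_cong) (auto simp: space_PiM PiE_def extensional_restrict)
  also have "\<dots> = (\<Pi>\<^sub>M i\<in>?I. ?M i)" by (simp add: distr_id path_law_def)
  also have "\<dots> = (\<Pi>\<^sub>M i\<in>?I. distr (path_law lam fs xs) lam (\<lambda>ys. ys i))"
  proof (rule PiM_cong[OF refl])
    fix i assume i: "i \<in> ?I"
    have "distr (path_law lam fs xs) lam (\<lambda>ys. ys i) = distr (PiM ?I ?M) (?M i) (\<lambda>ys. ys i)"
      unfolding path_law_def by (rule distr_cong) auto
    also have "\<dots> = ?M i" using i by (intro distr_PiM_component) (auto intro!: prob_space_fs state_at_less xs)
    finally show "?M i = distr (path_law lam fs xs) lam (\<lambda>ys. ys i)" by simp
  qed
  finally show ?thesis using xs rv
    by (subst indep_vars_iff_distr_eq_PiM') auto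
qed

text \<open>Given the path the observations are independent, and the windows occupy disjoint sets of
  times because each lies within its own block. All remaining dependence between blocks is carried
  by the path.\<close>

lemma integral_path_law_blocks:
  fixes F :: "_ \<Rightarrow> real"
  assumes xs: "set xs \<subseteq> {..<k}" "xs \<noteq> []" and gl: "g + l \<le> L" and N: "N * L \<le> length xs"
    and F[measurable]: "F \<in> borel_measurable (seq_space lam l)" and B: "\<And>ys. \<bar>F ys\<bar> \<le> B"
  shows "(\<integral>ys. (\<Prod>b<N. F (window (b * L + g) l ys)) \<partial>path_law lam fs xs)
    = (\<Prod>b<N. \<integral>ys. F ys \<partial>path_law lam fs (take l (drop (b * L + g) xs)))"
proof -
  interpret prob_space "path_law lam fs xs" by (rule prob_space_path_law[OF xs(1)])
  have le: "b * L + g + l \<le> length xs" if "b < N" for b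
  proof -
    have "b * L + g + l \<le> Suc b * L" using gl by simp
    also have "\<dots> \<le> N * L" using that by (intro mult_right_mono) auto
    finally show ?thesis using N by simp
  qed
  define K where "K b = {b * L + g..<b * L + g + l}" for b
  \<comment> \<open>\<open>indep_vars_restrict\<close> yields independence of the observations
    restricted to the sets \<open>K b\<close>, and a window reads no other coordinate.\<close>
  have sub: "window (b * L + g) l (restrict ys (K b)) = window (b * L + g) l ys" for b and ys :: "nat \<Rightarrow> 'y"
    by (auto simp: window_def K_def fun_eq_iff)
  have disj: "disjoint_family_on K {..<N}"
  proof -
    have "K a \<inter> K b = {}" if "a < b" for a b
    proof -
      have "a * L + g + l \<le> Suc a * L" using gl by simp
      also have "\<dots> \<le> b * L" using that by (intro mult_right_mono) auto
      finally show ?thesis unfolding K_def by auto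
    qed
    then show ?thesis unfolding disjoint_family_on_def by (metis Int_commute linorder_neqE_nat)
  qed
  have "indep_vars (\<lambda>b. PiM (K b) (\<lambda>_. lam)) (\<lambda>b ys. restrict (\<lambda>t. ys t) (K b)) {..<N}"
    using le disj by (intro indep_vars_restrict[OF indep_vars_path_law[OF xs]]) (fastforce simp: K_def)+
  then have "indep_vars (\<lambda>_. borel) (\<lambda>b ys. F (window (b * L + g) l (restrict ys (K b)))) {..<N}"
  proof (rule indep_vars_compose2)
    fix b
    have "(\<lambda>ys. window (b * L + g) l ys) \<in> measurable (PiM (K b) (\<lambda>_. lam)) (seq_space lam l)"
      unfolding window_def by (intro measurable_restrict measurable_component_singleton) (auto simp: K_def)
    then show "(\<lambda>ys. F (window (b * L + g) l ys)) \<in> borel_measurable (PiM (K b) (\<lambda>_. lam))" by measurable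
  qed
  then have ind: "indep_vars (\<lambda>_. borel) (\<lambda>b ys. F (window (b * L + g) l ys)) {..<N}"
    by (simp only: sub)
  have "(\<integral>ys. (\<Prod>b<N. F (window (b * L + g) l ys)) \<partial>path_law lam fs xs)
    = (\<Prod>b<N. \<integral>ys. F (window (b * L + g) l ys) \<partial>path_law lam fs xs)"
  proof (rule indep_vars_lebesgue_integral[OF _ ind])
    fix b assume "b \<in> {..<N}"
    then have "(\<lambda>ys. F (window (b * L + g) l ys)) \<in> borel_measurable (path_law lam fs xs)"
      using le[of b] by simp
    then show "integrable (path_law lam fs xs) (\<lambda>ys. F (window (b * L + g) l ys))"
      using B by (intro integrable_const_bound[of _ B]) auto
  qed simp
  also have "\<dots> = (\<Prod>b<N. \<integral>ys. F ys \<partial>path_law lam fs (take l (drop (b * L + g) xs)))"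
    using le by (intro prod.cong refl integral_path_law_window xs F) auto
  finally show ?thesis .
qed

end

section \<open>Deviation and maximal inequalities\<close>

text \<open>For negative \<open>u\<close> one has \<open>exp u \<le> 1 / (1 - u)\<close> from the
  tangent bound at \<open>- u\<close>, while \<open>(1 + u + u^2) * (1 - u) = 1 - u^3\<close> is at
  least 1.\<close>

lemma exp_le_quadratic:
  fixes u :: real
  assumes "u \<le> 1" shows "exp u \<le> 1 + u + u\<^sup>2"
proof (cases "0 \<le> u")
  case True
  then show ?thesis using assms exp_bound by blast
next
  case False
  have "1 - u \<le> exp (- u)" using exp_ge_add_one_self[of "- u"] by simp
  then have "exp u * (1 - u) \<le> exp u * exp (- u)" by (intro mult_left_mono) auto
  also have "\<dots> = 1" by (simp add: exp_minus_inverse)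
  also have "1 \<le> 1 - u ^ 3" using False by (simp add: power_le_zero_eq)
  also have "\<dots> = (1 + u + u\<^sup>2) * (1 - u)"
    by (simp add: algebra_simps power2_eq_square power3_eq_cube)
  finally show ?thesis using False by (simp add: mult_le_cancel_right)
qed

context emission
begin

text \<open>After conditioning on the path only the states of the window matter. The Markov property
  replaces the states before it by the law at time \<open>s\<close>, and those after it integrate
  out.\<close>

lemma integral_hmm_law_window:
  fixes F :: "_ \<Rightarrow> real"
  assumes Q: "trans_mat k Q" "prob_row k v" and l: "l \<noteq> 0" "s + l \<le> n"
    and F[measurable]: "F \<in> borel_measurable (seq_space lam l)" and B: "\<And>ys. \<bar>F ys\<bar> \<le> B"
  shows "(\<integral>ys. F (window s l ys) \<partial>hmm_law k lam Q fs v n)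
    = (\<integral>ys. F ys \<partial>hmm_law k lam Q fs ((chain_step k Q ^^ s) v) l)"
proof -
  obtain m where n: "n = s + (l + m)" using l by (metis add.assoc le_Suc_ex)
  have Q': "prob_row k ((chain_step k Q ^^ s) v)" by (rule prob_row_chain_step_iter[OF Q])
  have [measurable]: "(\<lambda>ys. F (window s l ys)) \<in> borel_measurable (seq_space lam n)"
    using l(2) by measurable
  have "(\<integral>ys. F (window s l ys) \<partial>hmm_law k lam Q fs v n)
     = chain_exp k Q n v (\<lambda>xs. \<integral>ys. F (window s l ys) \<partial>path_law lam fs xs)"
    by (rule integral_hmm_law[OF Q, of _ _ B]) (use l B in auto)
  also have "\<dots> = chain_exp k Q n v (\<lambda>xs. \<integral>ys. F ys \<partial>path_law lam fs (take l (drop s xs)))"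
    by (rule chain_exp_cong, rule integral_path_law_window) (use l in auto)
  also have "\<dots> = chain_exp k Q (l + m) ((chain_step k Q ^^ s) v) (\<lambda>xs. \<integral>ys. F ys \<partial>path_law lam fs (take l xs))"
    unfolding n by (rule chain_exp_drop[OF Q])
  also have "\<dots> = chain_exp k Q l ((chain_step k Q ^^ s) v) (\<lambda>xs. \<integral>ys. F ys \<partial>path_law lam fs xs)"
    by (rule chain_exp_take[OF Q(1) Q'])
  also have "\<dots> = (\<integral>ys. F ys \<partial>hmm_law k lam Q fs ((chain_step k Q ^^ s) v) l)"
    by (rule integral_hmm_law[OF Q(1) Q', of _ _ B, symmetric]) (use l B in auto)
  finally show ?thesis .
qed

lemma distr_hmm_law_window:
  assumes Q: "trans_mat k Q" "prob_row k v" and l: "l \<noteq> 0" "s + l \<le> n"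
  shows "distr (hmm_law k lam Q fs v n) (seq_space lam l) (window s l)
    = hmm_law k lam Q fs ((chain_step k Q ^^ s) v) l"
proof (rule measure_eqI)
  have Q': "prob_row k ((chain_step k Q ^^ s) v)" by (rule prob_row_chain_step_iter[OF Q])
  interpret A: prob_space "hmm_law k lam Q fs v n" using l by (intro prob_space_hmm_law Q) auto
  interpret B: prob_space "hmm_law k lam Q fs ((chain_step k Q ^^ s) v) l"
    using l by (intro prob_space_hmm_law Q Q') auto
  have w[measurable]: "window s l \<in> measurable (hmm_law k lam Q fs v n) (seq_space lam l)"
    using l(2) by measurable
  interpret C: prob_space "distr (hmm_law k lam Q fs v n) (seq_space lam l) (window s l)"
    by (rule A.prob_space_distr[OF w])
  fix X assume "X \<in> sets (distr (hmm_law k lam Q fs v n) (seq_space lam l) (window s l))"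
  then have X[measurable]: "X \<in> sets (seq_space lam l)" by simp
  have "C.prob X = (\<integral>ys. indicator X ys \<partial>distr (hmm_law k lam Q fs v n) (seq_space lam l) (window s l))"
    by simp
  also have "\<dots> = (\<integral>ys. indicator X (window s l ys) \<partial>hmm_law k lam Q fs v n)"
    by (rule integral_distr) measurable
  also have "\<dots> = (\<integral>ys. indicator X ys \<partial>hmm_law k lam Q fs ((chain_step k Q ^^ s) v) l)"
    by (rule integral_hmm_law_window[OF Q l, of _ 1]) (auto simp: indicator_def)
  also have "\<dots> = B.prob X" by simp
  finally show "emeasure (distr (hmm_law k lam Q fs v n) (seq_space lam l) (window s l)) X
     = emeasure (hmm_law k lam Q fs ((chain_step k Q ^^ s) v) l) X"
    by (simp add: C.emeasure_eq_measure B.emeasure_eq_measure)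
qed simp

text \<open>Peel off the first block. The later blocks then start from an unknown row of
  \<open>Q\<close>, which is why the one-block bound is assumed for every initial law; the gap at
  the front of a block replaces that law by its \<open>g\<close>-step image. The \<open>m\<close>
  states after the last full block integrate out.\<close>

lemma chain_exp_blocks_le:
  assumes Q: "trans_mat k Q" "prob_row k v" and C: "0 \<le> C"
    and le: "\<And>v. prob_row k v \<Longrightarrow> chain_exp k Q l ((chain_step k Q ^^ g) v) G \<le> C"
    and G: "\<And>xs. 0 \<le> G xs"
  shows "chain_exp k Q (N * (g + l) + m) v (\<lambda>xs. \<Prod>b<N. G (take l (drop (b * (g + l) + g) xs))) \<le> C ^ N"
  using Q(2)
proof (induction N arbitrary: v)
  case 0
  then show ?case by (simp add: chain_exp_const[OF Q(1)])
next
  case (Suc N)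
  let ?L = "g + l"
  have "chain_exp k Q (Suc N * ?L + m) v (\<lambda>xs. \<Prod>b<Suc N. G (take l (drop (b * ?L + g) xs)))
    = chain_exp k Q (?L + (N * ?L + m)) v (\<lambda>xs. (\<lambda>xs. G (take l (drop g xs))) (take ?L xs)
        * (\<lambda>xs. \<Prod>b<N. G (take l (drop (b * ?L + g) xs))) (drop ?L xs))"
    by (simp add: prod.lessThan_Suc_shift drop_take add.assoc add.commute add.left_commute del: prod.lessThan_Suc)
  also have "\<dots> \<le> C ^ N * chain_exp k Q ?L v (\<lambda>xs. G (take l (drop g xs)))"
    using Suc by (intro chain_exp_le_product Q G) auto
  also have "\<dots> = C ^ N * chain_exp k Q l ((chain_step k Q ^^ g) v) G"
    using chain_exp_drop[OF Q(1) Suc.prems, of g l "\<lambda>xs. G (take l xs)"]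
    by (simp cong: chain_exp_cong)
  also have "\<dots> \<le> C ^ N * C" using le[OF Suc.prems] C by (intro mult_left_mono) auto
  finally show ?case by (simp add: mult.commute)
qed

lemma integral_hmm_law_blocks_le:
  fixes F :: "_ \<Rightarrow> real"
  assumes Q: "trans_mat k Q" "prob_row k v" and l: "l \<noteq> 0" and n: "n \<noteq> 0" "N * (g + l) \<le> n"
    and F[measurable]: "F \<in> borel_measurable (seq_space lam l)" and B: "\<And>ys. \<bar>F ys\<bar> \<le> B"
    and F0: "\<And>ys. 0 \<le> F ys"
    and C: "0 \<le> C" "\<And>v. prob_row k v \<Longrightarrow> (\<integral>ys. F ys \<partial>hmm_law k lam Q fs ((chain_step k Q ^^ g) v) l) \<le> C"
  shows "(\<integral>ys. (\<Prod>b<N. F (window (b * (g + l) + g) l ys)) \<partial>hmm_law k lam Q fs v n) \<le> C ^ N"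
    and "integrable (hmm_law k lam Q fs v n) (\<lambda>ys. \<Prod>b<N. F (window (b * (g + l) + g) l ys))"
proof -
  let ?L = "g + l"
  obtain m where m: "n = N * ?L + m" using n by (metis le_Suc_ex)
  have le: "b * ?L + g + l \<le> n" if "b < N" for b
  proof -
    have "b * ?L + g + l = Suc b * ?L" by simp
    also have "\<dots> \<le> N * ?L" using that by (intro mult_right_mono) auto
    finally show ?thesis using n by simp
  qed
  have meas: "(\<lambda>ys. \<Prod>b<N. F (window (b * ?L + g) l ys)) \<in> borel_measurable (seq_space lam n)"
  proof (rule borel_measurable_prod)
    fix b assume "b \<in> {..<N}"
    then have "b * ?L + g + l \<le> n" using le by simp
    then show "(\<lambda>ys. F (window (b * ?L + g) l ys)) \<in> borel_measurable (seq_space lam n)"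
      by measurable
  qed
  have bd: "\<bar>\<Prod>b<N. F (window (b * ?L + g) l ys)\<bar> \<le> B ^ N" for ys
    unfolding abs_prod using prod_mono[of "{..<N}" "\<lambda>b. \<bar>F (window (b * ?L + g) l ys)\<bar>" "\<lambda>_. B"] B by simp
  show "integrable (hmm_law k lam Q fs v n) (\<lambda>ys. \<Prod>b<N. F (window (b * (g + l) + g) l ys))"
    by (rule integrable_hmm_law[OF Q n(1) meas bd])
  let ?G = "\<lambda>xs. \<integral>ys. F ys \<partial>path_law lam fs xs"
  have "(\<integral>ys. (\<Prod>b<N. F (window (b * ?L + g) l ys)) \<partial>hmm_law k lam Q fs v n)
    = chain_exp k Q n v (\<lambda>xs. \<integral>ys. (\<Prod>b<N. F (window (b * ?L + g) l ys)) \<partial>path_law lam fs xs)"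
    by (rule integral_hmm_law[OF Q n(1) meas bd])
  also have "\<dots> = chain_exp k Q n v (\<lambda>xs. \<Prod>b<N. ?G (take l (drop (b * ?L + g) xs)))"
    by (rule chain_exp_cong, rule integral_path_law_blocks[OF _ _ _ _ F B]) (use n in auto)
  also have "\<dots> \<le> C ^ N" unfolding m
  proof (rule chain_exp_blocks_le[OF Q C(1)])
    fix v assume v: "prob_row k v"
    have "chain_exp k Q l ((chain_step k Q ^^ g) v) ?G = (\<integral>ys. F ys \<partial>hmm_law k lam Q fs ((chain_step k Q ^^ g) v) l)"
      by (rule integral_hmm_law[OF Q(1) prob_row_chain_step_iter[OF Q(1) v] l F B, symmetric])
    then show "chain_exp k Q l ((chain_step k Q ^^ g) v) ?G \<le> C" using C(2)[OF v] by simp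
  qed (simp add: F0)
  finally show "(\<integral>ys. (\<Prod>b<N. F (window (b * (g + l) + g) l ys)) \<partial>hmm_law k lam Q fs v n) \<le> C ^ N" .
qed

lemma integral_hmm_law_vec_dist:
  fixes H :: "_ \<Rightarrow> real"
  assumes Q: "trans_mat k Q" "prob_row k v" "prob_row k w" and l: "l \<noteq> 0"
    and H[measurable]: "H \<in> borel_measurable (seq_space lam l)" and H01: "\<And>ys. 0 \<le> H ys \<and> H ys \<le> 1"
  shows "\<bar>(\<integral>ys. H ys \<partial>hmm_law k lam Q fs v l) - (\<integral>ys. H ys \<partial>hmm_law k lam Q fs w l)\<bar> \<le> vec_dist k v w"
proof -
  have B: "\<bar>H ys\<bar> \<le> 1" for ys using H01[of ys] by simp
  let ?G = "\<lambda>xs. \<integral>ys. H ys \<partial>path_law lam fs xs"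
  have "0 \<le> ?G xs \<and> ?G xs \<le> 1" if xs: "length xs = l" "set xs \<subseteq> {..<k}" for xs
  proof -
    interpret prob_space "path_law lam fs xs" by (rule prob_space_path_law[OF xs(2)])
    have "integrable (path_law lam fs xs) H" using xs by (intro integrable_path_law[OF _ _ B]) auto
    then have "?G xs \<le> (\<integral>ys. 1 \<partial>path_law lam fs xs)" using H01 by (intro integral_mono) auto
    then show ?thesis using H01 prob_space by (auto intro!: integral_nonneg)
  qed
  then have "\<bar>chain_exp k Q l v ?G - chain_exp k Q l w ?G\<bar> \<le> vec_dist k v w"
    unfolding vec_dist_def by (intro chain_exp_diff_le Q l)
  then show ?thesis
    by (simp add: integral_hmm_law[OF Q(1,2) l H B] integral_hmm_law[OF Q(1,3) l H B])
qed

text \<open>Chernoff's method. Whatever the law at the start of a block, after \<open>g\<close>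
  steps it is within \<open>\<gamma> / 4\<close> of stationarity, so the mean of \<open>H\<close> in
  the window exceeds \<open>e\<close> by at most that. Iterating the resulting exponential moment
  over blocks gives a bound that depends neither on the parameter nor on the initial law.\<close>

lemma block_deviation:
  fixes H :: "_ \<Rightarrow> real" and q :: real
  assumes Q: "trans_mat_lb k q Q" "prob_row k v" and q: "0 < q" and l: "l \<noteq> 0"
    and n: "n \<noteq> 0" "N * (g + l) \<le> n"
    and H[measurable]: "H \<in> borel_measurable (seq_space lam l)" and H01: "\<And>ys. 0 \<le> H ys \<and> H ys \<le> 1"
    and \<gamma>: "0 < \<gamma>" "\<gamma> \<le> 1" "2 * (1 - k * q) ^ g \<le> \<gamma> / 4"
  defines "e \<equiv> \<integral>ys. H ys \<partial>hmm_law k lam Q fs (stat_dist k Q) l"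
  shows "measure (hmm_law k lam Q fs v n)
      {ys \<in> space (seq_space lam n). N * (e + \<gamma>) \<le> (\<Sum>b<N. H (window (b * (g + l) + g) l ys))}
    \<le> exp (- (N * \<gamma>\<^sup>2 / 8))" (is "measure ?P ?S \<le> _")
proof -
  let ?L = "g + l"
  note t = trans_mat_lb_trans_mat[OF Q(1)]
  \<comment> \<open>With \<open>s = \<gamma> / 4\<close> the exponent per block is
    \<open>- s * \<gamma> + s^2 + s * \<gamma> / 4 = - \<gamma>^2 / 8\<close>, and the exponents in
    \<open>F\<close> stay below 1, as \<open>exp_le_quadratic\<close> requires.\<close>
  define s where "s = \<gamma> / 4"
  have s: "0 < s" "s \<le> 1/4" using \<gamma> by (auto simp: s_def)
  have st: "stat_dist k Q \<in> prob_vecs k" by (rule stat_dist_stationary[OF Q(1) k q])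
  interpret prob_space ?P by (rule prob_space_hmm_law[OF t Q(2) n(1)])
  have B: "\<bar>H ys\<bar> \<le> 1" for ys using H01[of ys] by simp
  interpret S: prob_space "hmm_law k lam Q fs (stat_dist k Q) l"
    by (rule prob_space_hmm_law[OF t prob_vecs_prob_row[OF st] l])
  have intS: "integrable (hmm_law k lam Q fs (stat_dist k Q) l) H"
    by (rule integrable_hmm_law[OF t prob_vecs_prob_row[OF st] l H B])
  have e: "0 \<le> e" "e \<le> 1"
  proof -
    show "0 \<le> e" unfolding e_def using H01 by (intro Bochner_Integration.integral_nonneg) auto
    have "e \<le> (\<integral>ys. 1 \<partial>hmm_law k lam Q fs (stat_dist k Q) l)"
      unfolding e_def using H01 intS by (intro integral_mono) auto
    then show "e \<le> 1" using S.prob_space by simp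
  qed
  define F where "F ys = exp (s * (H ys - e))" for ys
  have [measurable]: "F \<in> borel_measurable (seq_space lam l)" unfolding F_def by measurable
  have u: "\<bar>s * (H ys - e)\<bar> \<le> s" for ys
    using H01[of ys] e s by (auto simp: abs_mult intro!: mult_left_le)
  have F: "0 \<le> F ys" "\<bar>F ys\<bar> \<le> 3" "F ys \<le> (1 + s\<^sup>2 - s * e) + s * H ys" for ys
  proof -
    show "0 \<le> F ys" by (simp add: F_def)
    let ?u = "s * (H ys - e)"
    have "F ys \<le> 1 + ?u + ?u\<^sup>2"
      unfolding F_def using u[of ys] s by (intro exp_le_quadratic) simp
    moreover have "?u\<^sup>2 \<le> s\<^sup>2" using u[of ys] power_mono[of "\<bar>?u\<bar>" s 2] by simp
    ultimately show "F ys \<le> (1 + s\<^sup>2 - s * e) + s * H ys" by (simp add: algebra_simps)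
    have "F ys \<le> exp 1" unfolding F_def using u[of ys] s by simp
    then show "\<bar>F ys\<bar> \<le> 3" using exp_le \<open>0 \<le> F ys\<close> by linarith
  qed
  have le: "(\<integral>ys. F ys \<partial>hmm_law k lam Q fs ((chain_step k Q ^^ g) w) l) \<le> 1 + s\<^sup>2 + s * (\<gamma> / 4)"
    if w: "prob_row k w" for w
  proof -
    let ?w = "(chain_step k Q ^^ g) w"
    have w': "prob_row k ?w" by (rule prob_row_chain_step_iter[OF t w])
    interpret W: prob_space "hmm_law k lam Q fs ?w l" by (rule prob_space_hmm_law[OF t w' l])
    have iH: "integrable (hmm_law k lam Q fs ?w l) H" by (rule integrable_hmm_law[OF t w' l H B])
    have iF: "integrable (hmm_law k lam Q fs ?w l) F" by (rule integrable_hmm_law[OF t w' l _ F(2)]) simp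
    have "(\<integral>ys. F ys \<partial>hmm_law k lam Q fs ?w l) \<le> (\<integral>ys. (1 + s\<^sup>2 - s * e) + s * H ys \<partial>hmm_law k lam Q fs ?w l)"
      using iH iF F(3) by (intro integral_mono) auto
    also have "\<dots> = (1 + s\<^sup>2 - s * e) + s * (\<integral>ys. H ys \<partial>hmm_law k lam Q fs ?w l)"
      using iH W.prob_space by simp
    also have "(\<integral>ys. H ys \<partial>hmm_law k lam Q fs ?w l) \<le> e + \<gamma> / 4"
    proof -
      have "\<bar>(\<integral>ys. H ys \<partial>hmm_law k lam Q fs ?w l) - e\<bar> \<le> vec_dist k ?w (stat_dist k Q)"
        unfolding e_def by (rule integral_hmm_law_vec_dist[OF t w' prob_vecs_prob_row[OF st] l H H01])
      also have "vec_dist k ?w (stat_dist k Q) \<le> 2 * (1 - k * q) ^ g"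
        using vec_dist_chain_step_iter[OF Q(1) k w prob_vecs_prob_row[OF st], of g]
        by (simp add: stat_dist_iter[OF Q(1) k q])
      finally show ?thesis using \<gamma> by linarith
    qed
    finally show ?thesis using s by (simp add: algebra_simps)
  qed
  have C0: "0 \<le> 1 + s\<^sup>2 + s * (\<gamma> / 4)" using s \<gamma> by simp
  note bl = integral_hmm_law_blocks_le[OF t Q(2) l n _ F(2) F(1) C0 le]
  have "measure ?P ?S = (\<integral>ys. indicator ?S ys \<partial>?P)"
  proof -
    have "?S \<inter> space ?P = ?S" by auto
    then show ?thesis by (simp only: Bochner_Integration.integral_indicator)
  qed
  also have "\<dots> \<le> (\<integral>ys. exp (- s * N * \<gamma>) * (\<Prod>b<N. F (window (b * ?L + g) l ys)) \<partial>?P)"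
  proof (rule integral_mono)
    have "?S \<in> sets (seq_space lam n)"
    proof -
      have "(\<lambda>ys. \<Sum>b<N. H (window (b * ?L + g) l ys)) \<in> borel_measurable (seq_space lam n)"
      proof (rule borel_measurable_sum)
        fix b assume "b \<in> {..<N}"
        then have "Suc b * ?L \<le> N * ?L" by (intro mult_right_mono) auto
        then have "b * ?L + g + l \<le> n" using n by simp
        then show "(\<lambda>ys. H (window (b * ?L + g) l ys)) \<in> borel_measurable (seq_space lam n)" by measurable
      qed
      then show ?thesis by measurable
    qed
    then show "integrable ?P (indicator ?S :: _ \<Rightarrow> real)" by (intro integrable_real_indicator) (auto simp: emeasure_eq_measure)
    show "integrable ?P (\<lambda>ys. exp (- s * N * \<gamma>) * (\<Prod>b<N. F (window (b * ?L + g) l ys)))"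
      by (intro integrable_mult_right bl) auto
    fix ys
    have "exp (- s * N * \<gamma>) * (\<Prod>b<N. F (window (b * ?L + g) l ys))
       = exp (s * ((\<Sum>b<N. H (window (b * ?L + g) l ys)) - N * (e + \<gamma>)))"
      unfolding F_def exp_sum[symmetric, OF finite_lessThan] exp_add[symmetric]
      by (simp add: sum_subtractf sum_distrib_left[symmetric] algebra_simps)
    then show "indicator ?S ys \<le> exp (- s * N * \<gamma>) * (\<Prod>b<N. F (window (b * ?L + g) l ys))"
      using s by (auto simp: indicator_def)
  qed
  also have "\<dots> = exp (- s * N * \<gamma>) * (\<integral>ys. (\<Prod>b<N. F (window (b * ?L + g) l ys)) \<partial>?P)" by simp
  also have "\<dots> \<le> exp (- s * N * \<gamma>) * (1 + s\<^sup>2 + s * (\<gamma> / 4)) ^ N"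
    by (intro mult_left_mono bl) auto
  also have "\<dots> \<le> exp (- s * N * \<gamma>) * exp (s\<^sup>2 + s * (\<gamma> / 4)) ^ N"
    using C0 exp_ge_add_one_self[of "s\<^sup>2 + s * (\<gamma> / 4)"] by (intro mult_left_mono power_mono) (auto simp: add.assoc)
  also have "\<dots> = exp (- (N * \<gamma>\<^sup>2 / 8))"
    by (simp add: exp_of_nat_mult[symmetric] exp_add[symmetric] s_def power2_eq_square algebra_simps)
  finally show ?thesis .
qed

end

section \<open>Maximal inequality for stationary sequences\<close>

text \<open>Greedy covering: from a bad time \<open>t\<close> jump over a block whose average exceeds \<open>c\<close>.\<close>

lemma maximal_count:
  fixes a :: "nat \<Rightarrow> ennreal"
  shows "of_nat (card {t \<in> {s..<T}. \<exists>n\<in>{1..N}. of_nat n * c < (\<Sum>i<n. a (t + i))}) * c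
    \<le> (\<Sum>i\<in>{s..<T + N}. a i)"
proof (induction "T - s" arbitrary: s rule: less_induct)
  case less
  define bad where "bad t \<longleftrightarrow> (\<exists>n\<in>{1..N}. of_nat n * c < (\<Sum>i<n. a (t + i)))" for t
  consider "T \<le> s" | "s < T" "\<not> bad s" | "s < T" "bad s" by linarith
  then show ?case unfolding bad_def[symmetric]
  proof cases
    case 2
    have "{t \<in> {s..<T}. bad t} = {t \<in> {Suc s..<T}. bad t}"
      using 2 by (auto simp: Suc_le_eq order_le_less)
    then have "of_nat (card {t \<in> {s..<T}. bad t}) * c \<le> (\<Sum>i\<in>{Suc s..<T + N}. a i)"
      using less[of "Suc s"] 2 by (simp add: bad_def)
    also have "\<dots> \<le> (\<Sum>i\<in>{s..<T + N}. a i)" by (intro sum_mono2) auto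
    finally show "of_nat (card {t \<in> {s..<T}. bad t}) * c \<le> (\<Sum>i\<in>{s..<T + N}. a i)" .
  next
    case 3
    then obtain n where n: "1 \<le> n" "n \<le> N" "of_nat n * c < (\<Sum>i<n. a (s + i))" by (auto simp: bad_def)
    \<comment> \<open>At most \<open>n\<close> bad times are skipped by the jump, and the sum over
      the block, exceeding \<open>n * c\<close>, pays for all of them. The last block starts before
      \<open>T\<close>, hence ends by \<open>T + N\<close>; this explains the range of the
      right-hand sum.\<close>
    have "card {t \<in> {s..<T}. bad t} \<le> card ({s..<s + n} \<union> {t \<in> {s + n..<T}. bad t})"
      by (intro card_mono) auto
    also have "\<dots> \<le> n + card {t \<in> {s + n..<T}. bad t}"
      using card_Un_le[of "{s..<s + n}" "{t \<in> {s + n..<T}. bad t}"] by simp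
    finally have "of_nat (card {t \<in> {s..<T}. bad t}) * c \<le> (of_nat (n + card {t \<in> {s + n..<T}. bad t}) :: ennreal) * c"
      by (intro mult_right_mono) (simp_all only: of_nat_le_iff zero_le)
    also have "\<dots> = of_nat n * c + of_nat (card {t \<in> {s + n..<T}. bad t}) * c"
      by (simp add: distrib_right)
    also have "\<dots> \<le> (\<Sum>i<n. a (s + i)) + (\<Sum>i\<in>{s + n..<T + N}. a i)"
      using less[of "s + n"] 3 n by (intro add_mono) (auto simp: bad_def)
    also have "(\<Sum>i<n. a (s + i)) = (\<Sum>i\<in>{s..<s + n}. a i)"
      by (rule sum.reindex_bij_witness[of _ "\<lambda>i. i - s" "\<lambda>i. s + i"]) auto
    also have "(\<Sum>i\<in>{s..<s + n}. a i) + (\<Sum>i\<in>{s + n..<T + N}. a i) = (\<Sum>i\<in>{s..<T + N}. a i)"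
      using 3 n by (intro sum.atLeastLessThan_concat) auto
    finally show "of_nat (card {t \<in> {s..<T}. bad t}) * c \<le> (\<Sum>i\<in>{s..<T + N}. a i)" .
  qed simp
qed

text \<open>Integrating \<open>maximal_count\<close> and using stationarity gives
  \<open>T * p * c \<le> (T + N) * \<delta>\<close>, where \<open>p\<close> is the probability that
  time 0 is bad within horizon \<open>N\<close>. Letting \<open>T\<close> grow removes the boundary
  term, and continuity from below then removes the horizon.\<close>

lemma (in prob_space) maximal_inequality_stationary:
  fixes Y :: "nat \<Rightarrow> 'a \<Rightarrow> 'y" and r :: "'y \<Rightarrow> ennreal"
  assumes Y[measurable]: "\<And>t. Y t \<in> measurable M lam" and r[measurable]: "r \<in> borel_measurable lam"
    and stat: "\<And>s n. 1 \<le> n \<Longrightarrow> distr M (seq_space lam n) (\<lambda>\<omega>. \<lambda>t\<in>{..<n}. Y (s + t) \<omega>)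
      = distr M (seq_space lam n) (\<lambda>\<omega>. \<lambda>t\<in>{..<n}. Y t \<omega>)"
    and \<delta>: "(\<integral>\<^sup>+\<omega>. r (Y 0 \<omega>) \<partial>M) \<le> ennreal \<delta>" "0 \<le> \<delta>" and c: "0 < c"
  shows "prob {\<omega> \<in> space M. \<exists>n\<ge>1. of_nat n * ennreal c < (\<Sum>t<n. r (Y t \<omega>))} \<le> \<delta> / c"
proof -
  \<comment> \<open>The horizon \<open>N\<close> makes badness at time \<open>t\<close> a function
    of finitely many coordinates, so stationarity, known only for finite stretches, gives it the
    same probability at all times.\<close>
  define bad where "bad N t \<omega> \<longleftrightarrow> (\<exists>n\<in>{1..N}. of_nat n * ennreal c < (\<Sum>i<n. r (Y (t + i) \<omega>)))" for N t \<omega>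
  have [measurable]: "Measurable.pred M (bad N t)" for N t unfolding bad_def by measurable
  have same: "(\<integral>\<^sup>+\<omega>. G (\<lambda>i\<in>{..<n}. Y (t + i) \<omega>) \<partial>M) = (\<integral>\<^sup>+\<omega>. G (\<lambda>i\<in>{..<n}. Y i \<omega>) \<partial>M)"
    if n: "1 \<le> n" and G[measurable]: "G \<in> borel_measurable (seq_space lam n)" for n t and G :: "_ \<Rightarrow> ennreal"
    using arg_cong[OF stat[OF n, of t], of "\<lambda>M. integral\<^sup>N M G"] by (simp add: nn_integral_distr)
  have Er: "(\<integral>\<^sup>+\<omega>. r (Y t \<omega>) \<partial>M) = (\<integral>\<^sup>+\<omega>. r (Y 0 \<omega>) \<partial>M)" for t
    using same[of 1 "\<lambda>ys. r (ys 0)" t] by simp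
  have badP: "emeasure M {\<omega> \<in> space M. bad N t \<omega>} = emeasure M {\<omega> \<in> space M. bad N 0 \<omega>}" if N: "1 \<le> N" for N t
  proof -
    define G where "G ys = (indicator {ys. \<exists>n\<in>{1..N}. of_nat n * ennreal c < (\<Sum>i<n. r (ys i))} ys :: ennreal)" for ys
    have "Measurable.pred (seq_space lam N) (\<lambda>ys. \<exists>n\<in>{1..N}. of_nat n * ennreal c < (\<Sum>i<n. r (ys i)))"
    proof (rule pred_intros_finite)
      fix n assume n: "n \<in> {1..N}"
      have "(\<lambda>ys. \<Sum>i<n. r (ys i)) \<in> borel_measurable (seq_space lam N)"
      proof (rule borel_measurable_sum)
        fix i assume "i \<in> {..<n}"
        then have "i \<in> {..<N}" using n by auto
        then show "(\<lambda>ys. r (ys i)) \<in> borel_measurable (seq_space lam N)" by measurable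
      qed
      then show "Measurable.pred (seq_space lam N) (\<lambda>ys. of_nat n * ennreal c < (\<Sum>i<n. r (ys i)))"
        by measurable
    qed simp
    then have G: "G \<in> borel_measurable (seq_space lam N)"
      unfolding G_def indicator_def by measurable
    have eq: "(\<Sum>i<n. r ((\<lambda>i\<in>{..<N}. Y (t + i) \<omega>) i)) = (\<Sum>i<n. r (Y (t + i) \<omega>))" if "n \<in> {1..N}" for n t \<omega>
      using that by (intro sum.cong) auto
    have "(\<lambda>i\<in>{..<N}. Y (t + i) \<omega>) \<in> {ys. \<exists>n\<in>{1..N}. of_nat n * ennreal c < (\<Sum>i<n. r (ys i))} \<longleftrightarrow> bad N t \<omega>" for t \<omega>
      unfolding bad_def mem_Collect_eq by (intro bex_cong refl) (simp only: eq)
    then have "G (\<lambda>i\<in>{..<N}. Y (t + i) \<omega>) = indicator {\<omega> \<in> space M. bad N t \<omega>} \<omega>" if "\<omega> \<in> space M" for t \<omega>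
      using that unfolding G_def indicator_def by simp
    then have "(\<integral>\<^sup>+\<omega>. G (\<lambda>i\<in>{..<N}. Y (t + i) \<omega>) \<partial>M) = emeasure M {\<omega> \<in> space M. bad N t \<omega>}" for t
      by (simp cong: nn_integral_cong)
    from this[of t] this[of 0] same[OF N G, of t] show ?thesis by simp
  qed
  have fin: "c * prob {\<omega> \<in> space M. bad N 0 \<omega>} \<le> \<delta>" if N: "1 \<le> N" for N
  proof -
    let ?p = "prob {\<omega> \<in> space M. bad N 0 \<omega>}"
    have T: "T * (?p * c) \<le> (T + N) * \<delta>" for T :: nat
    proof -
      have "ennreal (T * (?p * c)) = (\<Sum>t<T. emeasure M {\<omega> \<in> space M. bad N 0 \<omega>}) * ennreal c"
        using c by (simp add: ennreal_mult mult.assoc flip: emeasure_eq_measure ennreal_of_nat_eq_real_of_nat)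
      also have "(\<Sum>t<T. emeasure M {\<omega> \<in> space M. bad N 0 \<omega>}) = (\<Sum>t<T. emeasure M {\<omega> \<in> space M. bad N t \<omega>})"
        by (intro sum.cong refl badP[OF N, symmetric])
      also have "\<dots> * ennreal c = (\<integral>\<^sup>+\<omega>. (\<Sum>t<T. indicator {\<omega> \<in> space M. bad N t \<omega>} \<omega>) * ennreal c \<partial>M)"
        by (simp add: nn_integral_multc nn_integral_sum)
      also have "\<dots> \<le> (\<integral>\<^sup>+\<omega>. (\<Sum>i\<in>{0..<T + N}. r (Y i \<omega>)) \<partial>M)"
      proof (rule nn_integral_mono)
        fix \<omega> assume \<omega>: "\<omega> \<in> space M"
        have "(\<Sum>t<T. indicator {\<omega> \<in> space M. bad N t \<omega>} \<omega>) = (\<Sum>t\<in>{t \<in> {..<T}. bad N t \<omega>}. 1 :: ennreal)"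
          using \<omega> by (intro sum.mono_neutral_cong_right) (auto simp: indicator_def)
        also have "\<dots> = of_nat (card {t \<in> {0..<T}. bad N t \<omega>})" by (simp add: lessThan_atLeast0)
        finally show "(\<Sum>t<T. indicator {\<omega> \<in> space M. bad N t \<omega>} \<omega>) * ennreal c \<le> (\<Sum>i\<in>{0..<T + N}. r (Y i \<omega>))"
          using maximal_count[where a="\<lambda>i. r (Y i \<omega>)" and c="ennreal c" and s=0 and T=T and N=N]
          by (simp add: bad_def)
      qed
      also have "\<dots> = (\<Sum>i\<in>{0..<T + N}. \<integral>\<^sup>+\<omega>. r (Y i \<omega>) \<partial>M)"
        by (simp add: nn_integral_sum)
      also have "\<dots> = (\<Sum>i\<in>{0..<T + N}. \<integral>\<^sup>+\<omega>. r (Y 0 \<omega>) \<partial>M)"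
        by (intro sum.cong refl Er)
      also have "\<dots> \<le> (\<Sum>i\<in>{0..<T + N}. ennreal \<delta>)" by (intro sum_mono \<delta>)
      also have "\<dots> = ennreal ((T + N) * \<delta>)"
        using \<delta> by (simp add: ennreal_mult ennreal_of_nat_eq_real_of_nat)
      finally show ?thesis using \<delta> by (subst (asm) ennreal_le_iff) auto
    qed
    show ?thesis
    proof (rule ccontr)
      assume "\<not> c * ?p \<le> \<delta>"
      then have d: "0 < c * ?p - \<delta>" by simp
      obtain T :: nat where "N * \<delta> / (c * ?p - \<delta>) < T" using reals_Archimedean2 by blast
      then have "N * \<delta> < T * (c * ?p - \<delta>)" using d by (simp add: pos_divide_less_eq)
      with T[of T] show False by (simp add: algebra_simps)
    qed
  qed
  have inc: "incseq (\<lambda>N. {\<omega> \<in> space M. bad N 0 \<omega>})"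
    by (auto simp: incseq_def bad_def)
  have U: "(\<Union>N. {\<omega> \<in> space M. bad N 0 \<omega>}) = {\<omega> \<in> space M. \<exists>n\<ge>1. of_nat n * ennreal c < (\<Sum>t<n. r (Y t \<omega>))}"
    unfolding bad_def by (simp add: set_eq_iff) (meson atLeastAtMost_iff le_refl)
  have lim: "(\<lambda>N. prob {\<omega> \<in> space M. bad N 0 \<omega>}) \<longlonglongrightarrow> prob (\<Union>N. {\<omega> \<in> space M. bad N 0 \<omega>})"
    by (rule finite_Lim_measure_incseq[OF _ inc]) auto
  have "\<forall>N\<ge>1. prob {\<omega> \<in> space M. bad N 0 \<omega>} \<le> \<delta> / c"
    using fin c by (auto simp: field_simps)
  then show ?thesis unfolding U[symmetric] by (intro LIMSEQ_le_const2[OF lim]) blast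
qed

section \<open>Likelihood ratios under (A1)\<close>

text \<open>The maximum over states bounds the log ratio along every hidden path at once. Applying
  \<open>e2ennreal\<close> to it takes the positive part.\<close>

definition log_ratio_max :: "nat \<Rightarrow> (nat \<Rightarrow> 'y \<Rightarrow> real) \<Rightarrow> (nat \<Rightarrow> 'y \<Rightarrow> real) \<Rightarrow> 'y \<Rightarrow> ereal" where
  "log_ratio_max k g f y = Max ((\<lambda>j. log_ratio (g j y) (f j y)) ` {..<k})"

lemma log_ratio_measurable[measurable (raw)]:
  assumes [measurable]: "a \<in> borel_measurable M" "b \<in> borel_measurable M"
  shows "(\<lambda>x. log_ratio (a x) (b x)) \<in> borel_measurable M"
  unfolding log_ratio_def by measurable

lemma log_ratio_max_measurable:
  assumes "\<And>j. j < k \<Longrightarrow> (\<lambda>x. g j (y x)) \<in> borel_measurable M" "\<And>j. j < k \<Longrightarrow> (\<lambda>x. f x j (y x)) \<in> borel_measurable M"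
  shows "(\<lambda>x. log_ratio_max k g (f x) (y x)) \<in> borel_measurable M"
  unfolding log_ratio_max_def using assms by (intro borel_measurable_Max log_ratio_measurable) auto

lemma log_ratio_le_max: "j < k \<Longrightarrow> log_ratio (g j y) (f j y) \<le> log_ratio_max k g f y"
  unfolding log_ratio_max_def by (intro Max_ge) auto

lemma log_ratio_leD:
  assumes "log_ratio a b \<le> ereal c" "0 \<le> a" "0 \<le> b" shows "exp (- c) * a \<le> b"
proof (cases "a = 0")
  case False
  with assms have ab: "0 < a" "0 < b" "ln (a / b) \<le> c" by (auto simp: log_ratio_def split: if_splits)
  then have "a / b \<le> exp c" by (metis divide_pos_pos exp_le_cancel_iff exp_ln)
  then show ?thesis using ab by (simp add: exp_minus field_simps)
qed (use assms in simp)

text \<open>The integrand of the Kullback-Leibler argument, with all terms moved so that both sides are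
  nonnegative. It combines \<open>exp u \<ge> 1 + u + u\<^sup>2 / 2\<close> with \<open>2 \<eta> u \<le> 2 \<eta>\<^sup>2 + u\<^sup>2 / 2\<close>.\<close>

lemma A1b_pointwise:
  assumes k: "i < k" and nn: "0 \<le> g i y" "0 \<le> f i y" and \<eta>: "0 < \<eta>"
  shows "ennreal (2 * \<eta> + 1) * (ennreal (g i y) * e2ennreal (- log_ratio_max k g f y)) + ennreal (g i y)
    \<le> ennreal (2 * \<eta>\<^sup>2) * ennreal (g i y) + ennreal (f i y) + ennreal (g i y) * e2ennreal (log_ratio_max k g f y)"
proof (cases "g i y = 0")
  case False
  with nn have gp: "0 < g i y" by simp
  show ?thesis
  proof (cases "log_ratio_max k g f y")
    case PInf
    then show ?thesis using gp by (simp add: ennreal_mult_top)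
  next
    case MInf
    \<comment> \<open>The log ratio of state \<open>i\<close> is minus infinity only where
      \<open>g i y = 0\<close>, which is excluded here, so the maximum cannot be.\<close>
    then show ?thesis using log_ratio_le_max[OF k, of g y f] gp by (auto simp: log_ratio_def split: if_splits)
  next
    case (real u)
    have x: "exp (- u) * g i y \<le> f i y"
      using log_ratio_leD[of "g i y" "f i y" u] log_ratio_le_max[OF k, of g y f] real nn by simp
    show ?thesis
    proof (cases "0 \<le> u")
      case True
      have "1 - u \<le> exp (- u)" using exp_ge_add_one_self[of "- u"] by simp
      then have "(1 - u) * g i y \<le> f i y" using x gp by (meson mult_right_mono less_imp_le order_trans)
      moreover have "0 \<le> 2 * \<eta>\<^sup>2 * g i y" using gp by simp
      ultimately have "g i y \<le> 2 * \<eta>\<^sup>2 * g i y + f i y + g i y * u" by (simp add: algebra_simps)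
      then show ?thesis using True real nn \<eta>
        by (simp add: ennreal_mult[symmetric] ennreal_neg ennreal_plus[symmetric] del: ennreal_plus)
    next
      case False
      have "1 + (- u) + (- u)\<^sup>2 / 2 \<le> exp (- u)"
        using False by (intro exp_lower_Taylor_quadratic) auto
      \<comment> \<open>The square of \<open>2 * \<eta> + u\<close> is nonnegative. The parameter
        \<eta> buys the surplus coefficient \<open>2 * \<eta>\<close> of the negative part at the
        price \<open>2 * \<eta>\<^sup>2\<close>.\<close>
      moreover have "2 * \<eta> * (- u) \<le> 2 * \<eta>\<^sup>2 + (- u)\<^sup>2 / 2"
        using zero_le_power2[of "2 * \<eta> + u"] by (simp add: power2_eq_square algebra_simps)
      ultimately have "(2 * \<eta> + 1) * (- u) + 1 \<le> 2 * \<eta>\<^sup>2 + exp (- u)" by (simp add: algebra_simps)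
      then have "((2 * \<eta> + 1) * (- u) + 1) * g i y \<le> (2 * \<eta>\<^sup>2 + exp (- u)) * g i y"
        using gp by (intro mult_right_mono) auto
      then have "(2 * \<eta> + 1) * (g i y * (- u)) + g i y \<le> 2 * \<eta>\<^sup>2 * g i y + f i y"
        using x by (simp add: algebra_simps)
      moreover have "0 \<le> (2 * \<eta> + 1) * (g i y * (- u))" using False \<eta> gp by (intro mult_nonneg_nonneg) auto
      ultimately show ?thesis using False real nn \<eta>
        by (simp add: ennreal_mult[symmetric] ennreal_neg ennreal_plus[symmetric] mult_nonneg_nonpos del: ennreal_plus)
    qed
  qed
qed simp

text \<open>A Kullback-Leibler integral is small by cancellation, yet its positive part alone is
  wanted. With \<open>P\<close> and \<open>N\<close> the integrals of the positive and negative
  parts, integrating the pointwise bound uses that both densities have mass 1 and gives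
  \<open>(2 * \<eta> + 1) * N \<le> 2 * \<eta>^2 + P\<close>. Combined with
  \<open>P < N + \<epsilon>\<close> this bounds \<open>N\<close>, and then \<open>P\<close>; \<eta>
  is left free for later optimisation.\<close>

lemma A1b_positive_part_le:
  fixes lam :: "'y measure"
  assumes i: "i < k" and g: "densities k lam g" and f: "densities k lam f" and \<eta>: "0 < \<eta>"
    and lt: "A1b_integral k lam g f i < ereal \<epsilon>"
  shows "(\<integral>\<^sup>+y. ennreal (g i y) * e2ennreal (log_ratio_max k g f y) \<partial>lam) \<le> ennreal (\<eta> + \<epsilon> / (2 * \<eta>) + \<epsilon>)"
proof -
  have gm: "g j \<in> borel_measurable lam" "f j \<in> borel_measurable lam" "0 \<le> g j y" "0 \<le> f j y"
      "(\<integral>\<^sup>+y. ennreal (g j y) \<partial>lam) = 1" "(\<integral>\<^sup>+y. ennreal (f j y) \<partial>lam) = 1" if "j < k" for j y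
    using g f that by (auto simp: densities_def is_density_def)
  have [measurable]: "log_ratio_max k g f \<in> borel_measurable lam"
    using gm by (intro log_ratio_max_measurable[where y="\<lambda>x. x" and f="\<lambda>_. f"]) auto
  note [measurable] = gm(1,2)[OF i]
  define P where "P = (\<integral>\<^sup>+y. ennreal (g i y) * e2ennreal (log_ratio_max k g f y) \<partial>lam)"
  define N where "N = (\<integral>\<^sup>+y. ennreal (g i y) * e2ennreal (- log_ratio_max k g f y) \<partial>lam)"
  have PN: "enn2ereal P - enn2ereal N < ereal \<epsilon>"
    using lt by (simp add: A1b_integral_def P_def N_def log_ratio_max_def Let_def)
  have "ennreal (2 * \<eta> + 1) * N + 1 = (\<integral>\<^sup>+y. ennreal (2 * \<eta> + 1) * (ennreal (g i y) * e2ennreal (- log_ratio_max k g f y)) + ennreal (g i y) \<partial>lam)"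
    unfolding N_def by (simp add: nn_integral_add nn_integral_cmult gm[OF i])
  also have "\<dots> \<le> (\<integral>\<^sup>+y. ennreal (2 * \<eta>\<^sup>2) * ennreal (g i y) + ennreal (f i y) + ennreal (g i y) * e2ennreal (log_ratio_max k g f y) \<partial>lam)"
    using i gm \<eta> by (intro nn_integral_mono A1b_pointwise) auto
  also have "\<dots> = ennreal (2 * \<eta>\<^sup>2) + 1 + P"
    unfolding P_def by (simp add: nn_integral_add nn_integral_cmult gm[OF i])
  finally have key: "ennreal (2 * \<eta> + 1) * N + 1 \<le> ennreal (2 * \<eta>\<^sup>2) + 1 + P" .
  \<comment> \<open>In \<open>ereal\<close> an infinite minuend gives an infinite difference even if
    the subtrahend is infinite, so a value below \<epsilon> forces \<open>P\<close> to be
    finite.\<close>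
  have "P \<noteq> top" using PN by (cases "enn2ereal N") auto
  then obtain p where p: "P = ennreal p" "0 \<le> p" by (cases P) auto
  have "N \<noteq> top" using key p \<eta> by (auto simp: ennreal_mult_top top_unique)
  then obtain n where n: "N = ennreal n" "0 \<le> n" by (cases N) auto
  have "(2 * \<eta> + 1) * n + 1 \<le> 2 * \<eta>\<^sup>2 + 1 + p"
  proof -
    have "ennreal ((2 * \<eta> + 1) * n + 1) \<le> ennreal (2 * \<eta>\<^sup>2 + 1 + p)"
      using key p n \<eta> by (simp add: ennreal_mult)
    then show ?thesis using p by (subst (asm) ennreal_le_iff) auto
  qed
  moreover have pn: "p - n < \<epsilon>" using PN p n by (simp add: enn2ereal_ennreal)
  ultimately have "2 * \<eta> * n \<le> 2 * \<eta>\<^sup>2 + \<epsilon>" by (simp add: algebra_simps)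
  then have "n \<le> \<eta> + \<epsilon> / (2 * \<eta>)" using \<eta> by (simp add: field_simps power2_eq_square)
  then show ?thesis using pn p unfolding P_def[symmetric] p(1) by (intro ennreal_leI) linarith
qed

lemma hmm_dens_1: "hmm_dens k Q f v (Suc 0) ys = (\<Sum>i<k. v i * f i (ys 0))"
  unfolding hmm_dens_eq sum_PiE_lessThan_Suc by (simp add: path_weight_def)

text \<open>The lower bound \<open>q\<close> on the entries of \<open>Qs\<close> turns the absolute
  error into a relative one: \<open>\<epsilon> \<le> \<epsilon> / q * Qs i j\<close>, hence
  \<open>Q i j \<ge> (1 - \<epsilon> / q) * Qs i j\<close>. The initial laws are compared through
  \<open>\<mu> i \<ge> q \<ge> q * v i\<close>.\<close>

lemma path_weight_lower:
  assumes Q: "trans_mat k Q" and Qs: "trans_mat_lb k q Qs" and q: "0 < q"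
    and near: "\<And>i j. i < k \<Longrightarrow> j < k \<Longrightarrow> \<bar>Q i j - Qs i j\<bar> \<le> \<epsilon>" and \<epsilon>: "0 < \<epsilon>" "\<epsilon> < q"
    and \<mu>: "\<And>i. i < k \<Longrightarrow> q \<le> \<mu> i" and v: "prob_row k v"
    and x: "\<And>t. t < n \<Longrightarrow> x t < k" and n: "n \<noteq> 0"
  shows "q * (1 - \<epsilon> / q) ^ n * path_weight Qs v n x \<le> path_weight Q \<mu> n x"
proof -
  let ?a = "1 - \<epsilon> / q"
  have a: "0 < ?a" "?a \<le> 1" using \<epsilon> by (auto simp: field_simps)
  have x0: "x 0 < k" using x n by simp
  have v1: "0 \<le> v (x 0)" "v (x 0) \<le> 1"
  proof -
    show "0 \<le> v (x 0)" using v x0 by (simp add: prob_row_def)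
    have "v (x 0) \<le> (\<Sum>i<k. v i)" using x0 v by (intro member_le_sum) (auto simp: prob_row_def)
    then show "v (x 0) \<le> 1" using v by (simp add: prob_row_def)
  qed
  have "(\<Prod>t\<in>{1..<n}. ?a * Qs (x (t - 1)) (x t)) \<le> (\<Prod>t\<in>{1..<n}. Q (x (t - 1)) (x t))"
  proof (rule prod_mono)
    fix t assume "t \<in> {1..<n}"
    then have ij: "x (t - 1) < k" "x t < k" using x by auto
    then have Qq: "q \<le> Qs (x (t - 1)) (x t)" using Qs by (auto simp: trans_mat_lb_def)
    have "\<epsilon> \<le> \<epsilon> / q * Qs (x (t - 1)) (x t)" using Qq \<epsilon> q by (simp add: field_simps)
    then have "?a * Qs (x (t - 1)) (x t) \<le> Q (x (t - 1)) (x t)"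
      using near[OF ij] by (simp add: algebra_simps)
    then show "0 \<le> ?a * Qs (x (t - 1)) (x t) \<and> ?a * Qs (x (t - 1)) (x t) \<le> Q (x (t - 1)) (x t)"
      using a Qq q by simp
  qed
  then have P: "?a ^ (n - 1) * (\<Prod>t\<in>{1..<n}. Qs (x (t - 1)) (x t)) \<le> (\<Prod>t\<in>{1..<n}. Q (x (t - 1)) (x t))"
    by (simp add: prod.distrib)
  have Qsn: "0 \<le> (\<Prod>t\<in>{1..<n}. Qs (x (t - 1)) (x t))"
    using Qs x by (intro prod_nonneg) (auto simp: trans_mat_lb_def trans_mat_def)
  have "q * ?a ^ n * path_weight Qs v n x = (q * v (x 0)) * (?a ^ n * (\<Prod>t\<in>{1..<n}. Qs (x (t - 1)) (x t)))"
    by (simp add: path_weight_def)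
  also have "\<dots> \<le> \<mu> (x 0) * (\<Prod>t\<in>{1..<n}. Q (x (t - 1)) (x t))"
  proof (rule mult_mono)
    have "q * v (x 0) \<le> q" using v1 q by (simp add: mult_left_le)
    then show "q * v (x 0) \<le> \<mu> (x 0)" using \<mu>[OF x0] by simp
    \<comment> \<open>There are only \<open>n - 1\<close> transitions; the factor is at most 1, so
      the weaker power \<open>n\<close> is used for a simpler formula.\<close>
    have "?a ^ n \<le> ?a ^ (n - 1)" using a by (intro power_decreasing) auto
    then have "?a ^ n * (\<Prod>t\<in>{1..<n}. Qs (x (t - 1)) (x t)) \<le> ?a ^ (n - 1) * (\<Prod>t\<in>{1..<n}. Qs (x (t - 1)) (x t))"
      using Qsn by (intro mult_right_mono)
    then show "?a ^ n * (\<Prod>t\<in>{1..<n}. Qs (x (t - 1)) (x t)) \<le> (\<Prod>t\<in>{1..<n}. Q (x (t - 1)) (x t))"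
      using P by linarith
    show "0 \<le> \<mu> (x 0)" using \<mu>[OF x0] q by simp
    show "0 \<le> ?a ^ n * (\<Prod>t\<in>{1..<n}. Qs (x (t - 1)) (x t))" using a Qsn by simp
  qed
  finally show ?thesis by (simp add: path_weight_def)
qed

text \<open>The loss at time \<open>t\<close> is bounded by the same \<open>exp (- \<rho> t)\<close>
  in every hidden state, so the product of the losses does not depend on the path and comes out of
  the sum.\<close>

lemma hmm_dens_lower:
  fixes f g :: "nat \<Rightarrow> 'y \<Rightarrow> real"
  assumes Q: "trans_mat k Q" and Qs: "trans_mat_lb k q Qs" and q: "0 < q"
    and near: "\<And>i j. i < k \<Longrightarrow> j < k \<Longrightarrow> \<bar>Q i j - Qs i j\<bar> \<le> \<epsilon>" and \<epsilon>: "0 < \<epsilon>" "\<epsilon> < q"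
    and \<mu>: "\<And>i. i < k \<Longrightarrow> q \<le> \<mu> i" and v: "prob_row k v"
    and n: "n \<noteq> 0" and f: "densities k lam f" and g: "densities k lam g"
    and c: "0 \<le> c" "(\<Sum>t<n. e2ennreal (log_ratio_max k g f (ys t))) \<le> of_nat n * ennreal c"
  shows "q * (1 - \<epsilon> / q) ^ n * exp (- c * n) * hmm_dens k Qs g v n ys \<le> hmm_dens k Q f \<mu> n ys"
proof -
  let ?r = "\<lambda>t. e2ennreal (log_ratio_max k g f (ys t))"
  \<comment> \<open>Real versions of the losses; finiteness of each follows from the bound on their
    sum.\<close>
  define \<rho> where "\<rho> t = enn2real (?r t)" for t
  have a: "0 < 1 - \<epsilon> / q" using \<epsilon> by (auto simp: field_simps)
  have "(\<Sum>t<n. ?r t) < top" using c(2)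
    by (rule le_less_trans) (simp add: ennreal_mult_less_top ennreal_of_nat_eq_real_of_nat)
  then have fin: "?r t < top" if "t < n" for t
    using that by (auto simp: less_top)
  have r: "?r t = ennreal (\<rho> t)" if "t < n" for t
    using fin[OF that] by (simp add: \<rho>_def)
  have \<rho>0: "0 \<le> \<rho> t" for t by (simp add: \<rho>_def)
  have "ennreal (\<Sum>t<n. \<rho> t) = (\<Sum>t<n. ennreal (\<rho> t))" by (rule sum_ennreal[symmetric]) (rule \<rho>0)
  also have "\<dots> = (\<Sum>t<n. ?r t)" by (rule sum.cong[OF refl], rule r[symmetric]) simp
  also note c(2)
  also have "of_nat n * ennreal c = ennreal (n * c)"
    using c(1) by (simp add: ennreal_mult ennreal_of_nat_eq_real_of_nat)
  finally have S: "(\<Sum>t<n. \<rho> t) \<le> c * n"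
    using c by (subst (asm) ennreal_le_iff) (auto simp: mult.commute)
  have fg: "0 \<le> g j y" "0 \<le> f j y" if "j < k" for j y
    using f g that by (auto simp: densities_def is_density_def)
  have ratio: "exp (- \<rho> t) * g j (ys t) \<le> f j (ys t)" if "t < n" "j < k" for t j
  proof (rule log_ratio_leD)
    have "log_ratio_max k g f (ys t) \<le> ereal (\<rho> t)"
    proof (cases "0 \<le> log_ratio_max k g f (ys t)")
      case True
      then have "log_ratio_max k g f (ys t) = enn2ereal (?r t)" by (simp add: enn2ereal_e2ennreal)
      then show ?thesis using r[OF that(1)] \<rho>0 by (simp add: enn2ereal_ennreal)
    next
      case False
      then have "log_ratio_max k g f (ys t) \<le> ereal 0" by (simp add: zero_ereal_def)
      also have "ereal 0 \<le> ereal (\<rho> t)" using \<rho>0 by simp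
      finally show ?thesis .
    qed
    then show "log_ratio (g j (ys t)) (f j (ys t)) \<le> ereal (\<rho> t)"
      using log_ratio_le_max[OF that(2), of g "ys t" f] by (rule order_trans[rotated])
  qed (use fg that in auto)
  show ?thesis unfolding hmm_dens_eq sum_distrib_left
  proof (rule sum_mono)
    fix x assume x: "x \<in> paths k n"
    have xk: "x t < k" if "t < n" for t using PiE_mem[OF x, of t] that by simp
    have "exp (- c * n) * (\<Prod>t<n. g (x t) (ys t)) \<le> (\<Prod>t<n. exp (- \<rho> t)) * (\<Prod>t<n. g (x t) (ys t))"
    proof (rule mult_right_mono)
      show "exp (- c * n) \<le> (\<Prod>t<n. exp (- \<rho> t))"
        using S by (simp add: exp_sum[symmetric] sum_negf)
      show "0 \<le> (\<Prod>t<n. g (x t) (ys t))" using fg xk by (intro prod_nonneg) auto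
    qed
    also have "\<dots> = (\<Prod>t<n. exp (- \<rho> t) * g (x t) (ys t))" by (simp add: prod.distrib)
    also have "\<dots> \<le> (\<Prod>t<n. f (x t) (ys t))"
      using ratio xk fg by (intro prod_mono) auto
    finally have F: "exp (- c * n) * (\<Prod>t<n. g (x t) (ys t)) \<le> (\<Prod>t<n. f (x t) (ys t))" .
    have W: "q * (1 - \<epsilon> / q) ^ n * path_weight Qs v n x \<le> path_weight Q \<mu> n x"
      by (rule path_weight_lower[OF Q Qs q near \<epsilon> \<mu> v xk n])
    have W0: "0 \<le> path_weight Qs v n x"
      by (rule path_weight_nonneg[OF trans_mat_lb_trans_mat[OF Qs] v x n])
    have "q * (1 - \<epsilon> / q) ^ n * exp (- c * n) * (path_weight Qs v n x * (\<Prod>t<n. g (x t) (ys t)))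
      = (q * (1 - \<epsilon> / q) ^ n * path_weight Qs v n x) * (exp (- c * n) * (\<Prod>t<n. g (x t) (ys t)))" by simp
    also have "\<dots> \<le> path_weight Q \<mu> n x * (\<Prod>t<n. f (x t) (ys t))"
    proof (rule mult_mono[OF W F])
      have "0 \<le> q * (1 - \<epsilon> / q) ^ n * path_weight Qs v n x" using q a W0 by simp
      then show "0 \<le> path_weight Q \<mu> n x" using W by linarith
      show "0 \<le> exp (- c * n) * (\<Prod>t<n. g (x t) (ys t))" using fg xk by (intro mult_nonneg_nonneg prod_nonneg) auto
    qed
    finally show "q * (1 - \<epsilon> / q) ^ n * exp (- c * n) * (path_weight Qs v n x * (\<Prod>t<n. g (x t) (ys t)))
        \<le> path_weight Q \<mu> n x * (\<Prod>t<n. f (x t) (ys t))" .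
  qed
qed

text \<open>Turns statements of high probability into almost sure ones: every failure lies in the
  intersection of exceptional events of vanishing probability. Only these events must be measurable,
  not \<open>P\<close> itself.\<close>

lemma AE_if_small_exceptions:
  assumes "\<And>e::real. 0 < e \<Longrightarrow> \<exists>W\<in>sets M. emeasure M W \<le> ennreal e \<and> (\<forall>\<omega>\<in>space M - W. P \<omega>)"
  shows "AE \<omega> in M. P \<omega>"
proof -
  have "\<forall>n. \<exists>W. W \<in> sets M \<and> emeasure M W \<le> ennreal (1 / Suc n) \<and> (\<forall>\<omega>\<in>space M - W. P \<omega>)"
    using assms[of "1 / Suc n" for n] by (simp add: Bex_def)
  from choice[OF this] obtain W where W: "\<And>n. W n \<in> sets M" "\<And>n. emeasure M (W n) \<le> ennreal (1 / Suc n)"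
      "\<And>n \<omega>. \<omega> \<in> space M - W n \<Longrightarrow> P \<omega>" by blast
  have "emeasure M (\<Inter>n. W n) \<le> ennreal e" if "0 < e" for e :: real
  proof -
    obtain n where "1 / real (Suc n) < e" using nat_approx_posE[OF \<open>0 < e\<close>] by auto
    have "emeasure M (\<Inter>n. W n) \<le> emeasure M (W n)" using W by (intro emeasure_mono) auto
    also have "\<dots> \<le> ennreal (1 / Suc n)" by (rule W)
    also have "\<dots> \<le> ennreal e" using \<open>1 / real (Suc n) < e\<close> by (intro ennreal_leI) simp
    finally show ?thesis .
  qed
  then have "emeasure M (\<Inter>n. W n) \<le> 0"
    using ennreal_le_epsilon[of 0 "emeasure M (\<Inter>n. W n)"] by simp
  then have "(\<Inter>n. W n) \<in> null_sets M" using W(1) by (intro null_setsI) auto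
  moreover have "{\<omega> \<in> space M. \<not> P \<omega>} \<subseteq> (\<Inter>n. W n)" using W(3) by blast
  ultimately show ?thesis by (rule AE_I')
qed

section \<open>Prior, evidence and observations\<close>

text \<open>The entrywise lower bound on \<open>Qstar\<close> is a locale assumption here; the final
  theorem derives it from (A1) before entering the locale. The observation space carries no
  topology, which enters only through the test functions of the weak neighbourhood.\<close>

locale hmm_bayes =
  fixes k :: nat and q :: real and lam :: "'y measure"
    and \<pi>Q :: "(nat \<Rightarrow> nat \<Rightarrow> real) measure" and \<pi>f :: "(nat \<Rightarrow> 'y \<Rightarrow> real) measure"
    and \<mu> :: "nat \<Rightarrow> real"
    and Qstar :: "nat \<Rightarrow> nat \<Rightarrow> real" and fstar :: "nat \<Rightarrow> 'y \<Rightarrow> real"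
    and M :: "'w measure" and Y :: "nat \<Rightarrow> 'w \<Rightarrow> 'y"
  assumes k: "1 \<le> k" and q: "0 < q" and lam: "sigma_finite_measure lam"
    and priorQ: "prob_space \<pi>Q" "space \<pi>Q \<subseteq> Collect (trans_mat k)"
      "\<And>i j. i < k \<Longrightarrow> j < k \<Longrightarrow> (\<lambda>Q. Q i j) \<in> borel_measurable \<pi>Q"
    and priorf: "prob_space \<pi>f" "space \<pi>f \<subseteq> Collect (densities k lam)"
      "\<And>j. j < k \<Longrightarrow> (\<lambda>(fs, y). fs j y) \<in> borel_measurable (\<pi>f \<Otimes>\<^sub>M lam)"
    and mu: "\<mu> \<in> prob_vecs k" "\<And>i. i < k \<Longrightarrow> q \<le> \<mu> i"
    and Qstar: "trans_mat_lb k q Qstar" and fstar: "densities k lam fstar"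
    and obs: "prob_space M" "\<And>t. Y t \<in> measurable M lam"
      "\<And>n. 1 \<le> n \<Longrightarrow> distr M (seq_space lam n) (\<lambda>\<omega>. \<lambda>t\<in>{..<n}. Y t \<omega>)
         = hmm_law k lam Qstar fstar (stat_dist k Qstar) n"
begin

abbreviation prior :: "((nat \<Rightarrow> nat \<Rightarrow> real) \<times> (nat \<Rightarrow> 'y \<Rightarrow> real)) measure" where
  "prior \<equiv> \<pi>Q \<Otimes>\<^sub>M \<pi>f"

abbreviation law_true :: "nat \<Rightarrow> (nat \<Rightarrow> 'y) measure" where
  "law_true \<equiv> hmm_law k lam Qstar fstar (stat_dist k Qstar)"

abbreviation dens_true :: "nat \<Rightarrow> (nat \<Rightarrow> 'y) \<Rightarrow> real" where
  "dens_true \<equiv> hmm_dens k Qstar fstar (stat_dist k Qstar)"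

abbreviation obs_upto :: "nat \<Rightarrow> 'w \<Rightarrow> nat \<Rightarrow> 'y" where
  "obs_upto n \<omega> \<equiv> (\<lambda>t\<in>{..<n}. Y t \<omega>)"

definition evidence_on :: "((nat \<Rightarrow> nat \<Rightarrow> real) \<times> (nat \<Rightarrow> 'y \<Rightarrow> real)) set \<Rightarrow> nat \<Rightarrow> (nat \<Rightarrow> 'y) \<Rightarrow> ennreal" where
  "evidence_on B n ys = (\<integral>\<^sup>+\<theta>. indicator B \<theta> * ennreal (hmm_dens k (fst \<theta>) (snd \<theta>) \<mu> n ys) \<partial>prior)"

sublocale star: emission lam k fstar
  using lam k fstar by (auto simp: emission_def emission_axioms_def)

sublocale M: prob_space M by (rule obs)
sublocale \<pi>Q: prob_space \<pi>Q by (rule priorQ)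
sublocale \<pi>f: prob_space \<pi>f by (rule priorf)
sublocale \<pi>: pair_prob_space \<pi>Q \<pi>f ..

declare obs(2)[measurable]

lemma emission_prior: "\<theta> \<in> space prior \<Longrightarrow> emission lam k (snd \<theta>)"
  using lam k priorf by (auto simp: emission_def emission_axioms_def space_pair_measure)

lemma trans_mat_prior: "\<theta> \<in> space prior \<Longrightarrow> trans_mat k (fst \<theta>)"
  using priorQ by (auto simp: space_pair_measure)

lemma stat_true: "stat_dist k Qstar \<in> prob_vecs k" "prob_row k (stat_dist k Qstar)"
  using stat_dist_stationary[OF Qstar k q] prob_vecs_prob_row by auto

lemma measurable_obs_upto[measurable]: "obs_upto n \<in> measurable M (seq_space lam n)"
  by measurable

text \<open>The initial law may depend on the parameter: it is the constant \<mu> for the evidence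
  and \<open>stat_limit\<close> for sets defined by stationary laws.\<close>

lemma measurable_joint_density:
  assumes n: "n \<noteq> 0" and v: "\<And>i. i < k \<Longrightarrow> (\<lambda>\<theta>. v \<theta> i) \<in> borel_measurable prior"
  shows "(\<lambda>p. hmm_dens k (fst (fst p)) (snd (fst p)) (v (fst p)) n (snd p))
    \<in> borel_measurable (prior \<Otimes>\<^sub>M (seq_space lam n))"
  unfolding hmm_dens_eq path_weight_def
proof (intro borel_measurable_sum borel_measurable_times borel_measurable_prod)
  fix x assume x: "x \<in> paths k n"
  have xk: "x t < k" if "t < n" for t using PiE_mem[OF x, of t] that by simp
  show "(\<lambda>p. v (fst p) (x 0)) \<in> borel_measurable (prior \<Otimes>\<^sub>M (seq_space lam n))"
    using xk n by (intro measurable_compose[OF measurable_fst v]) simp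
  show "(\<lambda>p. fst (fst p) (x (t - 1)) (x t)) \<in> borel_measurable (prior \<Otimes>\<^sub>M (seq_space lam n))" if "t \<in> {1..<n}" for t
    using xk that by (intro measurable_compose[OF measurable_compose[OF measurable_fst measurable_fst] priorQ(3)]) auto
  show "(\<lambda>p. snd (fst p) (x t) (snd p t)) \<in> borel_measurable (prior \<Otimes>\<^sub>M (seq_space lam n))" if "t \<in> {..<n}" for t
  proof -
    have "(\<lambda>p. (snd (fst p), snd p t)) \<in> measurable (prior \<Otimes>\<^sub>M (seq_space lam n)) (\<pi>f \<Otimes>\<^sub>M lam)"
      using that by measurable
    from measurable_compose[OF this priorf(3)[of "x t"]] xk that show ?thesis by simp
  qed
qed

lemma measurable_joint_mu:
  "n \<noteq> 0 \<Longrightarrow> (\<lambda>p. hmm_dens k (fst (fst p)) (snd (fst p)) \<mu> n (snd p))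
    \<in> borel_measurable (prior \<Otimes>\<^sub>M (seq_space lam n))"
  by (rule measurable_joint_density) auto

lemma measurable_prior_density:
  assumes "n \<noteq> 0" "ys \<in> space (seq_space lam n)"
  shows "(\<lambda>\<theta>. hmm_dens k (fst \<theta>) (snd \<theta>) \<mu> n ys) \<in> borel_measurable prior"
  using measurable_compose[OF measurable_Pair2'[OF assms(2)] measurable_joint_mu[OF assms(1)]] by simp

lemma measurable_evidence_on:
  assumes n: "n \<noteq> 0" and [measurable]: "B \<in> sets prior"
  shows "evidence_on B n \<in> borel_measurable (seq_space lam n)"
proof -
  have "(\<lambda>p. hmm_dens k (fst (snd p)) (snd (snd p)) \<mu> n (fst p)) \<in> borel_measurable ((seq_space lam n) \<Otimes>\<^sub>M prior)"
    using measurable_compose[OF measurable_pair_swap' measurable_joint_mu[OF n]] by (simp add: split_def)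
  then show ?thesis unfolding evidence_on_def[abs_def]
    by (intro \<pi>.borel_measurable_nn_integral) (simp add: split_def)
qed

lemma emeasure_obs:
  assumes "1 \<le> n" "S \<in> sets (seq_space lam n)"
  shows "emeasure M {\<omega> \<in> space M. obs_upto n \<omega> \<in> S} = emeasure (law_true n) S"
proof -
  have "emeasure (distr M (seq_space lam n) (obs_upto n)) S = emeasure M (obs_upto n -` S \<inter> space M)"
    using assms by (intro emeasure_distr) auto
  moreover have "obs_upto n -` S \<inter> space M = {\<omega> \<in> space M. obs_upto n \<omega> \<in> S}" by auto
  ultimately show ?thesis using obs(3)[OF assms(1)] by simp
qed

text \<open>Tonelli's theorem: the evidence is a prior mixture of likelihoods, so its integral over
  \<open>T\<close> is the prior average of the probabilities of \<open>T\<close>.\<close>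

lemma evidence_integral:
  assumes n: "1 \<le> n" and B[measurable]: "B \<in> sets prior" and T[measurable]: "T \<in> sets (seq_space lam n)"
  shows "(\<integral>\<^sup>+ys. evidence_on B n ys * indicator T ys \<partial>(seq_space lam n))
    = (\<integral>\<^sup>+\<theta>. indicator B \<theta> * emeasure (hmm_law k lam (fst \<theta>) (snd \<theta>) \<mu> n) T \<partial>prior)"
proof -
  let ?L = "seq_space lam n"
  have n0: "n \<noteq> 0" using n by simp
  interpret L: sigma_finite_measure ?L by (rule star.PF.sigma_finite) simp
  interpret pair_sigma_finite prior ?L ..
  define F where "F \<theta> ys = indicator B \<theta> * (ennreal (hmm_dens k (fst \<theta>) (snd \<theta>) \<mu> n ys) * indicator T ys)" for \<theta> ys
  note [measurable] = measurable_joint_mu[OF n0]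
  have F: "case_prod F \<in> borel_measurable (prior \<Otimes>\<^sub>M ?L)" unfolding F_def split_def by measurable
  have "(\<integral>\<^sup>+ys. evidence_on B n ys * indicator T ys \<partial>?L) = (\<integral>\<^sup>+ys. (\<integral>\<^sup>+\<theta>. F \<theta> ys \<partial>prior) \<partial>?L)"
  proof (rule nn_integral_cong)
    fix ys assume ys: "ys \<in> space ?L"
    note [measurable] = measurable_prior_density[OF n0 ys]
    show "evidence_on B n ys * indicator T ys = (\<integral>\<^sup>+\<theta>. F \<theta> ys \<partial>prior)"
      unfolding evidence_on_def F_def by (subst nn_integral_multc[symmetric]) (auto simp: mult.assoc)
  qed
  also have "\<dots> = (\<integral>\<^sup>+\<theta>. (\<integral>\<^sup>+ys. F \<theta> ys \<partial>?L) \<partial>prior)" by (rule Fubini'[OF F])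
  also have "\<dots> = (\<integral>\<^sup>+\<theta>. indicator B \<theta> * emeasure (hmm_law k lam (fst \<theta>) (snd \<theta>) \<mu> n) T \<partial>prior)"
  proof (rule nn_integral_cong)
    fix \<theta> assume \<theta>: "\<theta> \<in> space prior"
    interpret E: emission lam k "snd \<theta>" by (rule emission_prior[OF \<theta>])
    show "(\<integral>\<^sup>+ys. F \<theta> ys \<partial>?L) = indicator B \<theta> * emeasure (hmm_law k lam (fst \<theta>) (snd \<theta>) \<mu> n) T"
      unfolding F_def hmm_law_def by (subst nn_integral_cmult) (auto simp: emeasure_density)
  qed
  finally show ?thesis .
qed

text \<open>Markov's inequality for the ratio of evidence to true density, without dividing: on the
  event the true density is dominated by \<open>a\<close> times the evidence, and integrating this
  domination against the reference measure bounds the probability.\<close>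

lemma evidence_tail:
  assumes n: "1 \<le> n" and B[measurable]: "B \<in> sets prior" and T[measurable]: "T \<in> sets (seq_space lam n)"
    and a: "0 \<le> a"
  shows "emeasure M {\<omega> \<in> space M. obs_upto n \<omega> \<in> T \<and> ennreal (dens_true n (obs_upto n \<omega>)) \<le> ennreal a * evidence_on B n (obs_upto n \<omega>)}
    \<le> ennreal a * (\<integral>\<^sup>+\<theta>. indicator B \<theta> * emeasure (hmm_law k lam (fst \<theta>) (snd \<theta>) \<mu> n) T \<partial>prior)"
proof -
  let ?L = "seq_space lam n"
  have n0: "n \<noteq> 0" using n by simp
  note [measurable] = measurable_evidence_on[OF n0 B]
  define S where "S = {ys \<in> space ?L. ys \<in> T \<and> ennreal (dens_true n ys) \<le> ennreal a * evidence_on B n ys}"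
  have d: "(\<lambda>ys. ennreal (dens_true n ys)) \<in> borel_measurable ?L"
    by (rule measurable_compose[OF star.measurable_hmm_dens measurable_ennreal])
  have e: "(\<lambda>ys. ennreal a * evidence_on B n ys) \<in> borel_measurable ?L" by measurable
  have "S = T \<inter> {ys \<in> space ?L. ennreal (dens_true n ys) \<le> ennreal a * evidence_on B n ys}"
    using sets.sets_into_space[OF T] unfolding S_def by auto
  then have S[measurable]: "S \<in> sets ?L" using borel_measurable_le[OF d e] by auto
  have "{\<omega> \<in> space M. obs_upto n \<omega> \<in> T \<and> ennreal (dens_true n (obs_upto n \<omega>)) \<le> ennreal a * evidence_on B n (obs_upto n \<omega>)}
     = {\<omega> \<in> space M. obs_upto n \<omega> \<in> S}"
    using measurable_space[OF measurable_obs_upto[of n]] unfolding S_def by blast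
  then have "emeasure M {\<omega> \<in> space M. obs_upto n \<omega> \<in> T \<and> ennreal (dens_true n (obs_upto n \<omega>)) \<le> ennreal a * evidence_on B n (obs_upto n \<omega>)}
     = emeasure (law_true n) S"
    using emeasure_obs[OF n S] by simp
  also have "\<dots> = (\<integral>\<^sup>+ys. ennreal (dens_true n ys) * indicator S ys \<partial>?L)"
    unfolding hmm_law_def by (rule emeasure_density[OF d S])
  also have "\<dots> \<le> (\<integral>\<^sup>+ys. ennreal a * (evidence_on B n ys * indicator T ys) \<partial>?L)"
    by (intro nn_integral_mono) (auto simp: S_def indicator_def)
  also have "\<dots> = ennreal a * (\<integral>\<^sup>+ys. evidence_on B n ys * indicator T ys \<partial>?L)"
    by (rule nn_integral_cmult) measurable
  finally show ?thesis unfolding evidence_integral[OF n B T] .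
qed

text \<open>The total evidence integrates to 1 and is therefore finite almost everywhere for the
  reference measure, hence also under the true law, which has a density. This keeps the posterior
  quotient from degenerating.\<close>

lemma evidence_finite: "AE \<omega> in M. \<forall>n\<ge>1. evidence_on (space prior) n (obs_upto n \<omega>) < \<infinity>"
proof (subst AE_all_countable, intro allI)
  fix n
  show "AE \<omega> in M. 1 \<le> n \<longrightarrow> evidence_on (space prior) n (obs_upto n \<omega>) < \<infinity>"
  proof (cases "1 \<le> n")
    case n: True
    then have n0: "n \<noteq> 0" by simp
    let ?L = "seq_space lam n"
    note [measurable] = measurable_evidence_on[OF n0 sets.top]
    have "(\<integral>\<^sup>+ys. evidence_on (space prior) n ys \<partial>?L) = (\<integral>\<^sup>+ys. evidence_on (space prior) n ys * indicator (space ?L) ys \<partial>?L)"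
      by (intro nn_integral_cong) simp
    also have "\<dots> = (\<integral>\<^sup>+\<theta>. indicator (space prior) \<theta> * emeasure (hmm_law k lam (fst \<theta>) (snd \<theta>) \<mu> n) (space ?L) \<partial>prior)"
      by (rule evidence_integral[OF n]) auto
    also have "\<dots> = (\<integral>\<^sup>+\<theta>. 1 \<partial>prior)"
    proof (rule nn_integral_cong)
      fix \<theta> assume \<theta>: "\<theta> \<in> space prior"
      interpret E: emission lam k "snd \<theta>" by (rule emission_prior[OF \<theta>])
      interpret H: prob_space "hmm_law k lam (fst \<theta>) (snd \<theta>) \<mu> n"
        by (rule E.prob_space_hmm_law[OF trans_mat_prior[OF \<theta>] prob_vecs_prob_row[OF mu(1)] n0])
      show "indicator (space prior) \<theta> * emeasure (hmm_law k lam (fst \<theta>) (snd \<theta>) \<mu> n) (space ?L) = 1"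
        using \<theta> H.emeasure_space_1 by simp
    qed
    also have "\<dots> = 1" by (simp add: \<pi>.emeasure_space_1)
    finally have "AE ys in ?L. evidence_on (space prior) n ys \<noteq> \<infinity>"
      by (intro nn_integral_noteq_infinite) auto
    then have "AE ys in law_true n. evidence_on (space prior) n ys \<noteq> \<infinity>"
      unfolding hmm_law_def by (subst AE_density) auto
    then have "AE \<omega> in M. evidence_on (space prior) n (obs_upto n \<omega>) \<noteq> \<infinity>"
      unfolding obs(3)[OF n, symmetric] by (rule AE_distrD[OF measurable_obs_upto])
    then show ?thesis by (auto simp: less_top)
  qed simp
qed

text \<open>The zero set of a density is null under the law that it defines. Positivity passes to
  the denominator of the posterior through the lower bound on the evidence.\<close>

lemma dens_true_pos: "AE \<omega> in M. \<forall>n\<ge>1. 0 < dens_true n (obs_upto n \<omega>)"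
proof (subst AE_all_countable, intro allI)
  fix n
  show "AE \<omega> in M. 1 \<le> n \<longrightarrow> 0 < dens_true n (obs_upto n \<omega>)"
  proof (cases "1 \<le> n")
    case n: True
    have "AE ys in law_true n. 0 < dens_true n ys"
      unfolding hmm_law_def by (subst AE_density) auto
    then have "AE \<omega> in M. 0 < dens_true n (obs_upto n \<omega>)"
      unfolding obs(3)[OF n, symmetric] by (rule AE_distrD[OF measurable_obs_upto])
    then show ?thesis by auto
  qed simp
qed

text \<open>Only initial segments have a prescribed law. A later stretch is a window of a longer
  initial segment, and its law is unchanged because the stationary distribution is fixed by
  \<open>chain_step\<close>.\<close>

lemma process_stationary:
  assumes n: "1 \<le> n"
  shows "distr M (seq_space lam n) (\<lambda>\<omega>. \<lambda>t\<in>{..<n}. Y (s + t) \<omega>) = law_true n"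
proof -
  have w: "window s n \<in> measurable (seq_space lam (s + n)) (seq_space lam n)"
    by (rule measurable_window) simp
  have "distr M (seq_space lam n) (\<lambda>\<omega>. \<lambda>t\<in>{..<n}. Y (s + t) \<omega>)
    = distr M (seq_space lam n) (window s n \<circ> obs_upto (s + n))"
    by (rule distr_cong) (auto simp: window_def fun_eq_iff)
  also have "\<dots> = distr (distr M (seq_space lam (s + n)) (obs_upto (s + n))) (seq_space lam n) (window s n)"
    by (rule distr_distr[symmetric, OF w measurable_obs_upto])
  also have "\<dots> = distr (law_true (s + n)) (seq_space lam n) (window s n)"
    using obs(3)[of "s + n"] n by simp
  also have "\<dots> = hmm_law k lam Qstar fstar ((chain_step k Qstar ^^ s) (stat_dist k Qstar)) n"
    using n by (intro star.distr_hmm_law_window trans_mat_lb_trans_mat[OF Qstar] stat_true) auto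
  finally show ?thesis by (simp add: stat_dist_iter[OF Qstar k q])
qed

text \<open>A single observation has as density a convex combination of the \<open>fstar i\<close>,
  so a bound valid in each state survives averaging.\<close>

lemma nn_integral_first_obs:
  assumes r[measurable]: "r \<in> borel_measurable lam"
    and le: "\<And>i. i < k \<Longrightarrow> (\<integral>\<^sup>+y. ennreal (fstar i y) * r y \<partial>lam) \<le> d"
  shows "(\<integral>\<^sup>+\<omega>. r (Y 0 \<omega>) \<partial>M) \<le> d"
proof -
  let ?L = "\<Pi>\<^sub>M t\<in>{..<1::nat}. lam" and ?v = "stat_dist k Qstar"
  have v: "0 \<le> ?v i" if "i < k" for i using stat_true that by (auto simp: prob_row_def)
  have fm[measurable]: "fstar i \<in> borel_measurable lam" if "i < k" for i using star.measurable_fs[OF that] .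
  have r0[measurable]: "(\<lambda>ys. r (ys 0)) \<in> borel_measurable ?L"
    by (rule measurable_compose[OF measurable_component_singleton[of 0 "{..<1}" "\<lambda>_. lam"] r]) simp
  have "(\<integral>\<^sup>+\<omega>. r (Y 0 \<omega>) \<partial>M) = (\<integral>\<^sup>+ys. r (ys 0) \<partial>distr M ?L (obs_upto 1))"
    by (subst nn_integral_distr) auto
  also have "\<dots> = (\<integral>\<^sup>+ys. ennreal (dens_true 1 ys) * r (ys 0) \<partial>?L)"
    unfolding obs(3)[OF order_refl] hmm_law_def
    by (rule nn_integral_density) (auto intro!: star.measurable_hmm_dens measurable_compose[OF _ measurable_ennreal] r0)
  also have "\<dots> = (\<integral>\<^sup>+ys. (\<lambda>y. (\<Sum>i<k. ennreal (?v i) * (ennreal (fstar i y) * r y))) (ys 0) \<partial>(\<Pi>\<^sub>M t\<in>{0::nat}. lam))"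
  proof -
    have "ennreal (dens_true 1 ys) * r (ys 0) = (\<Sum>i<k. ennreal (?v i) * (ennreal (fstar i (ys 0)) * r (ys 0)))" for ys
    proof -
      have "ennreal (dens_true 1 ys) = (\<Sum>i<k. ennreal (?v i) * ennreal (fstar i (ys 0)))"
        using v star.fs_nonneg sum_ennreal[of "{..<k}" "\<lambda>i. ?v i * fstar i (ys 0)"]
        by (simp add: hmm_dens_1 ennreal_mult)
      then show ?thesis by (simp add: sum_distrib_right mult.assoc)
    qed
    then show ?thesis by (simp add: lessThan_Suc)
  qed
  also have "\<dots> = (\<integral>\<^sup>+y. (\<Sum>i<k. ennreal (?v i) * (ennreal (fstar i y) * r y)) \<partial>lam)"
    by (rule star.PF.product_nn_integral_singleton) (auto intro!: borel_measurable_sum)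
  also have "\<dots> = (\<Sum>i<k. ennreal (?v i) * (\<integral>\<^sup>+y. ennreal (fstar i y) * r y \<partial>lam))"
    by (subst nn_integral_sum) (auto intro!: sum.cong nn_integral_cmult)
  also have "\<dots> \<le> (\<Sum>i<k. ennreal (?v i) * d)"
    using le by (intro sum_mono mult_left_mono) auto
  also have "\<dots> = d"
    using v stat_true sum_ennreal[of "{..<k}" ?v] by (simp add: prob_row_def sum_distrib_right[symmetric])
  finally show ?thesis .
qed

end

section \<open>Lower bound on the evidence\<close>

lemma mat_norm_entry_le:
  assumes "i < k" "j < k" shows "\<bar>A i j\<bar> \<le> mat_norm k A"
proof -
  have "{\<bar>A i j\<bar> | i j. i < k \<and> j < k} = (\<lambda>(i, j). \<bar>A i j\<bar>) ` ({..<k} \<times> {..<k})" by auto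
  then have "finite {\<bar>A i j\<bar> | i j. i < k \<and> j < k}" by simp
  then show ?thesis unfolding mat_norm_def using assms by (intro Max_ge) auto
qed

lemma assumption_A1_cases:
  assumes "assumption_A1 k q lam \<pi> Qs g"
  obtains \<epsilon>0 where "0 < \<epsilon>0" "\<forall>\<epsilon>. 0 < \<epsilon> \<and> \<epsilon> < \<epsilon>0 \<longrightarrow>
      (\<exists>Th. Th \<subseteq> Theta_lb k q lam \<and> Th \<in> sets \<pi> \<and> emeasure \<pi> Th > 0 \<and>
        (\<forall>\<theta>\<in>Th. mat_norm k (\<lambda>i j. fst \<theta> i j - Qs i j) < \<epsilon> \<and>
           Max ((\<lambda>i. A1b_integral k lam g (snd \<theta>) i) ` {..<k}) < ereal \<epsilon>))"
proof -
  from assms[unfolded assumption_A1_def] obtain \<epsilon>0 where "0 < \<epsilon>0" and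
    H: "\<forall>\<epsilon>. 0 < \<epsilon> \<and> \<epsilon> < \<epsilon>0 \<longrightarrow>
      (\<exists>Th. Th \<subseteq> Theta_lb k q lam \<and> Th \<in> sets \<pi> \<and> emeasure \<pi> Th > 0 \<and>
        (\<forall>(Q, f)\<in>Th.
           mat_norm k (\<lambda>i j. Q i j - Qs i j) < \<epsilon> \<and>
           Max ((\<lambda>i. A1b_integral k lam g f i) ` {..<k}) < ereal \<epsilon> \<and>
           (\<forall>y. (\<Sum>i<k. g i y) > 0 \<longrightarrow> (\<Sum>j<k. f j y) > 0) \<and>
           (\<exists>C. \<forall>y. (\<Sum>i<k. g i y) > 0 \<longrightarrow> (\<forall>j<k. f j y \<le> C)) \<and>
           (\<Sum>i<k. \<integral>\<^sup>+ y. ennreal (g i y * \<bar>ln (\<Sum>j<k. f j y)\<bar>) \<partial>lam) < \<infinity>))"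
    by (elim exE conjE) (rule that)
  show ?thesis
  proof (rule that[OF \<open>0 < \<epsilon>0\<close>], intro allI impI)
    fix \<epsilon> :: real assume "0 < \<epsilon> \<and> \<epsilon> < \<epsilon>0"
    from mp[OF spec[OF H] this]
    show "\<exists>Th. Th \<subseteq> Theta_lb k q lam \<and> Th \<in> sets \<pi> \<and> emeasure \<pi> Th > 0 \<and>
        (\<forall>\<theta>\<in>Th. mat_norm k (\<lambda>i j. fst \<theta> i j - Qs i j) < \<epsilon> \<and>
           Max ((\<lambda>i. A1b_integral k lam g (snd \<theta>) i) ` {..<k}) < ereal \<epsilon>)"
    proof (elim exE conjE, goal_cases)
      case (1 Th)
      note P = 1(4)[unfolded split_def, THEN bspec]
      show ?case by (intro exI[of _ Th] conjI ballI 1(1-3)) (blast dest: P)+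
    qed
  qed
qed

context hmm_bayes
begin

abbreviation excess :: "(nat \<Rightarrow> nat \<Rightarrow> real) \<times> (nat \<Rightarrow> 'y \<Rightarrow> real) \<Rightarrow> 'y \<Rightarrow> ennreal" where
  "excess \<theta> y \<equiv> e2ennreal (log_ratio_max k fstar (snd \<theta>) y)"

text \<open>Joint measurability is what allows the exceptional events of different parameters to be
  averaged over the prior.\<close>

lemma measurable_excess_joint:
  "(\<lambda>p. excess (fst p) (Y t (snd p))) \<in> borel_measurable (prior \<Otimes>\<^sub>M M)"
proof (intro measurable_compose[OF log_ratio_max_measurable measurable_e2ennreal])
  fix j assume j: "j < k"
  show "(\<lambda>p. fstar j (Y t (snd p))) \<in> borel_measurable (prior \<Otimes>\<^sub>M M)"
    by (rule measurable_compose[OF _ star.measurable_fs[OF j]]) measurable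
  have "(\<lambda>p. (snd (fst p), Y t (snd p))) \<in> measurable (prior \<Otimes>\<^sub>M M) (\<pi>f \<Otimes>\<^sub>M lam)" by measurable
  from measurable_compose[OF this priorf(3)[OF j]]
  show "(\<lambda>p. snd (fst p) j (Y t (snd p))) \<in> borel_measurable (prior \<Otimes>\<^sub>M M)" by simp
qed

lemma excess_exceed_prob:
  assumes f: "densities k lam (snd \<theta>)" and \<epsilon>: "0 < \<epsilon>" and c: "0 < c"
    and A1b: "\<And>i. i < k \<Longrightarrow> A1b_integral k lam fstar (snd \<theta>) i < ereal \<epsilon>"
  shows "M.prob {\<omega> \<in> space M. \<exists>n\<ge>1. of_nat n * ennreal c < (\<Sum>t<n. excess \<theta> (Y t \<omega>))} \<le> (2 * sqrt \<epsilon> + \<epsilon>) / c"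
proof (rule M.maximal_inequality_stationary[where lam = lam])
  have fm: "snd \<theta> j \<in> borel_measurable lam" if "j < k" for j
    using f that by (auto simp: densities_def is_density_def)
  show r: "excess \<theta> \<in> borel_measurable lam"
    using fm star.measurable_fs
    by (intro measurable_compose[OF log_ratio_max_measurable[where y = "\<lambda>y. y" and f = "\<lambda>_. snd \<theta>"] measurable_e2ennreal]) auto
  \<comment> \<open>The choice \<open>\<eta> = sqrt \<epsilon>\<close> balances the two terms of
    \<open>A1b_positive_part_le\<close>.\<close>
  have s: "sqrt \<epsilon> + \<epsilon> / (2 * sqrt \<epsilon>) + \<epsilon> \<le> 2 * sqrt \<epsilon> + \<epsilon>"
  proof -
    have "\<epsilon> / (2 * sqrt \<epsilon>) = \<epsilon> / sqrt \<epsilon> / 2" by simp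
    also have "\<dots> = sqrt \<epsilon> / 2" using \<epsilon> by (simp only: real_div_sqrt less_imp_le)
    finally show ?thesis using real_sqrt_ge_zero[of \<epsilon>] \<epsilon> by linarith
  qed
  show "(\<integral>\<^sup>+\<omega>. excess \<theta> (Y 0 \<omega>) \<partial>M) \<le> ennreal (2 * sqrt \<epsilon> + \<epsilon>)"
  proof (rule nn_integral_first_obs[OF r])
    fix i assume i: "i < k"
    have "(\<integral>\<^sup>+y. ennreal (fstar i y) * excess \<theta> y \<partial>lam) \<le> ennreal (sqrt \<epsilon> + \<epsilon> / (2 * sqrt \<epsilon>) + \<epsilon>)"
      using \<epsilon> by (intro A1b_positive_part_le[OF i fstar f _ A1b[OF i]]) simp
    also have "\<dots> \<le> ennreal (2 * sqrt \<epsilon> + \<epsilon>)" by (rule ennreal_leI[OF s])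
    finally show "(\<integral>\<^sup>+y. ennreal (fstar i y) * excess \<theta> y \<partial>lam) \<le> ennreal (2 * sqrt \<epsilon> + \<epsilon>)" .
  qed
  show "distr M (seq_space lam n) (\<lambda>\<omega>. \<lambda>t\<in>{..<n}. Y (s + t) \<omega>) = distr M (seq_space lam n) (obs_upto n)"
    if "1 \<le> n" for s n using process_stationary[OF that] obs(3)[OF that] by simp
qed (use obs c \<epsilon> in auto)

text \<open>For a single parameter the losses stay below \<open>c * n\<close> for all
  \<open>n\<close> off an event of probability at most \<open>d\<close>, but this event varies with
  the parameter. By Tonelli the expected prior mass of bad parameters in \<open>Th\<close> is at
  most \<open>d * m\<close>; by Markov it stays below \<open>m / 2\<close> off an event of
  probability at most \<open>2 * d\<close>. There the good half of \<open>Th\<close> alone supplies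
  the bound, for all \<open>n\<close>.\<close>

lemma evidence_lower_on_event:
  assumes Th: "Th \<in> sets prior" "Th \<subseteq> Theta_lb k q lam" and m: "0 < m" "\<pi>.prob Th = m"
    and \<epsilon>: "0 < \<epsilon>" "\<epsilon> < q" and c: "0 < c"
    and near: "\<And>\<theta>. \<theta> \<in> Th \<Longrightarrow> mat_norm k (\<lambda>i j. fst \<theta> i j - Qstar i j) < \<epsilon>"
    and A1b: "\<And>\<theta> i. \<theta> \<in> Th \<Longrightarrow> i < k \<Longrightarrow> A1b_integral k lam fstar (snd \<theta>) i < ereal \<epsilon>"
  shows "\<exists>W\<in>sets M. emeasure M W \<le> ennreal (2 * ((2 * sqrt \<epsilon> + \<epsilon>) / c)) \<and>
    (\<forall>\<omega>\<in>space M - W. \<forall>n\<ge>1. ennreal (m / 2 * (q * (1 - \<epsilon> / q) ^ n * exp (- c * n) * dens_true n (obs_upto n \<omega>)))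
      \<le> evidence_on (space prior) n (obs_upto n \<omega>))"
proof -
  define bad where "bad \<theta> \<omega> \<longleftrightarrow> (\<exists>n\<ge>1. of_nat n * ennreal c < (\<Sum>t<n. excess \<theta> (Y t \<omega>)))" for \<theta> \<omega>
  note [measurable] = Th(1) measurable_excess_joint
  interpret MP: pair_sigma_finite prior M ..
  have bad_meas[measurable]: "Measurable.pred (prior \<Otimes>\<^sub>M M) (\<lambda>p. bad (fst p) (snd p))"
    unfolding bad_def by measurable
  \<comment> \<open>Prior mass of the parameters in \<open>Th\<close> that are bad for the outcome
    \<omega>.\<close>
  define X where "X \<omega> = (\<integral>\<^sup>+\<theta>. indicator {\<theta> \<in> space prior. \<theta> \<in> Th \<and> bad \<theta> \<omega>} \<theta> \<partial>prior)" for \<omega>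
  have badS: "{\<theta> \<in> space prior. \<theta> \<in> Th \<and> bad \<theta> \<omega>} \<in> sets prior" if "\<omega> \<in> space M" for \<omega>
  proof -
    have "Measurable.pred prior (\<lambda>\<theta>. bad \<theta> \<omega>)"
      using measurable_compose[OF measurable_Pair2'[OF that] bad_meas] by simp
    then show ?thesis by measurable
  qed
  have Xe: "X \<omega> = emeasure prior {\<theta> \<in> space prior. \<theta> \<in> Th \<and> bad \<theta> \<omega>}" if "\<omega> \<in> space M" for \<omega>
    unfolding X_def using badS[OF that] by (rule nn_integral_indicator)
  define F where "F \<theta> \<omega> = (indicator {\<theta> \<in> space prior. \<theta> \<in> Th \<and> bad \<theta> \<omega>} \<theta> :: ennreal)" for \<theta> \<omega>
  have F: "case_prod F \<in> borel_measurable (prior \<Otimes>\<^sub>M M)"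
  proof -
    have "case_prod F = indicator {p. fst p \<in> space prior \<and> fst p \<in> Th \<and> bad (fst p) (snd p)}"
      by (auto simp: F_def indicator_def fun_eq_iff)
    moreover have "\<dots> \<in> borel_measurable (prior \<Otimes>\<^sub>M M)" by measurable
    ultimately show ?thesis by simp
  qed
  have X_meas[measurable]: "X \<in> borel_measurable M"
  proof -
    have "(\<lambda>(\<omega>, \<theta>). F \<theta> \<omega>) \<in> borel_measurable (M \<Otimes>\<^sub>M prior)"
      using measurable_compose[OF measurable_pair_swap' F] by (simp add: split_def)
    then show ?thesis unfolding X_def[abs_def] F_def[symmetric] by (rule \<pi>.borel_measurable_nn_integral)
  qed
  define d where "d = (2 * sqrt \<epsilon> + \<epsilon>) / c"
  have d: "0 \<le> d" using \<epsilon> c by (simp add: d_def)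
  have "(\<integral>\<^sup>+\<omega>. X \<omega> \<partial>M) = (\<integral>\<^sup>+\<theta>. (\<integral>\<^sup>+\<omega>. F \<theta> \<omega> \<partial>M) \<partial>prior)"
    unfolding X_def F_def[symmetric] by (rule MP.Fubini'[OF F])
  also have "\<dots> \<le> (\<integral>\<^sup>+\<theta>. ennreal d * indicator Th \<theta> \<partial>prior)"
  proof (rule nn_integral_mono)
    fix \<theta> assume \<theta>: "\<theta> \<in> space prior"
    show "(\<integral>\<^sup>+\<omega>. F \<theta> \<omega> \<partial>M) \<le> ennreal d * indicator Th \<theta>"
    proof (cases "\<theta> \<in> Th")
      case True
      have "Measurable.pred M (\<lambda>\<omega>. bad \<theta> \<omega>)"
        using measurable_compose[OF measurable_Pair1'[OF \<theta>] bad_meas] by simp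
      then have S: "{\<omega> \<in> space M. bad \<theta> \<omega>} \<in> sets M" by measurable
      have "(\<integral>\<^sup>+\<omega>. F \<theta> \<omega> \<partial>M) = (\<integral>\<^sup>+\<omega>. indicator {\<omega> \<in> space M. bad \<theta> \<omega>} \<omega> \<partial>M)"
        using True \<theta> by (intro nn_integral_cong) (auto simp: F_def indicator_def)
      also have "\<dots> = emeasure M {\<omega> \<in> space M. bad \<theta> \<omega>}" using S by (rule nn_integral_indicator)
      also have "\<dots> = ennreal (M.prob {\<omega> \<in> space M. bad \<theta> \<omega>})" by (rule M.emeasure_eq_measure)
      also have "\<dots> \<le> ennreal d" unfolding bad_def d_def
        using Th True by (intro ennreal_leI excess_exceed_prob[OF _ \<epsilon>(1) c A1b[OF True]]) (auto simp: Theta_lb_def)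
      finally show ?thesis using True by simp
    qed (simp add: F_def)
  qed
  also have "\<dots> = ennreal (d * m)"
    using m d by (simp add: nn_integral_cmult \<pi>.emeasure_eq_measure ennreal_mult)
  finally have EX: "(\<integral>\<^sup>+\<omega>. X \<omega> \<partial>M) \<le> ennreal (d * m)" .
  \<comment> \<open>Outcomes for which the bad parameters fill at least half of
    \<open>Th\<close>.\<close>
  define W where "W = {\<omega> \<in> space M. 1 \<le> ennreal (2 / m) * X \<omega>}"
  have W: "W \<in> sets M" unfolding W_def by measurable
  have "emeasure M W \<le> ennreal (2 / m) * (\<integral>\<^sup>+\<omega>. X \<omega> * indicator (space M) \<omega> \<partial>M)"
    unfolding W_def by (rule nn_integral_Markov_inequality) auto
  also have "(\<integral>\<^sup>+\<omega>. X \<omega> * indicator (space M) \<omega> \<partial>M) = (\<integral>\<^sup>+\<omega>. X \<omega> \<partial>M)"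
    by (intro nn_integral_cong) simp
  also have "ennreal (2 / m) * (\<integral>\<^sup>+\<omega>. X \<omega> \<partial>M) \<le> ennreal (2 / m) * ennreal (d * m)"
    using EX by (rule mult_left_mono) simp
  also have "\<dots> = ennreal (2 * d)" using m d by (subst ennreal_mult[symmetric]) auto
  finally have WP: "emeasure M W \<le> ennreal (2 * d)" .
  have low: "ennreal (m / 2 * (q * (1 - \<epsilon> / q) ^ n * exp (- c * n) * dens_true n (obs_upto n \<omega>)))
      \<le> evidence_on (space prior) n (obs_upto n \<omega>)" if \<omega>: "\<omega> \<in> space M - W" and n: "1 \<le> n" for \<omega> n
  proof -
    have n0: "n \<noteq> 0" using n by simp
    have \<omega>M: "\<omega> \<in> space M" using \<omega> by simp
    let ?B = "{\<theta> \<in> space prior. \<theta> \<in> Th \<and> bad \<theta> \<omega>}" and ?G = "Th - {\<theta> \<in> space prior. \<theta> \<in> Th \<and> bad \<theta> \<omega>}"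
    note B = badS[OF \<omega>M]
    have "ennreal (2 / m) * ennreal (\<pi>.prob ?B) < 1"
      using \<omega> by (auto simp: W_def not_le Xe[symmetric] \<pi>.emeasure_eq_measure[symmetric])
    then have "ennreal (2 / m * \<pi>.prob ?B) < 1" using m by (subst ennreal_mult) auto
    then have "2 / m * \<pi>.prob ?B < 1" by (simp only: ennreal_less_one_iff)
    then have "\<pi>.prob ?B < m / 2" using m by (simp add: field_simps)
    moreover have "\<pi>.prob ?G = \<pi>.prob Th - \<pi>.prob ?B"
      using B Th(1) by (intro \<pi>.finite_measure_Diff) auto
    ultimately have G: "m / 2 \<le> \<pi>.prob ?G" using m by simp
    define a where "a = q * (1 - \<epsilon> / q) ^ n * exp (- c * n) * dens_true n (obs_upto n \<omega>)"
    have a0: "0 \<le> a" unfolding a_def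
      using q \<epsilon> star.hmm_dens_nonneg[OF trans_mat_lb_trans_mat[OF Qstar] stat_true(2) n0]
      by (intro mult_nonneg_nonneg) (auto simp: field_simps)
    have "ennreal (m / 2 * a) \<le> ennreal a * emeasure prior ?G"
    proof -
      have "m / 2 * a \<le> a * \<pi>.prob ?G" using mult_left_mono[OF G a0] by (simp only: mult.commute)
      then show ?thesis unfolding \<pi>.emeasure_eq_measure
        using a0 by (subst ennreal_mult[symmetric]) (auto intro: ennreal_leI)
    qed
    also have "\<dots> = (\<integral>\<^sup>+\<theta>. ennreal a * indicator ?G \<theta> \<partial>prior)"
      using B Th(1) by (intro nn_integral_cmult_indicator[symmetric]) auto
    also have "\<dots> \<le> (\<integral>\<^sup>+\<theta>. indicator (space prior) \<theta> * ennreal (hmm_dens k (fst \<theta>) (snd \<theta>) \<mu> n (obs_upto n \<omega>)) \<partial>prior)"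
    proof (rule nn_integral_mono)
      fix \<theta> assume \<theta>: "\<theta> \<in> space prior"
      show "ennreal a * indicator ?G \<theta> \<le> indicator (space prior) \<theta> * ennreal (hmm_dens k (fst \<theta>) (snd \<theta>) \<mu> n (obs_upto n \<omega>))"
      proof (cases "\<theta> \<in> ?G")
        case True
        then have t: "\<theta> \<in> Th" "\<not> bad \<theta> \<omega>" using \<theta> by auto
        have f: "densities k lam (snd \<theta>)" using t Th(2) by (auto simp: Theta_lb_def)
        have nr: "\<bar>fst \<theta> i j - Qstar i j\<bar> \<le> \<epsilon>" if "i < k" "j < k" for i j
          using mat_norm_entry_le[OF that, of "\<lambda>i j. fst \<theta> i j - Qstar i j"] near[OF t(1)] by simp
        have "(\<Sum>t<n. excess \<theta> (obs_upto n \<omega> t)) = (\<Sum>t<n. excess \<theta> (Y t \<omega>))"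
          by (intro sum.cong) auto
        then have s: "(\<Sum>t<n. excess \<theta> (obs_upto n \<omega> t)) \<le> of_nat n * ennreal c"
          using t(2) n unfolding bad_def by (auto simp: not_less)
        have "a \<le> hmm_dens k (fst \<theta>) (snd \<theta>) \<mu> n (obs_upto n \<omega>)"
          unfolding a_def using c
          by (intro hmm_dens_lower[OF trans_mat_prior[OF \<theta>] Qstar q nr \<epsilon> mu(2) stat_true(2) n0 f fstar _ s]) auto
        then show ?thesis using True \<theta> by (simp add: ennreal_leI)
      qed simp
    qed
    finally show ?thesis unfolding evidence_on_def a_def .
  qed
  show ?thesis using W WP low unfolding d_def by blast
qed

lemma evidence_lower:
  fixes \<kappa> :: real
  assumes A1: "assumption_A1 k q lam prior Qstar fstar" and \<kappa>: "0 < \<kappa>"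
  shows "AE \<omega> in M. \<forall>\<^sub>F n in sequentially.
    ennreal (exp (- \<kappa> * n) * dens_true n (obs_upto n \<omega>)) \<le> evidence_on (space prior) n (obs_upto n \<omega>)"
proof (rule AE_if_small_exceptions)
  fix e :: real assume e: "0 < e"
  \<comment> \<open>The rate \<kappa> is divided up: one half for the emission losses, a quarter for
    the factor \<open>(1 - \<epsilon> / q) ^ n\<close>, and a quarter to absorb the constant
    \<open>m / 2 * q\<close> for large \<open>n\<close>. That constant depends on \<epsilon>, but
    \<epsilon> is fixed before \<open>n\<close> grows.\<close>
  define c where "c = \<kappa> / 2"
  have c: "0 < c" using \<kappa> by (simp add: c_def)
  obtain \<epsilon>0 where \<epsilon>0: "0 < \<epsilon>0" and A: "\<forall>\<epsilon>. 0 < \<epsilon> \<and> \<epsilon> < \<epsilon>0 \<longrightarrow>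
      (\<exists>Th. Th \<subseteq> Theta_lb k q lam \<and> Th \<in> sets prior \<and> emeasure prior Th > 0 \<and>
        (\<forall>\<theta>\<in>Th. mat_norm k (\<lambda>i j. fst \<theta> i j - Qstar i j) < \<epsilon> \<and>
           Max ((\<lambda>i. A1b_integral k lam fstar (snd \<theta>) i) ` {..<k}) < ereal \<epsilon>))"
    by (rule assumption_A1_cases[OF A1])
  have l1: "((\<lambda>\<epsilon>. 2 * ((2 * sqrt \<epsilon> + \<epsilon>) / c)) \<longlongrightarrow> 0) (at_right 0)"
    by (rule tendsto_eq_intros refl | use c in simp)+
  have l2: "((\<lambda>\<epsilon>. 1 - \<epsilon> / q) \<longlongrightarrow> 1) (at_right 0)"
    by (rule tendsto_eq_intros refl | use q in simp)+
  have "\<forall>\<^sub>F \<epsilon> in at_right 0. 2 * ((2 * sqrt \<epsilon> + \<epsilon>) / c) < e \<and> exp (- \<kappa> / 4) < 1 - \<epsilon> / q \<and> 0 < \<epsilon> \<and> \<epsilon> < min \<epsilon>0 q"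
    using order_tendstoD(2)[OF l1 e] order_tendstoD(1)[OF l2, of "exp (- \<kappa> / 4)"] \<kappa> \<epsilon>0 q
      eventually_at_right_real[of 0 "min \<epsilon>0 q"]
    by (auto simp: eventually_conj_iff)
  then obtain \<epsilon> where \<epsilon>: "2 * ((2 * sqrt \<epsilon> + \<epsilon>) / c) < e" "exp (- \<kappa> / 4) < 1 - \<epsilon> / q" "0 < \<epsilon>" "\<epsilon> < \<epsilon>0" "\<epsilon> < q"
    by (auto dest!: eventually_happens)
  obtain Th where Th: "Th \<subseteq> Theta_lb k q lam" "Th \<in> sets prior" "emeasure prior Th > 0"
    and Th': "\<And>\<theta>. \<theta> \<in> Th \<Longrightarrow> mat_norm k (\<lambda>i j. fst \<theta> i j - Qstar i j) < \<epsilon>"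
      "\<And>\<theta>. \<theta> \<in> Th \<Longrightarrow> Max ((\<lambda>i. A1b_integral k lam fstar (snd \<theta>) i) ` {..<k}) < ereal \<epsilon>"
    using mp[OF spec[OF A] conjI[OF \<epsilon>(3,4)]] by (elim exE conjE) blast
  have A1b: "A1b_integral k lam fstar (snd \<theta>) i < ereal \<epsilon>" if "\<theta> \<in> Th" "i < k" for \<theta> i
    using Th'(2)[OF that(1)] that(2) by (subst (asm) Max_less_iff) auto
  define m where "m = \<pi>.prob Th"
  have m: "0 < m" using Th(3) by (simp add: m_def \<pi>.emeasure_eq_measure)
  obtain W where W: "W \<in> sets M" "emeasure M W \<le> ennreal (2 * ((2 * sqrt \<epsilon> + \<epsilon>) / c))"
    and low: "\<And>\<omega> n. \<omega> \<in> space M - W \<Longrightarrow> 1 \<le> n \<Longrightarrow>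
      ennreal (m / 2 * (q * (1 - \<epsilon> / q) ^ n * exp (- c * n) * dens_true n (obs_upto n \<omega>)))
      \<le> evidence_on (space prior) n (obs_upto n \<omega>)"
    using evidence_lower_on_event[OF Th(2,1) m m_def[symmetric] \<epsilon>(3,5) c Th'(1) A1b] by blast
  have "(\<lambda>n. exp (- \<kappa> / 4) ^ n) \<longlonglongrightarrow> 0" using \<kappa> by (intro LIMSEQ_power_zero) simp
  moreover have "0 < m / 2 * q" using m q by simp
  ultimately have "\<forall>\<^sub>F n in sequentially. exp (- \<kappa> / 4) ^ n < m / 2 * q" by (rule order_tendstoD)
  then have ev: "\<forall>\<^sub>F n in sequentially. exp (- \<kappa> * n) \<le> m / 2 * (q * (1 - \<epsilon> / q) ^ n * exp (- c * n))"
  proof eventually_elim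
    case (elim n)
    have "exp (- \<kappa> * n) = exp (- \<kappa> / 4) ^ n * (exp (- \<kappa> / 4) ^ n * exp (- c * n))"
      by (simp add: exp_of_nat_mult[symmetric] exp_add[symmetric] c_def algebra_simps)
    also have "\<dots> \<le> m / 2 * q * ((1 - \<epsilon> / q) ^ n * exp (- c * n))"
      using elim \<epsilon>(2) m q by (intro mult_mono mult_right_mono power_mono) auto
    finally show ?case by (simp add: mult.assoc)
  qed
  have "\<forall>\<^sub>F n in sequentially. ennreal (exp (- \<kappa> * n) * dens_true n (obs_upto n \<omega>)) \<le> evidence_on (space prior) n (obs_upto n \<omega>)"
    if \<omega>: "\<omega> \<in> space M - W" for \<omega>
    using ev eventually_ge_at_top[of 1]
  proof eventually_elim
    case (elim n)
    have "0 \<le> dens_true n (obs_upto n \<omega>)"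
      using elim(2) by (intro star.hmm_dens_nonneg[OF trans_mat_lb_trans_mat[OF Qstar] stat_true(2)]) simp
    then have "exp (- \<kappa> * n) * dens_true n (obs_upto n \<omega>)
       \<le> m / 2 * (q * (1 - \<epsilon> / q) ^ n * exp (- c * n)) * dens_true n (obs_upto n \<omega>)"
      using elim(1) by (intro mult_right_mono)
    then have "ennreal (exp (- \<kappa> * n) * dens_true n (obs_upto n \<omega>))
      \<le> ennreal (m / 2 * (q * (1 - \<epsilon> / q) ^ n * exp (- c * n) * dens_true n (obs_upto n \<omega>)))"
      by (intro ennreal_leI) (simp add: mult.assoc)
    also note low[OF \<omega> elim(2)]
    finally show ?case .
  qed
  moreover have "emeasure M W \<le> ennreal e"
    using W(2) \<epsilon>(1) by (meson ennreal_leI less_imp_le order_trans)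
  ultimately show "\<exists>W\<in>sets M. emeasure M W \<le> ennreal e \<and> (\<forall>\<omega>\<in>space M - W. \<forall>\<^sub>F n in sequentially.
    ennreal (exp (- \<kappa> * n) * dens_true n (obs_upto n \<omega>)) \<le> evidence_on (space prior) n (obs_upto n \<omega>))"
    using W(1) by blast
qed

end

section \<open>Posterior mass and tests\<close>

lemma stat_law_eq: "stat_law k lam \<theta> l = hmm_law k lam (fst \<theta>) (snd \<theta>) (stat_dist k (fst \<theta>)) l"
  by (simp add: stat_law_def hmm_law_def stat_dens_def)

context hmm_bayes
begin

lemma posterior_eq:
  "posterior k \<mu> prior n A ys = evidence_on A n ys / evidence_on (space prior) n ys"
  unfolding posterior_def evidence_on_def
  by (intro arg_cong2[where f = "(/)"] refl nn_integral_cong) simp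

lemma evidence_split:
  assumes "n \<noteq> 0" "ys \<in> space (seq_space lam n)" "A \<in> sets prior"
  shows "evidence_on (space prior) n ys = evidence_on A n ys + evidence_on (space prior - A) n ys"
proof -
  note [measurable] = measurable_prior_density[OF assms(1,2)] assms(3)
  have "evidence_on A n ys + evidence_on (space prior - A) n ys
    = (\<integral>\<^sup>+\<theta>. indicator A \<theta> * ennreal (hmm_dens k (fst \<theta>) (snd \<theta>) \<mu> n ys)
        + indicator (space prior - A) \<theta> * ennreal (hmm_dens k (fst \<theta>) (snd \<theta>) \<mu> n ys) \<partial>prior)"
    unfolding evidence_on_def by (rule nn_integral_add[symmetric]) measurable
  also have "\<dots> = evidence_on (space prior) n ys"
    unfolding evidence_on_def by (intro nn_integral_cong) (auto simp: indicator_def)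
  finally show ?thesis by simp
qed

lemma sets_evidence_event:
  assumes n: "n \<noteq> 0" and B: "B \<in> sets prior" and T[measurable]: "T \<in> sets (seq_space lam n)"
  shows "{\<omega> \<in> space M. obs_upto n \<omega> \<in> T \<and> ennreal (dens_true n (obs_upto n \<omega>)) \<le> ennreal a * evidence_on B n (obs_upto n \<omega>)} \<in> sets M"
proof -
  note [measurable] = measurable_evidence_on[OF n B]
  have d: "(\<lambda>\<omega>. ennreal (dens_true n (obs_upto n \<omega>))) \<in> borel_measurable M"
    by (rule measurable_compose[OF measurable_compose[OF measurable_obs_upto star.measurable_hmm_dens] measurable_ennreal])
  have e: "(\<lambda>\<omega>. ennreal a * evidence_on B n (obs_upto n \<omega>)) \<in> borel_measurable M" by measurable
  have "{\<omega> \<in> space M. obs_upto n \<omega> \<in> T} \<in> sets M" by measurable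
  then have "{\<omega> \<in> space M. obs_upto n \<omega> \<in> T} \<inter> {\<omega> \<in> space M. ennreal (dens_true n (obs_upto n \<omega>)) \<le> ennreal a * evidence_on B n (obs_upto n \<omega>)} \<in> sets M"
    using borel_measurable_le[OF d e] by (rule sets.Int)
  also have "{\<omega> \<in> space M. obs_upto n \<omega> \<in> T} \<inter> {\<omega> \<in> space M. ennreal (dens_true n (obs_upto n \<omega>)) \<le> ennreal a * evidence_on B n (obs_upto n \<omega>)}
    = {\<omega> \<in> space M. obs_upto n \<omega> \<in> T \<and> ennreal (dens_true n (obs_upto n \<omega>)) \<le> ennreal a * evidence_on B n (obs_upto n \<omega>)}" by blast
  finally show ?thesis .
qed

text \<open>Relative to the true density the mass outside \<open>A\<close> is at most
  \<open>exp (- c * n / 2)\<close> and the total at least \<open>exp (- c * n / 4)\<close>, so the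
  posterior mass outside \<open>A\<close> is at most \<open>exp (- c * n / 4)\<close>.\<close>

lemma posterior_ratio_bound:
  assumes n: "1 \<le> n" and \<omega>: "\<omega> \<in> space M" and A: "A \<in> sets prior"
    and fin: "evidence_on (space prior) n (obs_upto n \<omega>) < \<infinity>" and pos: "0 < dens_true n (obs_upto n \<omega>)"
    and low: "ennreal (exp (- (c / 4) * n) * dens_true n (obs_upto n \<omega>)) \<le> evidence_on (space prior) n (obs_upto n \<omega>)"
    and num: "ennreal (exp (c / 2 * n)) * evidence_on (space prior - A) n (obs_upto n \<omega>) \<le> ennreal (dens_true n (obs_upto n \<omega>))"
  shows "ennreal (1 - exp (- (c / 4) * n)) \<le> posterior k \<mu> prior n A (obs_upto n \<omega>)"
    and "posterior k \<mu> prior n A (obs_upto n \<omega>) \<le> 1"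
proof -
  have sp: "obs_upto n \<omega> \<in> space (seq_space lam n)" using measurable_space[OF measurable_obs_upto \<omega>] .
  have split: "evidence_on (space prior) n (obs_upto n \<omega>) = evidence_on A n (obs_upto n \<omega>) + evidence_on (space prior - A) n (obs_upto n \<omega>)"
    using n by (intro evidence_split[OF _ sp A]) simp
  obtain a b where a: "evidence_on A n (obs_upto n \<omega>) = ennreal a" "0 \<le> a"
    and b: "evidence_on (space prior - A) n (obs_upto n \<omega>) = ennreal b" "0 \<le> b"
    using fin unfolding split by (cases "evidence_on A n (obs_upto n \<omega>)"; cases "evidence_on (space prior - A) n (obs_upto n \<omega>)") auto
  define d where "d = dens_true n (obs_upto n \<omega>)"
  have ab: "evidence_on (space prior) n (obs_upto n \<omega>) = ennreal (a + b)" using split a b by simp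
  have l: "exp (- (c / 4) * n) * d \<le> a + b"
    using low a b unfolding ab d_def[symmetric] by (subst (asm) ennreal_le_iff) auto
  have "ennreal (exp (c / 2 * n) * b) \<le> ennreal d"
    using num b(2) unfolding b(1) d_def[symmetric] by (subst ennreal_mult) auto
  then have "exp (c / 2 * n) * b \<le> d" using pos by (subst (asm) ennreal_le_iff) (auto simp: d_def)
  then have "exp (- (c / 2) * n) * (exp (c / 2 * n) * b) \<le> exp (- (c / 2) * n) * d" by (intro mult_left_mono) auto
  then have "b \<le> exp (- (c / 2) * n) * d" by (simp add: mult.assoc[symmetric] exp_add[symmetric])
  also have "\<dots> = exp (- (c / 4) * n) * (exp (- (c / 4) * n) * d)"
    by (simp add: mult.assoc[symmetric] exp_add[symmetric])
  also have "\<dots> \<le> exp (- (c / 4) * n) * (a + b)" using l by (intro mult_left_mono) auto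
  finally have bb: "b \<le> exp (- (c / 4) * n) * (a + b)" .
  have p: "0 < a + b" using l pos by (smt (verit) d_def exp_gt_zero mult_pos_pos)
  have post: "posterior k \<mu> prior n A (obs_upto n \<omega>) = ennreal (a / (a + b))"
    unfolding posterior_eq ab a(1) using a p by (simp add: divide_ennreal)
  have "(1 - exp (- (c / 4) * n)) * (a + b) \<le> a" using bb by (simp add: algebra_simps)
  then show "ennreal (1 - exp (- (c / 4) * n)) \<le> posterior k \<mu> prior n A (obs_upto n \<omega>)"
    unfolding post using p by (intro ennreal_leI) (simp add: pos_le_divide_eq)
  show "posterior k \<mu> prior n A (obs_upto n \<omega>) \<le> 1"
    unfolding post using p b by (simp add: ennreal_le_1)
qed

text \<open>Schwartz's argument with acceptance regions \<open>T n\<close>: the truth is rejected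
  only finitely often, and within \<open>T n\<close> the evidence outside \<open>A\<close> is
  exponentially small because its prior-averaged probability of acceptance is.\<close>

lemma posterior_consistent:
  assumes A1: "assumption_A1 k q lam prior Qstar fstar" and A: "A \<in> sets prior"
    and T: "\<And>n. T n \<in> sets (seq_space lam n)" and c: "0 < c" and C: "0 \<le> C"
    and sumT: "summable (\<lambda>n. M.prob {\<omega> \<in> space M. obs_upto (Suc n) \<omega> \<notin> T (Suc n)})"
    and num: "\<And>n. 1 \<le> n \<Longrightarrow> (\<integral>\<^sup>+\<theta>. indicator (space prior - A) \<theta> * emeasure (hmm_law k lam (fst \<theta>) (snd \<theta>) \<mu> n) (T n) \<partial>prior)
       \<le> ennreal (C * exp (- c * n))"
  shows "AE \<omega> in M. (\<lambda>n. posterior k \<mu> prior n A (obs_upto n \<omega>)) \<longlonglongrightarrow> 1"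
proof -
  let ?B = "space prior - A"
  have B: "?B \<in> sets prior" using A by auto
  \<comment> \<open>The threshold takes half of the exponent: \<open>evidence_tail\<close> bounds
    the probability of \<open>E n\<close> by \<open>exp (c * n / 2) * C * exp (- c * n)\<close>,
    which is still summable.\<close>
  define E where "E n = {\<omega> \<in> space M. obs_upto n \<omega> \<in> T n \<and> ennreal (dens_true n (obs_upto n \<omega>)) \<le> ennreal (exp (c / 2 * n)) * evidence_on ?B n (obs_upto n \<omega>)}" for n
  have E: "E (Suc n) \<in> sets M" for n unfolding E_def by (rule sets_evidence_event[OF _ B T]) simp
  have Ep: "M.prob (E (Suc n)) \<le> C * exp (- (c / 2)) ^ Suc n" for n
  proof -
    have "emeasure M (E (Suc n)) \<le> ennreal (exp (c / 2 * Suc n)) * ennreal (C * exp (- c * Suc n))"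
      unfolding E_def
      by (rule order_trans[OF evidence_tail[OF _ B T] mult_left_mono[OF num]]) simp_all
    also have "\<dots> = ennreal (exp (c / 2 * Suc n) * (C * exp (- c * Suc n)))"
      using C by (simp add: ennreal_mult)
    also have "exp (c / 2 * Suc n) * (C * exp (- c * Suc n)) = C * exp (- (c / 2)) ^ Suc n"
    proof -
      have "exp (c / 2 * Suc n) * exp (- c * Suc n) = exp (Suc n * - (c / 2))"
        unfolding exp_add[symmetric] by (simp add: field_simps)
      then show ?thesis unfolding exp_of_nat_mult by (metis mult.left_commute)
    qed
    finally show ?thesis unfolding M.emeasure_eq_measure
      using C by (subst (asm) ennreal_le_iff) auto
  qed
  have sC: "summable (\<lambda>n. C * exp (- (c / 2)) ^ Suc n)"
    using c by (intro summable_mult summable_Suc_iff[THEN iffD2] summable_geometric) simp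
  have sE: "summable (\<lambda>n. M.prob (E (Suc n)))"
    by (rule summable_comparison_test'[OF sC, of 0]) (simp only: real_norm_def abs_of_nonneg[OF measure_nonneg] Ep)
  have mT: "{\<omega> \<in> space M. obs_upto (Suc n) \<omega> \<notin> T (Suc n)} \<in> sets M" for n
    using T[of "Suc n"] by measurable
  have e1: "AE \<omega> in M. \<forall>\<^sub>F n in sequentially. \<omega> \<in> space M - {\<omega> \<in> space M. obs_upto (Suc n) \<omega> \<notin> T (Suc n)}"
    by (rule borel_cantelli_AE1[OF mT _ sumT]) (simp add: M.emeasure_eq_measure)
  have e2: "AE \<omega> in M. \<forall>\<^sub>F n in sequentially. \<omega> \<in> space M - E (Suc n)"
    by (rule borel_cantelli_AE1[OF E _ sE]) (simp add: M.emeasure_eq_measure)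
  have e3: "AE \<omega> in M. \<forall>\<^sub>F n in sequentially.
    ennreal (exp (- (c / 4) * n) * dens_true n (obs_upto n \<omega>)) \<le> evidence_on (space prior) n (obs_upto n \<omega>)"
    using evidence_lower[OF A1, of "c / 4"] c by simp
  show ?thesis using AE_space e1 e2 e3 evidence_finite dens_true_pos
  proof eventually_elim
    case (elim \<omega>)
    have "\<forall>\<^sub>F n in sequentially. \<omega> \<in> space M - {\<omega> \<in> space M. obs_upto n \<omega> \<notin> T n}"
      "\<forall>\<^sub>F n in sequentially. \<omega> \<in> space M - E n"
      using elim(2,3) by (subst eventually_sequentially_Suc[symmetric], simp)+
    then have ev: "\<forall>\<^sub>F n in sequentially. ennreal (1 - exp (- (c / 4) * n)) \<le> posterior k \<mu> prior n A (obs_upto n \<omega>)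
       \<and> posterior k \<mu> prior n A (obs_upto n \<omega>) \<le> 1"
      using elim(4) eventually_ge_at_top[of 1]
    proof eventually_elim
      case (elim n)
      note fn = elim
      have num: "ennreal (exp (c / 2 * n)) * evidence_on ?B n (obs_upto n \<omega>) \<le> ennreal (dens_true n (obs_upto n \<omega>))"
        using fn(1,2) unfolding E_def by auto
      show ?case
        using posterior_ratio_bound[OF fn(4) \<open>\<omega> \<in> space M\<close> A _ _ fn(3) num]
          \<open>\<forall>n\<ge>1. evidence_on (space prior) n (obs_upto n \<omega>) < \<infinity>\<close> \<open>\<forall>n\<ge>1. 0 < dens_true n (obs_upto n \<omega>)\<close> fn(4)
        by blast
    qed
    have "(\<lambda>n. exp (- (c / 4)) ^ n) \<longlonglongrightarrow> 0" using c by (intro LIMSEQ_power_zero) simp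
    then have "(\<lambda>n. 1 - exp (- (c / 4)) ^ n) \<longlonglongrightarrow> 1 - 0" by (intro tendsto_diff tendsto_const)
    then have "(\<lambda>n. ennreal (1 - exp (- (c / 4)) ^ n)) \<longlonglongrightarrow> ennreal (1 - 0)" by (rule tendsto_ennrealI)
    moreover have "exp (- (c / 4)) ^ n = exp (- (c / 4) * n)" for n :: nat
      by (metis exp_of_nat_mult mult.commute)
    ultimately have lim: "(\<lambda>n. ennreal (1 - exp (- (c / 4) * n))) \<longlonglongrightarrow> 1" by simp
    show ?case
      by (rule tendsto_sandwich[OF _ _ lim tendsto_const]; rule eventually_mono[OF ev]; blast)
  qed
qed

end

section \<open>Tests from separated windows\<close>

lemma exp_div_le:
  fixes a :: real
  assumes "0 \<le> a" "0 < L"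
  shows "exp (- (real (n div L) * a)) \<le> exp a * exp (- (a / L) * n)"
proof -
  \<comment> \<open>There are at least \<open>n / L - 1\<close> full blocks; the missing one costs
    the factor \<open>exp a\<close>.\<close>
  have "real n \<le> real (Suc (n div L) * L)"
    using assms(2) dividend_less_div_times[of L n] unfolding of_nat_le_iff by simp
  then have "a / L * n \<le> a / L * (Suc (n div L) * L)" using assms by (intro mult_left_mono) auto
  also have "\<dots> = a + real (n div L) * a" using assms(2) by (simp add: field_simps)
  finally show ?thesis unfolding exp_add[symmetric] by simp
qed

context hmm_bayes
begin

definition test_stat :: "nat \<Rightarrow> nat \<Rightarrow> ((nat \<Rightarrow> 'y) \<Rightarrow> real) \<Rightarrow> nat \<Rightarrow> (nat \<Rightarrow> 'y) \<Rightarrow> real" where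
  "test_stat g l H n ys = (\<Sum>b<n div (g + l). H (window (b * (g + l) + g) l ys))"

lemma measurable_test_stat:
  assumes [measurable]: "H \<in> borel_measurable (seq_space lam l)"
  shows "test_stat g l H n \<in> borel_measurable (seq_space lam n)"
  unfolding test_stat_def[abs_def]
proof (rule borel_measurable_sum)
  fix b assume "b \<in> {..<n div (g + l)}"
  then have "Suc b * (g + l) \<le> n div (g + l) * (g + l)" by (intro mult_right_mono) auto
  also have "\<dots> \<le> n" by simp
  finally have "b * (g + l) + g + l \<le> n" by simp
  then show "(\<lambda>ys. H (window (b * (g + l) + g) l ys)) \<in> borel_measurable (seq_space lam n)" by measurable
qed

text \<open>The test is one-sided in each \<open>H\<close>. A two-sided one is obtained by putting a
  function and its reflection into \<open>Hs\<close>.\<close>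

definition accept :: "nat \<Rightarrow> nat \<Rightarrow> real \<Rightarrow> ((nat \<Rightarrow> 'y) \<Rightarrow> real) set \<Rightarrow> nat \<Rightarrow> (nat \<Rightarrow> 'y) set" where
  "accept g l \<gamma> Hs n = {ys \<in> space (seq_space lam n). \<forall>H\<in>Hs.
     test_stat g l H n ys < real (n div (g + l)) * ((\<integral>ys. H ys \<partial>stat_law k lam (Qstar, fstar) l) + \<gamma>)}"

lemma sets_accept:
  assumes "finite Hs" "\<And>H. H \<in> Hs \<Longrightarrow> H \<in> borel_measurable (seq_space lam l)"
  shows "accept g l \<gamma> Hs n \<in> sets (seq_space lam n)"
  unfolding accept_def
proof (intro sets.sets_Collect_finite_All assms(1))
  show "{ys \<in> space (seq_space lam n). test_stat g l H n ys
     < real (n div (g + l)) * ((\<integral>ys. H ys \<partial>stat_law k lam (Qstar, fstar) l) + \<gamma>)} \<in> sets (seq_space lam n)" if "H \<in> Hs" for H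
    by (intro borel_measurable_less measurable_test_stat assms that borel_measurable_const)
qed

lemma accept_false_alarm:
  assumes l: "l \<noteq> 0" and \<gamma>: "0 < \<gamma>" "\<gamma> \<le> 1" "2 * (1 - k * q) ^ g \<le> \<gamma> / 4"
    and Hs: "finite Hs" "\<And>H. H \<in> Hs \<Longrightarrow> H \<in> borel_measurable (seq_space lam l)"
      "\<And>H ys. H \<in> Hs \<Longrightarrow> 0 \<le> H ys \<and> H ys \<le> 1"
    and n: "1 \<le> n"
  shows "M.prob {\<omega> \<in> space M. obs_upto n \<omega> \<notin> accept g l \<gamma> Hs n}
    \<le> card Hs * (exp (\<gamma>\<^sup>2 / 8) * exp (- (\<gamma>\<^sup>2 / 8 / real (g + l)) * n))"
proof -
  let ?L = "seq_space lam n" and ?P = "law_true n"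
  let ?R = "\<lambda>H. {ys \<in> space ?L. real (n div (g + l)) * ((\<integral>ys. H ys \<partial>stat_law k lam (Qstar, fstar) l) + \<gamma>) \<le> test_stat g l H n ys}"
  have n0: "n \<noteq> 0" using n by simp
  interpret P: prob_space ?P
    by (rule star.prob_space_hmm_law[OF trans_mat_lb_trans_mat[OF Qstar] stat_true(2) n0])
  have acc: "space ?L - accept g l \<gamma> Hs n \<in> sets ?L" using sets_accept[OF Hs(1,2)] by auto
  have R: "?R H \<in> sets ?L" if "H \<in> Hs" for H
    by (intro borel_measurable_le measurable_test_stat Hs that borel_measurable_const)
  have "{\<omega> \<in> space M. obs_upto n \<omega> \<notin> accept g l \<gamma> Hs n} = {\<omega> \<in> space M. obs_upto n \<omega> \<in> space ?L - accept g l \<gamma> Hs n}"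
    using measurable_space[OF measurable_obs_upto[of n]] by blast
  then have "M.prob {\<omega> \<in> space M. obs_upto n \<omega> \<notin> accept g l \<gamma> Hs n} = P.prob (space ?L - accept g l \<gamma> Hs n)"
    using emeasure_obs[OF n acc] by (simp add: measure_def)
  also have "\<dots> \<le> P.prob (\<Union>H\<in>Hs. ?R H)"
    using R Hs(1) by (intro P.finite_measure_mono) (auto simp: accept_def not_less)
  also have "\<dots> \<le> (\<Sum>H\<in>Hs. P.prob (?R H))"
    using R Hs(1) by (intro P.finite_measure_subadditive_finite) auto
  also have "\<dots> \<le> (\<Sum>H\<in>Hs. exp (\<gamma>\<^sup>2 / 8) * exp (- (\<gamma>\<^sup>2 / 8 / real (g + l)) * n))"
  proof (rule sum_mono)
    fix H assume H: "H \<in> Hs"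
    have "P.prob (?R H) \<le> exp (- (real (n div (g + l)) * \<gamma>\<^sup>2 / 8))"
      unfolding stat_law_eq fst_conv snd_conv test_stat_def
      by (rule star.block_deviation[OF Qstar stat_true(2) q l n0 _ Hs(2)[OF H] Hs(3)[OF H] \<gamma>]) simp
    also have "\<dots> \<le> exp (\<gamma>\<^sup>2 / 8) * exp (- (\<gamma>\<^sup>2 / 8 / real (g + l)) * n)"
      using exp_div_le[of "\<gamma>\<^sup>2 / 8" "g + l" n] l by simp
    finally show "P.prob (?R H) \<le> exp (\<gamma>\<^sup>2 / 8) * exp (- (\<gamma>\<^sup>2 / 8 / real (g + l)) * n)" .
  qed
  finally show ?thesis by simp
qed

text \<open>Under \<theta> the mean of \<open>H\<close> exceeds the true one by
  \<open>2 * \<gamma>\<close>, so acceptance means that the window average falls \<gamma> below its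
  own mean: an upward deviation of \<open>1 - H\<close>. Starting from \<mu> is harmless since
  \<open>block_deviation\<close> allows any initial law.\<close>

lemma accept_miss:
  assumes l: "l \<noteq> 0" and \<gamma>: "0 < \<gamma>" "\<gamma> \<le> 1" "2 * (1 - k * q) ^ g \<le> \<gamma> / 4"
    and Hs: "finite Hs" "\<And>H. H \<in> Hs \<Longrightarrow> H \<in> borel_measurable (seq_space lam l)"
      "\<And>H ys. H \<in> Hs \<Longrightarrow> 0 \<le> H ys \<and> H ys \<le> 1"
    and n: "1 \<le> n" and \<theta>: "\<theta> \<in> Theta_lb k q lam"
    and H: "H \<in> Hs" "(\<integral>ys. H ys \<partial>stat_law k lam (Qstar, fstar) l) + 2 * \<gamma> \<le> (\<integral>ys. H ys \<partial>stat_law k lam \<theta> l)"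
  shows "measure (hmm_law k lam (fst \<theta>) (snd \<theta>) \<mu> n) (accept g l \<gamma> Hs n)
    \<le> exp (\<gamma>\<^sup>2 / 8) * exp (- (\<gamma>\<^sup>2 / 8 / real (g + l)) * n)"
proof -
  let ?L = "seq_space lam n" and ?P = "hmm_law k lam (fst \<theta>) (snd \<theta>) \<mu> n" and ?N = "n div (g + l)"
  have Q: "trans_mat_lb k q (fst \<theta>)" and f: "densities k lam (snd \<theta>)" using \<theta> by (auto simp: Theta_lb_def)
  note t = trans_mat_lb_trans_mat[OF Q]
  have n0: "n \<noteq> 0" using n by simp
  interpret E: emission lam k "snd \<theta>" using lam k f by (auto simp: emission_def emission_axioms_def)
  have st: "prob_row k (stat_dist k (fst \<theta>))"
    by (rule prob_vecs_prob_row[OF stat_dist_stationary(1)[OF Q k q]])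
  have \<mu>: "prob_row k \<mu>" by (rule prob_vecs_prob_row[OF mu(1)])
  interpret P: prob_space ?P by (rule E.prob_space_hmm_law[OF t \<mu> n0])
  interpret S: prob_space "stat_law k lam \<theta> l" unfolding stat_law_eq by (rule E.prob_space_hmm_law[OF t st l])
  define H' where "H' ys = 1 - H ys" for ys
  have H'm: "H' \<in> borel_measurable (seq_space lam l)" unfolding H'_def using Hs(2)[OF H(1)] by measurable
  have H'01: "0 \<le> H' ys \<and> H' ys \<le> 1" for ys using Hs(3)[OF H(1), of ys] by (simp add: H'_def)
  have "integrable (stat_law k lam \<theta> l) H" unfolding stat_law_eq
    using Hs(3)[OF H(1)] by (intro E.integrable_hmm_law[OF t st l Hs(2)[OF H(1)], of 1]) auto
  then have e': "(\<integral>ys. H' ys \<partial>stat_law k lam \<theta> l) = 1 - (\<integral>ys. H ys \<partial>stat_law k lam \<theta> l)"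
    unfolding H'_def using S.prob_space by simp
  let ?R = "{ys \<in> space ?L. real ?N * ((\<integral>ys. H' ys \<partial>stat_law k lam \<theta> l) + \<gamma>) \<le> test_stat g l H' n ys}"
  have R: "?R \<in> sets ?L" by (intro borel_measurable_le measurable_test_stat H'm borel_measurable_const)
  have "accept g l \<gamma> Hs n \<subseteq> ?R"
  proof
    fix ys assume ys: "ys \<in> accept g l \<gamma> Hs n"
    have "test_stat g l H n ys < real ?N * ((\<integral>ys. H ys \<partial>stat_law k lam (Qstar, fstar) l) + \<gamma>)"
      using ys H(1) by (auto simp: accept_def)
    also have "\<dots> \<le> real ?N * ((\<integral>ys. H ys \<partial>stat_law k lam \<theta> l) - \<gamma>)" using H(2) by (intro mult_left_mono) auto
    finally have "real ?N * ((\<integral>ys. H' ys \<partial>stat_law k lam \<theta> l) + \<gamma>) \<le> real ?N - test_stat g l H n ys"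
      unfolding e' by (simp add: algebra_simps)
    also have "\<dots> = test_stat g l H' n ys" by (simp add: test_stat_def H'_def sum_subtractf)
    finally show "ys \<in> ?R" using ys by (auto simp: accept_def)
  qed
  then have "P.prob (accept g l \<gamma> Hs n) \<le> P.prob ?R" using R by (intro P.finite_measure_mono) auto
  also have "\<dots> \<le> exp (- (real ?N * \<gamma>\<^sup>2 / 8))"
    unfolding stat_law_eq test_stat_def
    by (rule E.block_deviation[OF Q \<mu> q l n0 _ H'm H'01 \<gamma>]) simp
  also have "\<dots> \<le> exp (\<gamma>\<^sup>2 / 8) * exp (- (\<gamma>\<^sup>2 / 8 / real (g + l)) * n)"
    using exp_div_le[of "\<gamma>\<^sup>2 / 8" "g + l" n] l by simp
  finally show ?thesis .
qed

text \<open>Common core of both parts. A parameter outside \<open>A\<close> either lies in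
  \<open>B n\<close>, where small prior mass suffices, or is separated from the truth by some member
  of \<open>Hs n\<close>, where the miss probability is small. The family may grow with
  \<open>n\<close> as long as its size, which enters the false alarms through a union bound, is
  beaten by the exponent.\<close>

lemma test_consistency:
  fixes r C \<gamma> :: real
  assumes A1: "assumption_A1 k q lam prior Qstar fstar" and A: "A \<in> sets prior"
    and support: "AE \<theta> in prior. \<theta> \<in> Theta_lb k q lam"
    and l: "l \<noteq> 0" and \<gamma>: "0 < \<gamma>" "\<gamma> \<le> 1" "2 * (1 - k * q) ^ g \<le> \<gamma> / 4"
    and Hs: "\<And>n. finite (Hs n)" "\<And>n H. H \<in> Hs n \<Longrightarrow> H \<in> borel_measurable (seq_space lam l)"
      "\<And>n H ys. H \<in> Hs n \<Longrightarrow> 0 \<le> H ys \<and> H ys \<le> 1"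
    and sum: "summable (\<lambda>n. card (Hs (Suc n)) * exp (- (\<gamma>\<^sup>2 / 8 / real (g + l)) * Suc n))"
    and B: "\<And>n. 1 \<le> n \<Longrightarrow> B n \<in> sets prior" "\<And>n. 1 \<le> n \<Longrightarrow> emeasure prior (B n) \<le> ennreal (C * exp (- real n * r))"
    and r: "0 < r" "0 \<le> C"
    and sep: "\<And>n \<theta>. 1 \<le> n \<Longrightarrow> \<theta> \<in> space prior \<Longrightarrow> \<theta> \<in> Theta_lb k q lam \<Longrightarrow> \<theta> \<notin> A \<Longrightarrow> \<theta> \<notin> B n \<Longrightarrow>
      \<exists>H\<in>Hs n. (\<integral>ys. H ys \<partial>stat_law k lam (Qstar, fstar) l) + 2 * \<gamma> \<le> (\<integral>ys. H ys \<partial>stat_law k lam \<theta> l)"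
  shows "AE \<omega> in M. (\<lambda>n. posterior k \<mu> prior n A (obs_upto n \<omega>)) \<longlonglongrightarrow> 1"
proof (rule posterior_consistent[OF A1 A])
  let ?K = "exp (\<gamma>\<^sup>2 / 8)"
  define \<rho> where "\<rho> = \<gamma>\<^sup>2 / 8 / real (g + l)"
  have \<rho>: "0 < \<rho>" using \<gamma> l by (simp add: \<rho>_def)
  show "accept g l \<gamma> (Hs n) n \<in> sets (seq_space lam n)" for n by (rule sets_accept[OF Hs(1)[of n] Hs(2)[of _ n]])
  show "0 < min \<rho> r" using \<rho> r by simp
  show "0 \<le> ?K + C" using r by (simp add: add_nonneg_nonneg)
  have s: "summable (\<lambda>n. ?K * (card (Hs (Suc n)) * exp (- \<rho> * Suc n)))"
    unfolding \<rho>_def by (intro summable_mult sum)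
  have le: "M.prob {\<omega> \<in> space M. obs_upto (Suc n) \<omega> \<notin> accept g l \<gamma> (Hs (Suc n)) (Suc n)}
     \<le> ?K * (card (Hs (Suc n)) * exp (- \<rho> * Suc n))" for n
  proof -
    have "M.prob {\<omega> \<in> space M. obs_upto (Suc n) \<omega> \<notin> accept g l \<gamma> (Hs (Suc n)) (Suc n)}
      \<le> card (Hs (Suc n)) * (?K * exp (- \<rho> * Suc n))"
      unfolding \<rho>_def by (rule accept_false_alarm[OF l \<gamma>]) (use Hs in auto)
    then show ?thesis by (simp only: mult.left_commute)
  qed
  show "summable (\<lambda>n. M.prob {\<omega> \<in> space M. obs_upto (Suc n) \<omega> \<notin> accept g l \<gamma> (Hs (Suc n)) (Suc n)})"
    by (rule summable_comparison_test'[OF s, of 0]) (simp only: real_norm_def abs_of_nonneg[OF measure_nonneg] le)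
  fix n :: nat assume n: "1 \<le> n"
  note [measurable] = B(1)[OF n]
  have "(\<integral>\<^sup>+\<theta>. indicator (space prior - A) \<theta> * emeasure (hmm_law k lam (fst \<theta>) (snd \<theta>) \<mu> n) (accept g l \<gamma> (Hs n) n) \<partial>prior)
    \<le> (\<integral>\<^sup>+\<theta>. ennreal (?K * exp (- \<rho> * n)) + indicator (B n) \<theta> \<partial>prior)"
  proof (rule nn_integral_mono_AE)
    show "AE \<theta> in prior. indicator (space prior - A) \<theta> * emeasure (hmm_law k lam (fst \<theta>) (snd \<theta>) \<mu> n) (accept g l \<gamma> (Hs n) n)
      \<le> ennreal (?K * exp (- \<rho> * n)) + indicator (B n) \<theta>"
      using support AE_space
    proof eventually_elim
      case (elim \<theta>)
      interpret E: emission lam k "snd \<theta>" by (rule emission_prior[OF elim(2)])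
      interpret P: prob_space "hmm_law k lam (fst \<theta>) (snd \<theta>) \<mu> n"
        using n by (intro E.prob_space_hmm_law[OF trans_mat_prior[OF elim(2)] prob_vecs_prob_row[OF mu(1)]]) simp
      show ?case
      proof (cases "\<theta> \<in> A")
        case nA: False
        show ?thesis
        proof (cases "\<theta> \<in> B n")
          case True
          have "emeasure (hmm_law k lam (fst \<theta>) (snd \<theta>) \<mu> n) (accept g l \<gamma> (Hs n) n) \<le> 0 + 1" using P.emeasure_le_1 by simp
          also have "\<dots> \<le> ennreal (?K * exp (- \<rho> * n)) + indicator (B n) \<theta>"
            using True by (intro add_mono) auto
          finally show ?thesis using nA elim(2) by simp
        next
          case False
          obtain H where "H \<in> Hs n" "(\<integral>ys. H ys \<partial>stat_law k lam (Qstar, fstar) l) + 2 * \<gamma> \<le> (\<integral>ys. H ys \<partial>stat_law k lam \<theta> l)"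
            using sep[OF n elim(2,1) nA False] by blast
          then have "P.prob (accept g l \<gamma> (Hs n) n) \<le> ?K * exp (- \<rho> * n)"
            unfolding \<rho>_def by (intro accept_miss[OF l \<gamma> _ _ _ n elim(1)] Hs) auto
          then show ?thesis using nA False elim(2) by (simp add: P.emeasure_eq_measure ennreal_leI)
        qed
      qed simp
    qed
  qed
  also have "\<dots> = ennreal (?K * exp (- \<rho> * n)) + emeasure prior (B n)"
    by (subst nn_integral_add) (auto simp: \<pi>.emeasure_space_1)
  also have "\<dots> \<le> ennreal (?K * exp (- \<rho> * n)) + ennreal (C * exp (- real n * r))"
    using B(2)[OF n] by (intro add_left_mono)
  also have "\<dots> \<le> ennreal (?K * exp (- min \<rho> r * n)) + ennreal (C * exp (- min \<rho> r * n))"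
  proof -
    have "min \<rho> r * n \<le> \<rho> * n" "min \<rho> r * n \<le> r * n" by (intro mult_right_mono; simp)+
    then show ?thesis using r by (intro add_mono ennreal_leI mult_left_mono) (auto simp: mult.commute)
  qed
  also have "\<dots> = ennreal ((?K + C) * exp (- min \<rho> r * n))"
    using r by (subst ennreal_plus[symmetric]) (auto simp: distrib_right)
  finally show "(\<integral>\<^sup>+\<theta>. indicator (space prior - A) \<theta> * emeasure (hmm_law k lam (fst \<theta>) (snd \<theta>) \<mu> n) (accept g l \<gamma> (Hs n) n) \<partial>prior)
    \<le> ennreal ((?K + C) * exp (- min \<rho> r * n))" .
qed

end

section \<open>Covering and L1 estimates\<close>

text \<open>Finiteness excludes the infimum over the empty set, and a set of natural numbers has a
  least element.\<close>

lemma covering_number_attained: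
  assumes "covering_number S D \<delta> A < \<infinity>"
  shows "\<exists>T. finite T \<and> T \<subseteq> S \<and> (\<forall>a\<in>A. \<exists>t\<in>T. D a t \<le> \<delta>) \<and> of_nat (card T) \<le> covering_number S D \<delta> A"
proof -
  let ?P = "\<lambda>T. finite T \<and> T \<subseteq> S \<and> (\<forall>a\<in>A. \<exists>t\<in>T. D a t \<le> \<delta>)"
  have "\<exists>T. ?P T"
  proof (rule ccontr)
    assume "\<not> ?thesis"
    then have e: "{T. ?P T} = {}" by blast
    have "covering_number S D \<delta> A = \<infinity>" unfolding covering_number_def e by simp
    then show False using assms by simp
  qed
  then obtain T0 where T0: "?P T0" by (rule exE)
  obtain T where T: "?P T \<and> (\<forall>T'. ?P T' \<longrightarrow> card T \<le> card T')"
    using ex_has_least_nat[of ?P, OF T0, of card] by (rule exE)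
  have "of_nat (card T) \<le> covering_number S D \<delta> A"
    unfolding covering_number_def using T by (intro INF_greatest) simp
  with T show ?thesis by (intro exI[of _ T]) simp
qed

text \<open>Telescoping over the factors: \<open>a * A - b * B = (a - b) * A + (A - B) * b\<close>,
  where \<open>A\<close> and \<open>b\<close> integrate to 1.\<close>

lemma (in product_sigma_finite) nn_integral_prod_diff_le:
  fixes a b :: "'i \<Rightarrow> 'a \<Rightarrow> real"
  assumes "finite I"
    and "\<And>i. i \<in> I \<Longrightarrow> a i \<in> borel_measurable (M i)" "\<And>i. i \<in> I \<Longrightarrow> b i \<in> borel_measurable (M i)"
    and "\<And>i y. i \<in> I \<Longrightarrow> 0 \<le> a i y" "\<And>i y. i \<in> I \<Longrightarrow> 0 \<le> b i y"
    and "\<And>i. i \<in> I \<Longrightarrow> (\<integral>\<^sup>+y. ennreal (a i y) \<partial>M i) = 1" "\<And>i. i \<in> I \<Longrightarrow> (\<integral>\<^sup>+y. ennreal (b i y) \<partial>M i) = 1"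
  shows "(\<integral>\<^sup>+y. ennreal \<bar>(\<Prod>i\<in>I. a i (y i)) - (\<Prod>i\<in>I. b i (y i))\<bar> \<partial>Pi\<^sub>M I M)
    \<le> (\<Sum>i\<in>I. \<integral>\<^sup>+y. ennreal \<bar>a i y - b i y\<bar> \<partial>M i)"
  using assms
proof (induction I)
  case (insert i I)
  interpret I: finite_product_sigma_finite M I by standard (rule insert)
  interpret J: finite_product_sigma_finite M "insert i I" by standard (simp add: insert)
  let ?A = "\<lambda>y. \<Prod>j\<in>I. a j (y j)" and ?B = "\<lambda>y. \<Prod>j\<in>I. b j (y j)"
  have am[measurable]: "a i \<in> borel_measurable (M i)" "b i \<in> borel_measurable (M i)" using insert.prems by auto
  have AB[measurable]: "?A \<in> borel_measurable (Pi\<^sub>M I M)" "?B \<in> borel_measurable (Pi\<^sub>M I M)"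
    using insert.prems by (auto intro!: borel_measurable_prod measurable_compose[OF measurable_component_singleton])
  have A0: "0 \<le> ?A y" for y using insert.prems by (intro prod_nonneg) auto
  have A1: "(\<integral>\<^sup>+y. ennreal (?A y) \<partial>Pi\<^sub>M I M) = 1"
  proof -
    have "(\<integral>\<^sup>+y. ennreal (?A y) \<partial>Pi\<^sub>M I M) = (\<integral>\<^sup>+y. (\<Prod>j\<in>I. ennreal (a j (y j))) \<partial>Pi\<^sub>M I M)"
      using insert.prems by (intro nn_integral_cong prod_ennreal[symmetric]) auto
    also have "\<dots> = (\<Prod>j\<in>I. \<integral>\<^sup>+y. ennreal (a j y) \<partial>M j)"
      using insert.prems insert.hyps by (intro product_nn_integral_prod) auto
    finally show ?thesis using insert.prems by simp
  qed
  have "(\<integral>\<^sup>+y. ennreal \<bar>(\<Prod>i\<in>insert i I. a i (y i)) - (\<Prod>i\<in>insert i I. b i (y i))\<bar> \<partial>Pi\<^sub>M (insert i I) M)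
    = (\<integral>\<^sup>+y. (\<integral>\<^sup>+z. ennreal \<bar>(\<Prod>j\<in>insert i I. a j ((y(i := z)) j)) - (\<Prod>j\<in>insert i I. b j ((y(i := z)) j))\<bar> \<partial>M i) \<partial>Pi\<^sub>M I M)"
  proof (rule product_nn_integral_insert[OF insert.hyps])
    have "(\<lambda>y. \<Prod>i\<in>insert i I. c i (y i)) \<in> borel_measurable (Pi\<^sub>M (insert i I) M)"
      if "\<And>j. j \<in> insert i I \<Longrightarrow> c j \<in> borel_measurable (M j)" for c :: "'i \<Rightarrow> 'a \<Rightarrow> real"
      using that by (auto intro!: borel_measurable_prod measurable_compose[OF measurable_component_singleton])
    from this[of a] this[of b] insert.prems
    show "(\<lambda>y. ennreal \<bar>(\<Prod>i\<in>insert i I. a i (y i)) - (\<Prod>i\<in>insert i I. b i (y i))\<bar>) \<in> borel_measurable (Pi\<^sub>M (insert i I) M)"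
      by (intro measurable_compose[OF _ measurable_ennreal] borel_measurable_abs borel_measurable_diff) auto
  qed
  also have "\<dots> = (\<integral>\<^sup>+y. (\<integral>\<^sup>+z. ennreal \<bar>a i z * ?A y - b i z * ?B y\<bar> \<partial>M i) \<partial>Pi\<^sub>M I M)"
  proof -
    have "(\<Prod>j\<in>insert i I. c j ((y(i := z)) j)) = c i z * (\<Prod>j\<in>I. c j (y j))" for c :: "'i \<Rightarrow> 'a \<Rightarrow> real" and y z
    proof -
      have "(\<Prod>j\<in>I. c j ((y(i := z)) j)) = (\<Prod>j\<in>I. c j (y j))"
        using insert.hyps by (intro prod.cong) auto
      then show ?thesis using insert.hyps by simp
    qed
    then show ?thesis by (simp only:)
  qed
  also have "\<dots> \<le> (\<integral>\<^sup>+y. (\<integral>\<^sup>+z. ennreal (?A y) * ennreal \<bar>a i z - b i z\<bar> + ennreal \<bar>?A y - ?B y\<bar> * ennreal (b i z) \<partial>M i) \<partial>Pi\<^sub>M I M)"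
  proof (intro nn_integral_mono)
    fix y z
    have b0: "0 \<le> b i z" using insert.prems by auto
    have "\<bar>a i z * ?A y - b i z * ?B y\<bar> = \<bar>?A y * (a i z - b i z) + (?A y - ?B y) * b i z\<bar>"
      by (simp add: algebra_simps)
    also have "\<dots> \<le> ?A y * \<bar>a i z - b i z\<bar> + \<bar>?A y - ?B y\<bar> * b i z"
      using A0[of y] b0 by (intro order_trans[OF abs_triangle_ineq]) (simp add: abs_mult)
    finally show "ennreal \<bar>a i z * ?A y - b i z * ?B y\<bar>
      \<le> ennreal (?A y) * ennreal \<bar>a i z - b i z\<bar> + ennreal \<bar>?A y - ?B y\<bar> * ennreal (b i z)"
      using A0[of y] b0 by (simp add: ennreal_mult[symmetric] ennreal_plus[symmetric] ennreal_leI del: ennreal_plus)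
  qed
  also have "\<dots> = (\<integral>\<^sup>+y. ennreal (?A y) * (\<integral>\<^sup>+z. ennreal \<bar>a i z - b i z\<bar> \<partial>M i) + ennreal \<bar>?A y - ?B y\<bar> \<partial>Pi\<^sub>M I M)"
    using insert.prems by (simp add: nn_integral_add nn_integral_cmult)
  also have "\<dots> = (\<integral>\<^sup>+z. ennreal \<bar>a i z - b i z\<bar> \<partial>M i) + (\<integral>\<^sup>+y. ennreal \<bar>?A y - ?B y\<bar> \<partial>Pi\<^sub>M I M)"
    by (simp add: nn_integral_add nn_integral_multc A1)
  also have "\<dots> \<le> (\<integral>\<^sup>+z. ennreal \<bar>a i z - b i z\<bar> \<partial>M i) + (\<Sum>i\<in>I. \<integral>\<^sup>+y. ennreal \<bar>a i y - b i y\<bar> \<partial>M i)"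
    using insert by (intro add_left_mono insert.IH) auto
  finally show ?case using insert.hyps by simp
qed simp

lemma path_weight_le_1:
  assumes "trans_mat k Q" "prob_row k v" "x \<in> paths k n" "n \<noteq> 0"
  shows "path_weight Q v n x \<le> 1"
proof -
  have "path_weight Q v n x \<le> (\<Sum>x\<in>paths k n. path_weight Q v n x)"
    using assms path_weight_nonneg by (intro member_le_sum finite_PiE) auto
  also have "\<dots> = chain_exp k Q n v (\<lambda>_. 1)" using assms by (simp add: chain_exp_eq_sum)
  also have "\<dots> = 1" by (rule chain_exp_const[OF assms(1,2)])
  finally show ?thesis .
qed

text \<open>Rounding down \<open>m w\<close> leaves finitely many classes; pick one representative of each.\<close>

lemma finite_floor_net:
  fixes w :: "'q \<Rightarrow> 'x \<Rightarrow> real" and m :: nat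
  assumes X: "finite X" and w: "\<And>Q x. Q \<in> S \<Longrightarrow> x \<in> X \<Longrightarrow> 0 \<le> w Q x \<and> w Q x \<le> 1" and m: "0 < m"
  shows "\<exists>R. finite R \<and> R \<subseteq> S \<and> (\<forall>Q\<in>S. \<exists>Q0\<in>R. \<forall>x\<in>X. \<bar>w Q x - w Q0 x\<bar> \<le> 1 / m)"
proof -
  define cl where "cl Q = (\<lambda>x\<in>X. \<lfloor>m * w Q x\<rfloor>)" for Q
  have "cl ` S \<subseteq> (\<Pi>\<^sub>E x\<in>X. {0..int m})"
  proof
    fix c assume "c \<in> cl ` S"
    then obtain Q where Q: "Q \<in> S" "c = cl Q" by auto
    have "0 \<le> \<lfloor>m * w Q x\<rfloor> \<and> \<lfloor>m * w Q x\<rfloor> \<le> int m" if "x \<in> X" for x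
    proof -
      have "m * w Q x \<le> m" using w[OF Q(1) that] m by (simp add: mult_left_le)
      then have "\<lfloor>m * w Q x\<rfloor> \<le> \<lfloor>real m\<rfloor>" by (rule floor_mono)
      then show ?thesis using w[OF Q(1) that] by simp
    qed
    then show "c \<in> (\<Pi>\<^sub>E x\<in>X. {0..int m})" unfolding Q(2) cl_def by auto
  qed
  then have fin: "finite (cl ` S)" using X by (intro finite_subset[OF _ finite_PiE]) auto
  define R where "R = inv_into S cl ` cl ` S"
  have "\<exists>Q0\<in>R. \<forall>x\<in>X. \<bar>w Q x - w Q0 x\<bar> \<le> 1 / m" if Q: "Q \<in> S" for Q
  proof (rule bexI)
    let ?Q0 = "inv_into S cl (cl Q)"
    show "?Q0 \<in> R" using Q by (auto simp: R_def)
    show "\<forall>x\<in>X. \<bar>w Q x - w ?Q0 x\<bar> \<le> 1 / m"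
    proof
      fix x assume x: "x \<in> X"
      have "cl ?Q0 = cl Q" using Q by (intro f_inv_into_f) auto
      then have "\<lfloor>m * w ?Q0 x\<rfloor> = \<lfloor>m * w Q x\<rfloor>" using x by (auto simp: cl_def dest: fun_cong[of _ _ x])
      then have "\<bar>m * w Q x - m * w ?Q0 x\<bar> \<le> 1" by linarith
      then have "m * \<bar>w Q x - w ?Q0 x\<bar> \<le> 1" by (simp add: abs_mult right_diff_distrib[symmetric])
      then show "\<bar>w Q x - w ?Q0 x\<bar> \<le> 1 / m" using m by (simp add: field_simps)
    qed
  qed
  moreover have "R \<subseteq> S" by (auto simp: R_def inv_into_into)
  ultimately show ?thesis using fin unfolding R_def by blast
qed

section \<open>Weak consistency\<close>

context hmm_bayes
begin

lemma exists_gap: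
  assumes "0 < \<gamma>" shows "\<exists>g. 2 * (1 - k * q) ^ g \<le> \<gamma> / 4"
proof -
  have "0 \<le> 1 - k * q" "1 - k * q < 1" using trans_mat_lb_rate[OF Qstar k] k q by auto
  then have "(\<lambda>g. (1 - k * q) ^ g) \<longlonglongrightarrow> 0" by (intro LIMSEQ_power_zero) simp
  from order_tendstoD(2)[OF this, of "\<gamma> / 8"] assms obtain g where "(1 - k * q) ^ g < \<gamma> / 8"
    by (auto simp: eventually_sequentially)
  then show ?thesis by (intro exI[of _ g]) simp
qed

lemma true_in_Theta_lb: "(Qstar, fstar) \<in> Theta_lb k q lam"
  using Qstar fstar by (simp add: Theta_lb_def)

lemma emission_Theta_lb: "\<theta> \<in> Theta_lb k q lam \<Longrightarrow> emission lam k (snd \<theta>)"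
  using lam k by (auto simp: emission_def emission_axioms_def Theta_lb_def)

lemma Theta_lb_chain:
  assumes "\<theta> \<in> Theta_lb k q lam"
  shows "trans_mat_lb k q (fst \<theta>)" "trans_mat k (fst \<theta>)" "prob_row k (stat_dist k (fst \<theta>))"
proof -
  show Q: "trans_mat_lb k q (fst \<theta>)" using assms by (auto simp: Theta_lb_def)
  show "trans_mat k (fst \<theta>)" by (rule trans_mat_lb_trans_mat[OF Q])
  show "prob_row k (stat_dist k (fst \<theta>))" by (rule prob_vecs_prob_row[OF stat_dist_stationary(1)[OF Q k q]])
qed

lemma
  fixes F :: "_ \<Rightarrow> real"
  assumes \<theta>: "\<theta> \<in> Theta_lb k q lam" and l: "l \<noteq> 0"
  shows measurable_stat_dens: "stat_dens k \<theta> l \<in> borel_measurable (seq_space lam l)"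
    and prob_space_stat_law: "prob_space (stat_law k lam \<theta> l)"
    and integrable_stat_dens: "integrable (seq_space lam l) (stat_dens k \<theta> l)"
    and integral_stat_dens: "(\<integral>ys. stat_dens k \<theta> l ys \<partial>(seq_space lam l)) = 1"
    and integral_stat_law: "F \<in> borel_measurable (seq_space lam l) \<Longrightarrow>
      (\<integral>ys. F ys \<partial>stat_law k lam \<theta> l) = (\<integral>ys. stat_dens k \<theta> l ys * F ys \<partial>(seq_space lam l))"
    and integrable_stat_dens_mult: "F \<in> borel_measurable (seq_space lam l) \<Longrightarrow> (\<And>ys. \<bar>F ys\<bar> \<le> B) \<Longrightarrow>
      integrable (seq_space lam l) (\<lambda>ys. stat_dens k \<theta> l ys * F ys)"
proof -
  interpret E: emission lam k "snd \<theta>" by (rule emission_Theta_lb[OF \<theta>])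
  note c = Theta_lb_chain[OF \<theta>]
  have nn: "0 \<le> stat_dens k \<theta> l ys" for ys
    unfolding stat_dens_def by (rule E.hmm_dens_nonneg[OF c(2,3) l])
  show meas: "stat_dens k \<theta> l \<in> borel_measurable (seq_space lam l)"
    unfolding stat_dens_def[abs_def] by (rule E.measurable_hmm_dens)
  show ps: "prob_space (stat_law k lam \<theta> l)" unfolding stat_law_eq by (rule E.prob_space_hmm_law[OF c(2,3) l])
  then interpret P: prob_space "stat_law k lam \<theta> l" .
  show int: "integrable (seq_space lam l) (\<lambda>ys. stat_dens k \<theta> l ys * F ys)"
    if "F \<in> borel_measurable (seq_space lam l)" "\<And>ys. \<bar>F ys\<bar> \<le> B" for F :: "_ \<Rightarrow> real" and B
    unfolding stat_dens_def by (rule E.integrable_hmm_dens_mult[OF c(2,3) l that])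
  from int[of "\<lambda>_. 1" 1] show "integrable (seq_space lam l) (stat_dens k \<theta> l)" by simp
  show I: "(\<integral>ys. F ys \<partial>stat_law k lam \<theta> l) = (\<integral>ys. stat_dens k \<theta> l ys * F ys \<partial>(seq_space lam l))"
    if "F \<in> borel_measurable (seq_space lam l)" for F :: "_ \<Rightarrow> real"
    unfolding stat_law_def using that meas nn by (subst integral_density) auto
  show "(\<integral>ys. stat_dens k \<theta> l ys \<partial>(seq_space lam l)) = 1"
    using I[of "\<lambda>_. 1"] P.prob_space by simp
qed

section \<open>Measurability of sets of parameters\<close>

lemma measurable_stat_limit:
  assumes "i < k" shows "(\<lambda>\<theta>. stat_limit k (fst \<theta>) i) \<in> borel_measurable prior"
proof -
  have "(\<lambda>Q. (chain_step k Q ^^ n) (\<lambda>i. if i = 0 then 1 else 0) j) \<in> borel_measurable \<pi>Q" for n j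
  proof (induction n arbitrary: j)
    case (Suc n)
    have "chain_step k Q v j = (if j < k then (\<Sum>i<k. v i * Q i j) else 0)" for Q v by (simp add: chain_step_def)
    then show ?case unfolding funpow.simps comp_def
      by (simp only:) (cases "j < k"; simp; intro borel_measurable_sum borel_measurable_times Suc.IH priorQ(3); simp)
  qed simp
  then have "(\<lambda>Q. stat_limit k Q i) \<in> borel_measurable \<pi>Q"
    unfolding stat_limit_def by (rule borel_measurable_lim_metric)
  from measurable_compose[OF measurable_fst this] show ?thesis .
qed

lemma measurable_joint_stat_limit:
  "l \<noteq> 0 \<Longrightarrow> (\<lambda>p. hmm_dens k (fst (fst p)) (snd (fst p)) (stat_limit k (fst (fst p))) l (snd p))
    \<in> borel_measurable (prior \<Otimes>\<^sub>M (seq_space lam l))"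
  using measurable_joint_density[where v = "\<lambda>\<theta>. stat_limit k (fst \<theta>)"] measurable_stat_limit by simp

lemma stat_dens_limit:
  "\<theta> \<in> Theta_lb k q lam \<Longrightarrow> stat_dens k \<theta> l ys = hmm_dens k (fst \<theta>) (snd \<theta>) (stat_limit k (fst \<theta>)) l ys"
  unfolding stat_dens_def using stat_dist_eq_limit[OF Theta_lb_chain(1) k q] by simp

text \<open>Within the space of the prior all other conditions hold automatically, leaving finitely
  many inequalities between measurable coordinates.\<close>

lemma sets_Theta_lb: "{\<theta> \<in> space prior. \<theta> \<in> Theta_lb k q lam} \<in> sets prior"
proof -
  have "{\<theta> \<in> space prior. \<theta> \<in> Theta_lb k q lam} = {\<theta> \<in> space prior. \<forall>i\<in>{..<k}. \<forall>j\<in>{..<k}. q \<le> fst \<theta> i j}"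
    using priorQ(2) priorf(2) by (auto simp: Theta_lb_def trans_mat_lb_def space_pair_measure)
  moreover have "(\<lambda>\<theta>. fst \<theta> i j) \<in> borel_measurable prior" if "i < k" "j < k" for i j
    by (rule measurable_compose[OF measurable_fst priorQ(3)[OF that]])
  ultimately show ?thesis
    by (simp only:) (intro sets.sets_Collect_finite_All borel_measurable_le; simp)
qed

text \<open>Intersecting with \<open>Theta_lb\<close> permits replacing \<open>stat_dist\<close> by
  \<open>stat_limit\<close>, after which the integral is a measurable function of the parameter.
  \<Phi> is later a product with a test function or the distance to the true density.\<close>

lemma sets_stat_functional:
  assumes "(\<lambda>p. \<Phi> (hmm_dens k (fst (fst p)) (snd (fst p)) (stat_limit k (fst (fst p))) l (snd p)) (snd p))
      \<in> borel_measurable (prior \<Otimes>\<^sub>M (seq_space lam l))" and S: "S \<in> sets borel"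
  shows "{\<theta> \<in> space prior. \<theta> \<in> Theta_lb k q lam \<and> (\<integral>ys. \<Phi> (stat_dens k \<theta> l ys) ys \<partial>(seq_space lam l)) \<in> (S :: real set)} \<in> sets prior"
proof -
  interpret L: sigma_finite_measure "seq_space lam l" by (rule star.PF.sigma_finite) simp
  have "(\<lambda>\<theta>. \<integral>ys. \<Phi> (hmm_dens k (fst \<theta>) (snd \<theta>) (stat_limit k (fst \<theta>)) l ys) ys \<partial>(seq_space lam l)) \<in> borel_measurable prior"
    using assms(1) by (intro L.borel_measurable_lebesgue_integral) (simp add: split_def)
  from measurable_sets[OF this S] sets_Theta_lb
  have "((\<lambda>\<theta>. \<integral>ys. \<Phi> (hmm_dens k (fst \<theta>) (snd \<theta>) (stat_limit k (fst \<theta>)) l ys) ys \<partial>(seq_space lam l)) -` S \<inter> space prior)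
    \<inter> {\<theta> \<in> space prior. \<theta> \<in> Theta_lb k q lam} \<in> sets prior" by (rule sets.Int)
  also have "((\<lambda>\<theta>. \<integral>ys. \<Phi> (hmm_dens k (fst \<theta>) (snd \<theta>) (stat_limit k (fst \<theta>)) l ys) ys \<partial>(seq_space lam l)) -` S \<inter> space prior)
    \<inter> {\<theta> \<in> space prior. \<theta> \<in> Theta_lb k q lam}
    = {\<theta> \<in> space prior. \<theta> \<in> Theta_lb k q lam \<and> (\<integral>ys. \<Phi> (stat_dens k \<theta> l ys) ys \<partial>(seq_space lam l)) \<in> S}"
    by (auto simp: stat_dens_limit)
  finally show ?thesis .
qed

text \<open>A parameter outside \<open>A\<close> moves the mean of some \<open>h\<close> by at least
  \<epsilon> in one of two directions, so finitely many fixed tests suffice and no set of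
  exceptional parameters has to be removed.\<close>

lemma weak_consistency:
  fixes G :: "((nat \<Rightarrow> 'y) \<Rightarrow> real) set"
  assumes A1: "assumption_A1 k q lam prior Qstar fstar"
    and support: "AE \<theta> in prior. \<theta> \<in> Theta_lb k q lam"
    and l: "l \<noteq> 0" and \<epsilon>: "0 < \<epsilon>" and G: "finite G" "\<And>h. h \<in> G \<Longrightarrow> h \<in> borel_measurable (seq_space lam l)"
    and bd: "\<And>h ys. h \<in> G \<Longrightarrow> \<bar>h ys\<bar> \<le> B" and B: "0 < B"
  defines "A \<equiv> {\<theta> \<in> space prior. \<theta> \<in> Theta_lb k q lam \<and>
    (\<forall>h\<in>G. \<bar>(\<integral>ys. h ys \<partial>stat_law k lam \<theta> l) - (\<integral>ys. h ys \<partial>stat_law k lam (Qstar, fstar) l)\<bar> < \<epsilon>)}"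
  shows "A \<in> sets prior" and "AE \<omega> in M. (\<lambda>n. posterior k \<mu> prior n A (obs_upto n \<omega>)) \<longlonglongrightarrow> 1"
proof -
  have Ah: "{\<theta> \<in> space prior. \<theta> \<in> Theta_lb k q lam \<and>
    \<bar>(\<integral>ys. h ys \<partial>stat_law k lam \<theta> l) - (\<integral>ys. h ys \<partial>stat_law k lam (Qstar, fstar) l)\<bar> < \<epsilon>} \<in> sets prior" if h: "h \<in> G" for h
  proof -
    let ?e = "\<integral>ys. h ys \<partial>stat_law k lam (Qstar, fstar) l"
    have "(\<lambda>p. hmm_dens k (fst (fst p)) (snd (fst p)) (stat_limit k (fst (fst p))) l (snd p) * h (snd p))
      \<in> borel_measurable (prior \<Otimes>\<^sub>M (seq_space lam l))"
      using measurable_joint_stat_limit[OF l] measurable_compose[OF measurable_snd G(2)[OF h]]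
      by (rule borel_measurable_times)
    from sets_stat_functional[where \<Phi> = "\<lambda>a ys. a * h ys", OF this, of "{?e - \<epsilon><..<?e + \<epsilon>}"]
    have "{\<theta> \<in> space prior. \<theta> \<in> Theta_lb k q lam \<and> (\<integral>ys. stat_dens k \<theta> l ys * h ys \<partial>(seq_space lam l)) \<in> {?e - \<epsilon><..<?e + \<epsilon>}} \<in> sets prior"
      by simp
    also have "{\<theta> \<in> space prior. \<theta> \<in> Theta_lb k q lam \<and> (\<integral>ys. stat_dens k \<theta> l ys * h ys \<partial>(seq_space lam l)) \<in> {?e - \<epsilon><..<?e + \<epsilon>}}
      = {\<theta> \<in> space prior. \<theta> \<in> Theta_lb k q lam \<and> \<bar>(\<integral>ys. h ys \<partial>stat_law k lam \<theta> l) - ?e\<bar> < \<epsilon>}"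
      using integral_stat_law[OF _ l G(2)[OF h]] by (auto simp: abs_less_iff)
    finally show ?thesis .
  qed
  have Aeq: "A = {\<theta> \<in> space prior. \<forall>h\<in>G. \<theta> \<in> Theta_lb k q lam \<and>
    \<bar>(\<integral>ys. h ys \<partial>stat_law k lam \<theta> l) - (\<integral>ys. h ys \<partial>stat_law k lam (Qstar, fstar) l)\<bar> < \<epsilon>} \<inter> {\<theta> \<in> space prior. \<theta> \<in> Theta_lb k q lam}"
    unfolding A_def by blast
  show A: "A \<in> sets prior" unfolding Aeq
    by (intro sets.Int sets_Theta_lb sets.sets_Collect_finite_All G Ah)
  \<comment> \<open>Rescaling to the unit interval divides differences of means by
    \<open>2 * B\<close>, so a shift of \<epsilon> becomes at least
    \<open>2 * \<gamma>\<close>.\<close>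
  define \<gamma> where "\<gamma> = min 1 (\<epsilon> / (4 * B))"
  have \<gamma>: "0 < \<gamma>" "\<gamma> \<le> 1" "\<gamma> \<le> \<epsilon> / (4 * B)" using \<epsilon> B by (auto simp: \<gamma>_def)
  obtain g where g: "2 * (1 - k * q) ^ g \<le> \<gamma> / 4" using exists_gap[OF \<gamma>(1)] by blast
  \<comment> \<open>Both orientations of \<open>h\<close>, mapped to the unit interval, because
    \<open>accept\<close> detects only means that are too large.\<close>
  define pos where "pos h ys = (B + h ys) / (2 * B)" for h :: "(nat \<Rightarrow> 'y) \<Rightarrow> real" and ys
  define neg where "neg h ys = (B - h ys) / (2 * B)" for h :: "(nat \<Rightarrow> 'y) \<Rightarrow> real" and ys
  define Hs where "Hs = pos ` G \<union> neg ` G"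
  show "AE \<omega> in M. (\<lambda>n. posterior k \<mu> prior n A (obs_upto n \<omega>)) \<longlonglongrightarrow> 1"
  proof (rule test_consistency[OF A1 A support l \<gamma>(1,2) g, where Hs = "\<lambda>_. Hs" and B = "\<lambda>_. {}" and C = 0 and r = 1])
    show "finite Hs" using G by (simp add: Hs_def)
    show "H \<in> borel_measurable (seq_space lam l)" if "H \<in> Hs" for H
      using that G(2) unfolding Hs_def pos_def neg_def
      by (auto intro!: borel_measurable_divide borel_measurable_add borel_measurable_diff borel_measurable_const)
    show "0 \<le> H ys \<and> H ys \<le> 1" if H: "H \<in> Hs" for H ys
    proof -
      obtain h where h: "h \<in> G" "H = pos h \<or> H = neg h" using H by (auto simp: Hs_def)
      then show ?thesis using bd[OF h(1), of ys] B by (auto simp: pos_def neg_def abs_le_iff field_simps)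
    qed
    have "exp (- (\<gamma>\<^sup>2 / 8 / real (g + l)) * Suc n) = exp (- (\<gamma>\<^sup>2 / 8 / real (g + l))) ^ Suc n" for n
      by (metis exp_of_nat_mult mult.commute)
    moreover have "summable (\<lambda>n. card Hs * exp (- (\<gamma>\<^sup>2 / 8 / real (g + l))) ^ Suc n)"
      using \<gamma>(1) l by (intro summable_mult summable_Suc_iff[THEN iffD2] summable_geometric) simp
    ultimately show "summable (\<lambda>n. card Hs * exp (- (\<gamma>\<^sup>2 / 8 / real (g + l)) * Suc n))" by (simp only:)
    fix n \<theta> assume \<theta>: "\<theta> \<in> space prior" "\<theta> \<in> Theta_lb k q lam" "\<theta> \<notin> A"
    then obtain h where h: "h \<in> G"
      and ge: "\<epsilon> \<le> \<bar>(\<integral>ys. h ys \<partial>stat_law k lam \<theta> l) - (\<integral>ys. h ys \<partial>stat_law k lam (Qstar, fstar) l)\<bar>"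
      unfolding A_def by (auto simp: not_less)
    have I: "(\<integral>ys. pos h ys \<partial>stat_law k lam \<theta>' l) = (B + (\<integral>ys. h ys \<partial>stat_law k lam \<theta>' l)) / (2 * B)"
        "(\<integral>ys. neg h ys \<partial>stat_law k lam \<theta>' l) = (B - (\<integral>ys. h ys \<partial>stat_law k lam \<theta>' l)) / (2 * B)"
      if \<theta>': "\<theta>' \<in> Theta_lb k q lam" for \<theta>'
    proof -
      interpret P: prob_space "stat_law k lam \<theta>' l" by (rule prob_space_stat_law[OF \<theta>' l])
      interpret E: emission lam k "snd \<theta>'" by (rule emission_Theta_lb[OF \<theta>'])
      have "integrable (stat_law k lam \<theta>' l) h"
        unfolding stat_law_eq by (rule E.integrable_hmm_law[OF Theta_lb_chain(2,3)[OF \<theta>'] l G(2)[OF h] bd[OF h]])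
      then show "(\<integral>ys. pos h ys \<partial>stat_law k lam \<theta>' l) = (B + (\<integral>ys. h ys \<partial>stat_law k lam \<theta>' l)) / (2 * B)"
        "(\<integral>ys. neg h ys \<partial>stat_law k lam \<theta>' l) = (B - (\<integral>ys. h ys \<partial>stat_law k lam \<theta>' l)) / (2 * B)"
        unfolding pos_def neg_def using P.prob_space by simp_all
    qed
    have "2 * \<gamma> \<le> \<epsilon> / (2 * B)" using \<gamma>(3) by simp
    moreover have "\<epsilon> / (2 * B) \<le> d / (2 * B)" if "\<epsilon> \<le> d" for d using that B by (intro divide_right_mono) auto
    ultimately have two: "2 * \<gamma> \<le> d / (2 * B)" if "\<epsilon> \<le> d" for d using that by fastforce
    let ?e = "\<integral>ys. h ys \<partial>stat_law k lam \<theta> l" and ?s = "\<integral>ys. h ys \<partial>stat_law k lam (Qstar, fstar) l"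
    consider "\<epsilon> \<le> ?e - ?s" | "\<epsilon> \<le> ?s - ?e" using ge by linarith
    then show "\<exists>H\<in>Hs. (\<integral>ys. H ys \<partial>stat_law k lam (Qstar, fstar) l) + 2 * \<gamma> \<le> (\<integral>ys. H ys \<partial>stat_law k lam \<theta> l)"
    proof cases
      case 1
      have "(\<integral>ys. pos h ys \<partial>stat_law k lam (Qstar, fstar) l) + 2 * \<gamma> \<le> (\<integral>ys. pos h ys \<partial>stat_law k lam \<theta> l)"
        unfolding I(1)[OF \<theta>(2)] I(1)[OF true_in_Theta_lb] using two[OF 1] by (simp add: add_divide_distrib diff_divide_distrib)
      then show ?thesis using h by (intro bexI[of _ "pos h"]) (auto simp: Hs_def)
    next
      case 2
      have "(\<integral>ys. neg h ys \<partial>stat_law k lam (Qstar, fstar) l) + 2 * \<gamma> \<le> (\<integral>ys. neg h ys \<partial>stat_law k lam \<theta> l)"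
        unfolding I(2)[OF \<theta>(2)] I(2)[OF true_in_Theta_lb] using two[OF 2] by (simp add: add_divide_distrib diff_divide_distrib)
      then show ?thesis using h by (intro bexI[of _ "neg h"]) (auto simp: Hs_def)
    qed
  qed auto
qed

end

section \<open>Strong consistency\<close>

context hmm_bayes
begin

text \<open>Expand both densities over paths and split each term as
  \<open>(w - w') * a + w' * (a - b)\<close>: the densities \<open>a\<close> integrate to 1, the
  weights \<open>w'\<close> sum to 1, and \<open>a - b\<close> is a difference of product densities
  with \<open>l\<close> factors.\<close>

lemma D_dist_path_bound:
  assumes \<theta>: "\<theta> \<in> Theta_lb k q lam" and \<theta>': "\<theta>' \<in> Theta_lb k q lam" and l: "l \<noteq> 0"
    and near: "\<And>j. j < k \<Longrightarrow> (\<integral>\<^sup>+y. ennreal \<bar>snd \<theta> j y - snd \<theta>' j y\<bar> \<partial>lam) \<le> ennreal d" and d: "0 \<le> d"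
  shows "D_dist k lam l \<theta> \<theta>' \<le> (\<Sum>x\<in>paths k l.
      \<bar>path_weight (fst \<theta>) (stat_dist k (fst \<theta>)) l x - path_weight (fst \<theta>') (stat_dist k (fst \<theta>')) l x\<bar>) + l * d"
proof -
  let ?L = "seq_space lam l" and ?X = "paths k l"
  define w where "w x = path_weight (fst \<theta>) (stat_dist k (fst \<theta>)) l x" for x
  define w' where "w' x = path_weight (fst \<theta>') (stat_dist k (fst \<theta>')) l x" for x
  define a where "a x ys = (\<Prod>t<l. snd \<theta> (x t) (ys t))" for x ys
  define b where "b x ys = (\<Prod>t<l. snd \<theta>' (x t) (ys t))" for x ys
  interpret E: emission lam k "snd \<theta>" by (rule emission_Theta_lb[OF \<theta>])
  interpret E': emission lam k "snd \<theta>'" by (rule emission_Theta_lb[OF \<theta>'])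
  have X: "finite ?X" by (intro finite_PiE) auto
  have xk: "x t < k" if "x \<in> ?X" "t < l" for x t using PiE_mem[OF that(1), of t] that(2) by simp
  have am: "a x \<in> borel_measurable ?L" "b x \<in> borel_measurable ?L" if "x \<in> ?X" for x
    unfolding a_def[abs_def] b_def[abs_def] using that by (rule E.measurable_path_dens E'.measurable_path_dens)+
  have a0: "0 \<le> a x ys" if "x \<in> ?X" for x ys
    unfolding a_def using xk[OF that] E.fs_nonneg by (intro prod_nonneg) auto
  have w'0: "0 \<le> w' x" if "x \<in> ?X" for x
    unfolding w'_def by (rule path_weight_nonneg[OF Theta_lb_chain(2,3)[OF \<theta>'] that l])
  have w'1: "(\<Sum>x\<in>?X. w' x) = 1"
    using chain_exp_eq_sum[OF l, of k "fst \<theta>'" "stat_dist k (fst \<theta>')" "\<lambda>_. 1"]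
      chain_exp_const[OF Theta_lb_chain(2,3)[OF \<theta>'], of l 1] by (simp add: w'_def)
  have a1: "(\<integral>\<^sup>+ys. ennreal (a x ys) \<partial>?L) = 1" if x: "x \<in> ?X" for x
  proof -
    interpret prob_space "path_law lam (snd \<theta>) (map x [0..<l])"
      by (rule E.prob_space_path_law[OF E.set_map_path[OF x]])
    have "emeasure (path_law lam (snd \<theta>) (map x [0..<l])) (space ?L) = 1" using emeasure_space_1 by simp
    then show ?thesis unfolding E.path_law_map[OF x] a_def[symmetric]
      using am(1)[OF x] by (subst (asm) emeasure_density) (auto cong: nn_integral_cong)
  qed
  have ab: "(\<integral>\<^sup>+ys. ennreal \<bar>a x ys - b x ys\<bar> \<partial>?L) \<le> ennreal (l * d)" if x: "x \<in> ?X" for x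
  proof -
    have f: "is_density lam (snd \<theta> (x t))" "is_density lam (snd \<theta>' (x t))" if "t < l" for t
      using xk[OF x that] \<theta> \<theta>' by (auto simp: Theta_lb_def densities_def)
    have "(\<integral>\<^sup>+ys. ennreal \<bar>a x ys - b x ys\<bar> \<partial>?L) \<le> (\<Sum>t<l. \<integral>\<^sup>+y. ennreal \<bar>snd \<theta> (x t) y - snd \<theta>' (x t) y\<bar> \<partial>lam)"
      unfolding a_def b_def using f
      by (intro star.PF.nn_integral_prod_diff_le) (auto simp: is_density_def)
    also have "\<dots> \<le> (\<Sum>t<l. ennreal d)" using xk[OF x] near by (intro sum_mono) auto
    also have "\<dots> = ennreal (l * d)" using d by (simp add: ennreal_mult ennreal_of_nat_eq_real_of_nat)
    finally show ?thesis .
  qed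
  have p: "stat_dens k \<theta> l ys = (\<Sum>x\<in>?X. w x * a x ys)" "stat_dens k \<theta>' l ys = (\<Sum>x\<in>?X. w' x * b x ys)" for ys
    by (simp_all add: stat_dens_def hmm_dens_eq w_def w'_def a_def b_def)
  have "ennreal (D_dist k lam l \<theta> \<theta>') = (\<integral>\<^sup>+ys. ennreal \<bar>stat_dens k \<theta> l ys - stat_dens k \<theta>' l ys\<bar> \<partial>?L)"
    unfolding D_dist_def
    using integrable_stat_dens[OF \<theta> l] integrable_stat_dens[OF \<theta>' l]
    by (intro nn_integral_eq_integral[symmetric]) auto
  also have "\<dots> \<le> (\<integral>\<^sup>+ys. (\<Sum>x\<in>?X. ennreal \<bar>w x - w' x\<bar> * ennreal (a x ys) + ennreal (w' x) * ennreal \<bar>a x ys - b x ys\<bar>) \<partial>?L)"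
  proof (rule nn_integral_mono)
    fix ys
    have "\<bar>stat_dens k \<theta> l ys - stat_dens k \<theta>' l ys\<bar> = \<bar>\<Sum>x\<in>?X. (w x - w' x) * a x ys + w' x * (a x ys - b x ys)\<bar>"
      unfolding p sum_subtractf[symmetric] by (simp add: algebra_simps)
    also have "\<dots> \<le> (\<Sum>x\<in>?X. \<bar>w x - w' x\<bar> * a x ys + w' x * \<bar>a x ys - b x ys\<bar>)"
    proof (rule order_trans[OF sum_abs], rule sum_mono)
      fix x assume x: "x \<in> ?X"
      show "\<bar>(w x - w' x) * a x ys + w' x * (a x ys - b x ys)\<bar> \<le> \<bar>w x - w' x\<bar> * a x ys + w' x * \<bar>a x ys - b x ys\<bar>"
        using a0[OF x, of ys] w'0[OF x] by (intro order_trans[OF abs_triangle_ineq]) (simp add: abs_mult)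
    qed
    finally have "ennreal \<bar>stat_dens k \<theta> l ys - stat_dens k \<theta>' l ys\<bar> \<le> ennreal (\<Sum>x\<in>?X. \<bar>w x - w' x\<bar> * a x ys + w' x * \<bar>a x ys - b x ys\<bar>)"
      by (rule ennreal_leI)
    also have "\<dots> = (\<Sum>x\<in>?X. ennreal (\<bar>w x - w' x\<bar> * a x ys + w' x * \<bar>a x ys - b x ys\<bar>))"
      using a0 w'0 by (intro sum_ennreal[symmetric] add_nonneg_nonneg mult_nonneg_nonneg) auto
    also have "\<dots> = (\<Sum>x\<in>?X. ennreal \<bar>w x - w' x\<bar> * ennreal (a x ys) + ennreal (w' x) * ennreal \<bar>a x ys - b x ys\<bar>)"
      using a0 w'0 by (intro sum.cong refl) (simp add: ennreal_mult)
    finally show "ennreal \<bar>stat_dens k \<theta> l ys - stat_dens k \<theta>' l ys\<bar>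
      \<le> (\<Sum>x\<in>?X. ennreal \<bar>w x - w' x\<bar> * ennreal (a x ys) + ennreal (w' x) * ennreal \<bar>a x ys - b x ys\<bar>)" .
  qed
  also have "\<dots> = (\<Sum>x\<in>?X. ennreal \<bar>w x - w' x\<bar> + ennreal (w' x) * (\<integral>\<^sup>+ys. ennreal \<bar>a x ys - b x ys\<bar> \<partial>?L))"
  proof (subst nn_integral_sum)
    fix x assume x: "x \<in> ?X"
    note [measurable] = am[OF x]
    show "(\<lambda>ys. ennreal \<bar>w x - w' x\<bar> * ennreal (a x ys) + ennreal (w' x) * ennreal \<bar>a x ys - b x ys\<bar>) \<in> borel_measurable ?L"
      by measurable
  next
    show "(\<Sum>x\<in>?X. \<integral>\<^sup>+ys. ennreal \<bar>w x - w' x\<bar> * ennreal (a x ys) + ennreal (w' x) * ennreal \<bar>a x ys - b x ys\<bar> \<partial>?L)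
      = (\<Sum>x\<in>?X. ennreal \<bar>w x - w' x\<bar> + ennreal (w' x) * (\<integral>\<^sup>+ys. ennreal \<bar>a x ys - b x ys\<bar> \<partial>?L))"
    proof (rule sum.cong[OF refl])
      fix x assume x: "x \<in> ?X"
      note [measurable] = am[OF x]
      show "(\<integral>\<^sup>+ys. ennreal \<bar>w x - w' x\<bar> * ennreal (a x ys) + ennreal (w' x) * ennreal \<bar>a x ys - b x ys\<bar> \<partial>?L)
        = ennreal \<bar>w x - w' x\<bar> + ennreal (w' x) * (\<integral>\<^sup>+ys. ennreal \<bar>a x ys - b x ys\<bar> \<partial>?L)"
        by (simp add: nn_integral_add nn_integral_cmult a1[OF x])
    qed
  qed
  also have "\<dots> \<le> (\<Sum>x\<in>?X. ennreal \<bar>w x - w' x\<bar> + ennreal (w' x) * ennreal (l * d))"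
    by (intro sum_mono add_left_mono mult_left_mono ab) auto
  also have "\<dots> = (\<Sum>x\<in>?X. ennreal (\<bar>w x - w' x\<bar> + w' x * (l * d)))"
    using w'0 d by (intro sum.cong refl) (simp add: ennreal_mult)
  also have "\<dots> = ennreal (\<Sum>x\<in>?X. \<bar>w x - w' x\<bar> + w' x * (l * d))"
    using w'0 d by (intro sum_ennreal add_nonneg_nonneg mult_nonneg_nonneg) auto
  also have "(\<Sum>x\<in>?X. \<bar>w x - w' x\<bar> + w' x * (l * d)) = (\<Sum>x\<in>?X. \<bar>w x - w' x\<bar>) + l * d"
    by (simp add: sum.distrib sum_distrib_right[symmetric] w'1)
  finally have "ennreal (D_dist k lam l \<theta> \<theta>') \<le> ennreal ((\<Sum>x\<in>?X. \<bar>w x - w' x\<bar>) + l * d)" .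
  then show ?thesis unfolding w_def w'_def
    using d by (subst (asm) ennreal_le_iff) (auto intro!: add_nonneg_nonneg sum_nonneg)
qed

definition scheffe :: "nat \<Rightarrow> (nat \<Rightarrow> nat \<Rightarrow> real) \<times> (nat \<Rightarrow> 'y \<Rightarrow> real) \<Rightarrow> (nat \<Rightarrow> 'y) \<Rightarrow> real" where
  "scheffe l \<theta> ys = (if stat_dens k (Qstar, fstar) l ys < stat_dens k \<theta> l ys then 1 else 0)"

lemma measurable_scheffe:
  assumes "\<theta> \<in> Theta_lb k q lam" "l \<noteq> 0"
  shows "scheffe l \<theta> \<in> borel_measurable (seq_space lam l)"
proof -
  note [measurable] = measurable_stat_dens[OF assms] measurable_stat_dens[OF true_in_Theta_lb assms(2)]
  show ?thesis unfolding scheffe_def[abs_def] by measurable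
qed

text \<open>For the centre \<theta>' itself its Scheffe set gains exactly half of the distance to
  the truth. Passing from \<theta>' to \<theta> costs half of their distance in the triangle
  inequality and once more that distance in the expectation, hence the factor 3/2.\<close>

lemma scheffe_separates:
  assumes \<theta>: "\<theta> \<in> Theta_lb k q lam" and \<theta>': "\<theta>' \<in> Theta_lb k q lam" and l: "l \<noteq> 0"
  shows "(D_dist k lam l \<theta> (Qstar, fstar) - 3 * D_dist k lam l \<theta> \<theta>') / 2
    \<le> (\<integral>ys. scheffe l \<theta>' ys \<partial>stat_law k lam \<theta> l) - (\<integral>ys. scheffe l \<theta>' ys \<partial>stat_law k lam (Qstar, fstar) l)"
proof -
  let ?L = "seq_space lam l" and ?H = "scheffe l \<theta>'"
  let ?p = "stat_dens k \<theta> l" and ?p' = "stat_dens k \<theta>' l" and ?s = "stat_dens k (Qstar, fstar) l"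
  note H = measurable_scheffe[OF \<theta>' l]
  have Hb: "\<bar>?H ys\<bar> \<le> 1" for ys by (simp add: scheffe_def)
  note i = integrable_stat_dens[OF \<theta> l] integrable_stat_dens[OF \<theta>' l] integrable_stat_dens[OF true_in_Theta_lb l]
  note iH = integrable_stat_dens_mult[OF \<theta> l H Hb] integrable_stat_dens_mult[OF \<theta>' l H Hb] integrable_stat_dens_mult[OF true_in_Theta_lb l H Hb]
  have "D_dist k lam l \<theta> (Qstar, fstar) \<le> (\<integral>ys. \<bar>?p ys - ?p' ys\<bar> + \<bar>?p' ys - ?s ys\<bar> \<partial>?L)"
    unfolding D_dist_def using i by (intro integral_mono) auto
  also have "\<dots> = D_dist k lam l \<theta> \<theta>' + (\<integral>ys. \<bar>?p' ys - ?s ys\<bar> \<partial>?L)"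
    unfolding D_dist_def using i by (intro Bochner_Integration.integral_add) auto
  \<comment> \<open>On the Scheffe set the absolute value is the difference, off it the negative of
    the difference; the last term vanishes on integration since both densities have mass 1.\<close>
  also have "(\<integral>ys. \<bar>?p' ys - ?s ys\<bar> \<partial>?L) = (\<integral>ys. 2 * (?p' ys * ?H ys - ?s ys * ?H ys) - (?p' ys - ?s ys) \<partial>?L)"
    by (intro Bochner_Integration.integral_cong) (auto simp: scheffe_def)
  also have "\<dots> = 2 * ((\<integral>ys. ?p' ys * ?H ys \<partial>?L) - (\<integral>ys. ?s ys * ?H ys \<partial>?L))"
    using i iH integral_stat_dens[OF \<theta>' l] integral_stat_dens[OF true_in_Theta_lb l] by simp
  finally have 1: "D_dist k lam l \<theta> (Qstar, fstar) \<le> D_dist k lam l \<theta> \<theta>' + 2 * ((\<integral>ys. ?p' ys * ?H ys \<partial>?L) - (\<integral>ys. ?s ys * ?H ys \<partial>?L))" .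
  have "(\<integral>ys. ?p' ys * ?H ys \<partial>?L) - (\<integral>ys. ?p ys * ?H ys \<partial>?L) = (\<integral>ys. ?p' ys * ?H ys - ?p ys * ?H ys \<partial>?L)"
    using iH by simp
  also have "\<dots> \<le> D_dist k lam l \<theta> \<theta>'"
    unfolding D_dist_def using i iH by (intro integral_mono) (auto simp: scheffe_def)
  finally show ?thesis using 1 unfolding integral_stat_law[OF \<theta> l H] integral_stat_law[OF true_in_Theta_lb l H]
    by simp
qed

text \<open>\<open>dens_dist\<close> uses Bochner integrals, which would be 0 for a non-integrable
  difference; differences of densities are integrable, so the two kinds of integral agree.\<close>

lemma dens_dist_nn_integral_le:
  assumes "densities k lam f" "densities k lam g" "dens_dist k lam f g \<le> d" "j < k"
  shows "(\<integral>\<^sup>+y. ennreal \<bar>f j y - g j y\<bar> \<partial>lam) \<le> ennreal d"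
proof -
  have "integrable lam h" if "is_density lam h" for h
    using that by (intro integrableI_nonneg) (auto simp: is_density_def)
  then have "integrable lam (\<lambda>y. \<bar>f j y - g j y\<bar>)" using assms by (auto simp: densities_def)
  then have "(\<integral>\<^sup>+y. ennreal \<bar>f j y - g j y\<bar> \<partial>lam) = ennreal (\<integral>y. \<bar>f j y - g j y\<bar> \<partial>lam)"
    by (intro nn_integral_eq_integral) auto
  also have "(\<integral>y. \<bar>f j y - g j y\<bar> \<partial>lam) \<le> dens_dist k lam f g"
    unfolding dens_dist_def using assms(4) by (intro Max_ge) auto
  finally show ?thesis using assms(3) by (meson ennreal_leI order_trans le_less_linear)
qed

lemma strong_consistency:
  assumes A1: "assumption_A1 k q lam prior Qstar fstar" and A2: "assumption_A2 k q l lam \<pi>f"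
    and support: "AE \<theta> in prior. \<theta> \<in> Theta_lb k q lam"
    and l: "l \<noteq> 0" and \<epsilon>: "0 < \<epsilon>"
  defines "A \<equiv> {\<theta> \<in> space prior. \<theta> \<in> Theta_lb k q lam \<and> D_dist k lam l \<theta> (Qstar, fstar) < \<epsilon>}"
  shows "A \<in> sets prior" and "AE \<omega> in M. (\<lambda>n. posterior k \<mu> prior n A (obs_upto n \<omega>)) \<longlonglongrightarrow> 1"
proof -
  let ?X = "paths k l"
  show A: "A \<in> sets prior"
  proof -
    have "(\<lambda>p. \<bar>hmm_dens k (fst (fst p)) (snd (fst p)) (stat_limit k (fst (fst p))) l (snd p) - stat_dens k (Qstar, fstar) l (snd p)\<bar>)
      \<in> borel_measurable (prior \<Otimes>\<^sub>M (seq_space lam l))"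
      by (intro borel_measurable_abs borel_measurable_diff measurable_joint_stat_limit[OF l]
        measurable_compose[OF measurable_snd measurable_stat_dens[OF true_in_Theta_lb l]])
    from sets_stat_functional[where \<Phi> = "\<lambda>a ys. \<bar>a - stat_dens k (Qstar, fstar) l ys\<bar>", OF this, of "{..<\<epsilon>}"]
    show ?thesis unfolding A_def D_dist_def by simp
  qed
  \<comment> \<open>Centres will lie within \<open>\<epsilon> / 4\<close> of the parameter, so
    \<open>scheffe_separates\<close> yields
    \<open>(\<epsilon> - 3 * \<epsilon> / 4) / 2 = \<epsilon> / 8\<close>, which is at least
    \<open>2 * \<gamma>\<close>.\<close>
  define \<gamma> where "\<gamma> = min 1 (\<epsilon> / 16)"
  have \<gamma>: "0 < \<gamma>" "\<gamma> \<le> 1" "\<gamma> \<le> \<epsilon> / 16" using \<epsilon> by (auto simp: \<gamma>_def)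
  obtain g where g: "2 * (1 - k * q) ^ g \<le> \<gamma> / 4" using exists_gap[OF \<gamma>(1)] by blast
  define \<rho> where "\<rho> = \<gamma>\<^sup>2 / 8 / real (g + l)"
  have \<rho>: "0 < \<rho>" using \<gamma> l by (simp add: \<rho>_def)
  define a where "a = real k ^ 2 * q ^ 2 / (32 * real l)"
  have a: "0 < a" using k q l by (simp add: a_def)
  \<comment> \<open>The bound 1 allows replacing the square of \<delta> by \<delta>, the bound
    \<open>\<rho> / a\<close> makes the (A2) exponent at most the test exponent, and the bound
    \<epsilon> keeps the emission error \<open>\<delta> / 36\<close> below
    \<open>\<epsilon> / 8\<close>.\<close>
  define \<delta> where "\<delta> = min 1 (min \<epsilon> (\<rho> / a))"
  have \<delta>: "0 < \<delta>" "\<delta> \<le> 1" "\<delta> \<le> \<epsilon>" "\<delta> \<le> \<rho> / a" using \<epsilon> \<rho> a by (auto simp: \<delta>_def)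
  have rate: "\<delta>\<^sup>2 * a \<le> \<rho>"
  proof -
    have "\<delta>\<^sup>2 * a \<le> \<delta> * a" using \<delta> a by (intro mult_right_mono) (auto simp: power2_eq_square mult_left_le)
    also have "\<dots> \<le> \<rho>" using \<delta>(4) a by (simp add: pos_le_divide_eq)
    finally show ?thesis .
  qed
  let ?D = "Collect (densities k lam)"
  let ?cov = "\<lambda>F n. covering_number ?D (dens_dist k lam) (\<delta> / (36 * real l)) (F n)"
  obtain F :: "nat \<Rightarrow> (nat \<Rightarrow> 'y \<Rightarrow> real) set" and r1 C where r1: "0 < r1" and C: "0 < C"
    and F': "\<forall>n\<ge>1. F n \<subseteq> ?D \<and>
      (\<exists>B\<in>sets \<pi>f. space \<pi>f - F n \<subseteq> B \<and> emeasure \<pi>f B \<le> ennreal (C * exp (- real n * r1)))"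
    and S: "(\<Sum>n. ?cov F (Suc n) * ennreal (exp (- real (Suc n) * \<delta>^2 * real k^2 * q^2 / (32 * real l)))) < \<infinity>"
    using mp[OF spec[OF A2[unfolded assumption_A2_def]] \<delta>(1)] by (elim exE conjE) (rule that)
  have F: "\<exists>B. B \<in> sets \<pi>f \<and> space \<pi>f - F n \<subseteq> B \<and> emeasure \<pi>f B \<le> ennreal (C * exp (- real n * r1))" if "1 \<le> n" for n
    using F'[rule_format, OF that] by (simp add: Bex_def)
  have ex: "exp (- real (Suc n) * \<delta>^2 * real k^2 * q^2 / (32 * real l)) = exp (- (\<delta>\<^sup>2 * a) * Suc n)" for n
  proof -
    have "- s * d * K * Q / Z = - (d * (K * Q / Z)) * s" for s d K Q Z :: real by simp
    then show ?thesis unfolding a_def by (simp only:)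
  qed
  have fin: "?cov F (Suc n) < \<infinity>" for n
    using ennreal_suminf_lessD[OF S, of n] by (auto simp: ennreal_mult_less_top)
  \<comment> \<open>(A2) speaks about \<open>n \<ge> 1\<close> only; the empty family serves at 0,
    so that one choice covers all indices.\<close>
  have "\<exists>T. finite T \<and> T \<subseteq> ?D \<and> (1 \<le> n \<longrightarrow> (\<forall>f\<in>F n. \<exists>t\<in>T. dens_dist k lam f t \<le> \<delta> / (36 * real l)) \<and> of_nat (card T) \<le> ?cov F n)" for n
  proof (cases n)
    case (Suc m)
    then show ?thesis using covering_number_attained[OF fin[of m]] by auto
  qed (auto intro!: exI[of _ "{}"])
  then have "\<forall>n. \<exists>T. finite T \<and> T \<subseteq> ?D \<and> (1 \<le> n \<longrightarrow> (\<forall>f\<in>F n. \<exists>t\<in>T. dens_dist k lam f t \<le> \<delta> / (36 * real l)) \<and> of_nat (card T) \<le> ?cov F n)"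
    by (rule allI)
  from choice[OF this] obtain T where T: "\<And>n. finite (T n)" "\<And>n. T n \<subseteq> ?D"
      "\<And>n f. 1 \<le> n \<Longrightarrow> f \<in> F n \<Longrightarrow> \<exists>t\<in>T n. dens_dist k lam f t \<le> \<delta> / (36 * real l)"
      "\<And>n. 1 \<le> n \<Longrightarrow> of_nat (card (T n)) \<le> ?cov F n" by blast
  have "\<forall>n. \<exists>B. 1 \<le> n \<longrightarrow> B \<in> sets \<pi>f \<and> space \<pi>f - F n \<subseteq> B \<and> emeasure \<pi>f B \<le> ennreal (C * exp (- real n * r1))"
    using F by blast
  from choice[OF this] obtain Bf where Bf: "\<And>n. 1 \<le> n \<Longrightarrow> Bf n \<in> sets \<pi>f" "\<And>n. 1 \<le> n \<Longrightarrow> space \<pi>f - F n \<subseteq> Bf n"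
      "\<And>n. 1 \<le> n \<Longrightarrow> emeasure \<pi>f (Bf n) \<le> ennreal (C * exp (- real n * r1))" by blast
  \<comment> \<open>Transition matrices are discretised through their path weights, the very
    quantities in which \<open>D_dist_path_bound\<close> measures their distance.\<close>
  define w where "w Q x = path_weight Q (stat_dist k Q) l x" for Q x
  have w01: "0 \<le> w Q x \<and> w Q x \<le> 1" if "Q \<in> Collect (trans_mat_lb k q)" "x \<in> ?X" for Q x
  proof -
    have Q: "trans_mat_lb k q Q" using that by simp
    note c = trans_mat_lb_trans_mat[OF Q] prob_vecs_prob_row[OF stat_dist_stationary(1)[OF Q k q]]
    show ?thesis unfolding w_def using path_weight_nonneg[OF c that(2) l] path_weight_le_1[OF c that(2) l] by simp
  qed
  have X: "finite ?X" by (intro finite_PiE) auto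
  \<comment> \<open>Makes the total rounding error over all paths, \<open>card ?X / m\<close>, at
    most \<open>\<epsilon> / 8\<close>.\<close>
  obtain m :: nat where m: "card ?X * 8 / \<epsilon> < m" using reals_Archimedean2 by blast
  moreover have "0 \<le> card ?X * 8 / \<epsilon>" using \<epsilon> by simp
  ultimately have m0: "0 < m" by (metis le_less_trans of_nat_0_less_iff)
  have "\<exists>R. finite R \<and> R \<subseteq> Collect (trans_mat_lb k q) \<and>
      (\<forall>Q\<in>Collect (trans_mat_lb k q). \<exists>Q0\<in>R. \<forall>x\<in>?X. \<bar>w Q x - w Q0 x\<bar> \<le> 1 / m)"
    by (rule finite_floor_net[OF X _ m0]) (rule w01)
  then obtain R where R: "finite R" "R \<subseteq> Collect (trans_mat_lb k q)"
      "\<And>Q. trans_mat_lb k q Q \<Longrightarrow> \<exists>Q0\<in>R. \<forall>x\<in>?X. \<bar>w Q x - w Q0 x\<bar> \<le> 1 / m"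
    by blast
  \<comment> \<open>The net \<open>R\<close> does not depend on \<open>n\<close>, so the number of
    tests is at most a constant times the covering number.\<close>
  define Hs where "Hs n = scheffe l ` (R \<times> T n)" for n
  have RT: "R \<times> T n \<subseteq> Theta_lb k q lam" for n using R(2) T(2)[of n] by (auto simp: Theta_lb_def)
  show "AE \<omega> in M. (\<lambda>n. posterior k \<mu> prior n A (obs_upto n \<omega>)) \<longlonglongrightarrow> 1"
  proof (rule test_consistency[OF A1 A support l \<gamma>(1,2) g, where Hs = Hs and B = "\<lambda>n. space \<pi>Q \<times> Bf n" and C = C and r = r1])
    show "finite (Hs n)" for n using R(1) T(1) by (simp add: Hs_def)
    show "H \<in> borel_measurable (seq_space lam l)" if "H \<in> Hs n" for H n
      using that RT[of n] measurable_scheffe[OF _ l] unfolding Hs_def by blast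
    show "0 \<le> H ys \<and> H ys \<le> 1" if "H \<in> Hs n" for H n ys using that by (auto simp: Hs_def scheffe_def)
    show "summable (\<lambda>n. card (Hs (Suc n)) * exp (- (\<gamma>\<^sup>2 / 8 / real (g + l)) * Suc n))"
      unfolding \<rho>_def[symmetric]
    proof (rule summable_comparison_test'[of "\<lambda>n. card R * (card (T (Suc n)) * exp (- (\<delta>\<^sup>2 * a) * Suc n))" 0])
      have "(\<Sum>n. ennreal (card (T (Suc n)) * exp (- (\<delta>\<^sup>2 * a) * Suc n)))
        \<le> (\<Sum>n. ?cov F (Suc n) * ennreal (exp (- real (Suc n) * \<delta>^2 * real k^2 * q^2 / (32 * real l))))"
      proof (intro suminf_le summableI)
        fix n
        show "ennreal (card (T (Suc n)) * exp (- (\<delta>\<^sup>2 * a) * Suc n))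
          \<le> ?cov F (Suc n) * ennreal (exp (- real (Suc n) * \<delta>^2 * real k^2 * q^2 / (32 * real l)))"
          unfolding ex using mult_right_mono[OF T(4)[of "Suc n"], of "ennreal (exp (- (\<delta>\<^sup>2 * a) * Suc n))"]
          by (simp add: ennreal_mult ennreal_of_nat_eq_real_of_nat)
      qed
      also note S
      finally have "summable (\<lambda>n. card (T (Suc n)) * exp (- (\<delta>\<^sup>2 * a) * Suc n))"
        by (intro summable_suminf_not_top) auto
      then show "summable (\<lambda>n. card R * (card (T (Suc n)) * exp (- (\<delta>\<^sup>2 * a) * Suc n)))" by (rule summable_mult)
      fix n
      have "card (Hs (Suc n)) \<le> card R * card (T (Suc n))"
        unfolding Hs_def card_cartesian_product[symmetric] using R(1) T(1) by (intro card_image_le) simp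
      then have "real (card (Hs (Suc n))) \<le> card R * card (T (Suc n))" by (metis of_nat_le_iff of_nat_mult)
      moreover have "exp (- \<rho> * Suc n) \<le> exp (- (\<delta>\<^sup>2 * a) * Suc n)"
        using mult_right_mono[OF rate, of "real (Suc n)"] by simp
      ultimately have "card (Hs (Suc n)) * exp (- \<rho> * Suc n) \<le> (card R * card (T (Suc n))) * exp (- (\<delta>\<^sup>2 * a) * Suc n)"
        by (intro mult_mono) auto
      then show "norm (card (Hs (Suc n)) * exp (- \<rho> * Suc n)) \<le> card R * (card (T (Suc n)) * exp (- (\<delta>\<^sup>2 * a) * Suc n))"
        by (simp only: real_norm_def abs_of_nonneg[OF mult_nonneg_nonneg[OF of_nat_0_le_iff exp_ge_zero]] mult.assoc of_nat_mult)
    qed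
    show "0 < r1" by (rule r1)
    show "0 \<le> C" using C by simp
    fix n :: nat assume n: "1 \<le> n"
    show "space \<pi>Q \<times> Bf n \<in> sets prior" using Bf(1)[OF n] by auto
    show "emeasure prior (space \<pi>Q \<times> Bf n) \<le> ennreal (C * exp (- real n * r1))"
      using Bf(1,3)[OF n] by (simp add: \<pi>f.emeasure_pair_measure_Times \<pi>Q.emeasure_space_1)
    fix \<theta> assume \<theta>: "\<theta> \<in> space prior" "\<theta> \<in> Theta_lb k q lam" "\<theta> \<notin> A" "\<theta> \<notin> space \<pi>Q \<times> Bf n"
    have "snd \<theta> \<in> F n" using \<theta>(1,4) Bf(2)[OF n] by (auto simp: space_pair_measure)
    then obtain t where t: "t \<in> T n" "dens_dist k lam (snd \<theta>) t \<le> \<delta> / (36 * real l)" using T(3)[OF n] by blast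
    obtain Q0 where Q0: "Q0 \<in> R" "\<And>x. x \<in> ?X \<Longrightarrow> \<bar>w (fst \<theta>) x - w Q0 x\<bar> \<le> 1 / m"
      using R(3)[OF Theta_lb_chain(1)[OF \<theta>(2)]] by blast
    have \<theta>0: "(Q0, t) \<in> Theta_lb k q lam" using RT Q0(1) t(1) by blast
    have "D_dist k lam l \<theta> (Q0, t) \<le> (\<Sum>x\<in>?X. \<bar>w (fst \<theta>) x - w Q0 x\<bar>) + l * (\<delta> / (36 * real l))"
    proof -
      have "(\<integral>\<^sup>+y. ennreal \<bar>snd \<theta> j y - snd (Q0, t) j y\<bar> \<partial>lam) \<le> ennreal (\<delta> / (36 * real l))" if "j < k" for j
        using dens_dist_nn_integral_le[OF _ _ t(2) that] \<theta>(2) \<theta>0 by (auto simp: Theta_lb_def)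
      from D_dist_path_bound[OF \<theta>(2) \<theta>0 l this] \<delta>(1) show ?thesis by (simp add: w_def)
    qed
    also have "(\<Sum>x\<in>?X. \<bar>w (fst \<theta>) x - w Q0 x\<bar>) \<le> (\<Sum>x\<in>?X. 1 / m)" by (intro sum_mono Q0(2))
    also have "\<dots> \<le> \<epsilon> / 8" using m m0 \<epsilon> by (simp add: field_simps)
    also have "l * (\<delta> / (36 * real l)) \<le> \<epsilon> / 8" using l \<delta> \<epsilon> by (simp add: field_simps)
    finally have b: "D_dist k lam l \<theta> (Q0, t) \<le> \<epsilon> / 4" by simp
    have c: "\<epsilon> \<le> D_dist k lam l \<theta> (Qstar, fstar)" using \<theta>(1,2,3) by (auto simp: A_def)
    have "2 * \<gamma> \<le> (\<epsilon> - 3 * (\<epsilon> / 4)) / 2" using \<gamma>(3) by simp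
    also have "\<dots> \<le> (D_dist k lam l \<theta> (Qstar, fstar) - 3 * D_dist k lam l \<theta> (Q0, t)) / 2"
      using b c by (intro divide_right_mono diff_mono mult_left_mono) auto
    also note scheffe_separates[OF \<theta>(2) \<theta>0 l]
    finally have "(\<integral>ys. scheffe l (Q0, t) ys \<partial>stat_law k lam (Qstar, fstar) l) + 2 * \<gamma> \<le> (\<integral>ys. scheffe l (Q0, t) ys \<partial>stat_law k lam \<theta> l)"
      by simp
    then show "\<exists>H\<in>Hs n. (\<integral>ys. H ys \<partial>stat_law k lam (Qstar, fstar) l) + 2 * \<gamma> \<le> (\<integral>ys. H ys \<partial>stat_law k lam \<theta> l)"
      unfolding Hs_def using Q0(1) t(1) by blast
  qed
qed

end

section \<open>From the abstract setting to the theorem\<close>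

lemma bounded_cont_measurable:
  fixes h :: "(nat \<Rightarrow> 'y::second_countable_topology) \<Rightarrow> real"
  assumes "bounded_cont l h" "sets lam = sets (borel :: 'y measure)"
  shows "h \<in> borel_measurable (seq_space lam l)"
proof -
  let ?S = "\<Pi>\<^sub>E t\<in>{..<l}. (UNIV :: 'y set)" and ?L = "seq_space lam l"
  have sp: "space ?L = ?S" using sets_eq_imp_space_eq[OF assms(2)] by (simp add: space_PiM)
  \<comment> \<open>Continuity refers to the product topology on functions of all natural numbers,
    measurability to \<open>l\<close> coordinates. The two meet because every coordinate from
    \<open>l\<close> on is constantly \<open>undefined\<close> on the space.\<close>
  have "(\<lambda>ys. ys) \<in> measurable ?L (borel :: (nat \<Rightarrow> 'y) measure)"
  proof (rule measurable_coordinatewise_then_product)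
    fix i
    show "(\<lambda>ys. ys i) \<in> measurable ?L borel"
    proof (cases "i < l")
      case True
      then have "(\<lambda>ys. ys i) \<in> measurable ?L lam" by (intro measurable_component_singleton) simp
      then show ?thesis using assms(2) by (simp cong: measurable_cong_sets)
    next
      case False
      then have "ys i = undefined" if "ys \<in> space ?L" for ys using that unfolding sp by (auto simp: PiE_def extensional_def)
      then show ?thesis by (subst measurable_cong[where g = "\<lambda>_. undefined"]) auto
    qed
  qed
  then have "(\<lambda>ys. ys) \<in> measurable ?L (restrict_space borel ?S)"
    by (rule measurable_restrict_space2[rotated]) (simp add: sp)
  moreover have "h \<in> borel_measurable (restrict_space borel ?S)"
    using assms(1) by (intro borel_measurable_continuous_on_restrict) (simp add: bounded_cont_def)
  ultimately show ?thesis by (rule measurable_compose)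
qed

text \<open>(A1) puts matrices with entries at least \<open>q\<close> arbitrarily close to
  \<open>Qstar\<close>, a set of positive mass being nonempty, and the bound passes to the
  limit.\<close>

lemma assumption_A1_trans_mat_lb:
  assumes A1: "assumption_A1 k q lam \<pi> Qstar fstar" and Q: "trans_mat k Qstar"
  shows "trans_mat_lb k q Qstar"
  unfolding trans_mat_lb_def
proof (intro conjI Q allI impI)
  fix i j assume ij: "i < k" "j < k"
  obtain \<epsilon>0 where \<epsilon>0: "0 < \<epsilon>0" and A: "\<forall>\<epsilon>. 0 < \<epsilon> \<and> \<epsilon> < \<epsilon>0 \<longrightarrow>
      (\<exists>Th. Th \<subseteq> Theta_lb k q lam \<and> Th \<in> sets \<pi> \<and> emeasure \<pi> Th > 0 \<and>
        (\<forall>\<theta>\<in>Th. mat_norm k (\<lambda>i j. fst \<theta> i j - Qstar i j) < \<epsilon> \<and>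
           Max ((\<lambda>i. A1b_integral k lam fstar (snd \<theta>) i) ` {..<k}) < ereal \<epsilon>))"
    by (rule assumption_A1_cases[OF A1])
  show "q \<le> Qstar i j"
  proof (rule field_le_epsilon)
    fix e :: real assume e: "0 < e"
    define \<epsilon> where "\<epsilon> = min e (\<epsilon>0 / 2)"
    have \<epsilon>: "0 < \<epsilon> \<and> \<epsilon> < \<epsilon>0" "\<epsilon> \<le> e" using e \<epsilon>0 by (auto simp: \<epsilon>_def)
    obtain Th where Th: "Th \<subseteq> Theta_lb k q lam" "emeasure \<pi> Th > 0" "\<forall>\<theta>\<in>Th. mat_norm k (\<lambda>i j. fst \<theta> i j - Qstar i j) < \<epsilon>"
      using mp[OF spec[OF A] \<epsilon>(1)] by (elim exE conjE) blast
    have "Th \<noteq> {}" using Th(2) by auto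
    then obtain \<theta> where \<theta>: "\<theta> \<in> Th" by blast
    have "q \<le> fst \<theta> i j" using \<theta> Th(1) ij by (auto simp: Theta_lb_def trans_mat_lb_def)
    moreover have "\<bar>fst \<theta> i j - Qstar i j\<bar> < \<epsilon>"
      using mat_norm_entry_le[OF ij, of "\<lambda>i j. fst \<theta> i j - Qstar i j"] Th(3) \<theta> by force
    ultimately show "q \<le> Qstar i j + e" using \<epsilon>(2) by linarith
  qed
qed

text \<open>The sets of parameters named in the two claims need not be measurable for the prior,
  \<open>U\<close> being an arbitrary neighbourhood. Convergence is therefore asserted for a
  measurable subset, which implies it for the full set whenever that is measurable.\<close>

theorem theorem1:
  fixes k l :: nat and q :: real
    and lam :: "(real^'d::finite) measure"
    and \<pi>Q :: "(nat \<Rightarrow> nat \<Rightarrow> real) measure"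
    and \<pi>f :: "(nat \<Rightarrow> real^'d \<Rightarrow> real) measure"
    and \<mu> :: "nat \<Rightarrow> real"
    and Qstar :: "nat \<Rightarrow> nat \<Rightarrow> real" and fstar :: "nat \<Rightarrow> real^'d \<Rightarrow> real"
    and M :: "'w measure" and Y :: "nat \<Rightarrow> 'w \<Rightarrow> real^'d"
  defines "\<pi> \<equiv> \<pi>Q \<Otimes>\<^sub>M \<pi>f"
  assumes k: "1 \<le> k" and l: "3 \<le> l" and q: "0 < q"
    and lam: "sigma_finite_measure lam" "sets lam = sets borel"
    and priorQ: "prob_space \<pi>Q" "space \<pi>Q \<subseteq> Collect (trans_mat k)"
                "\<forall>i<k. \<forall>j<k. (\<lambda>Q. Q i j) \<in> borel_measurable \<pi>Q"
    and priorf: "prob_space \<pi>f" "space \<pi>f \<subseteq> Collect (densities k lam)"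
                "\<forall>j<k. (\<lambda>(fs, y). fs j y) \<in> borel_measurable (\<pi>f \<Otimes>\<^sub>M lam)"
    and support: "AE \<theta> in \<pi>. \<theta> \<in> Theta_lb k q lam"
    and mu: "\<mu> \<in> prob_vecs k" "\<forall>i<k. q \<le> \<mu> i"
    and truth: "(Qstar, fstar) \<in> Theta k lam"
    and obs: "prob_space M" "\<forall>t. Y t \<in> measurable M lam"
      "\<forall>n\<ge>1. distr M (\<Pi>\<^sub>M t\<in>{..<n}. lam) (\<lambda>\<omega>. \<lambda>t\<in>{..<n}. Y t \<omega>)
             = density (\<Pi>\<^sub>M t\<in>{..<n}. lam) (\<lambda>ys. ennreal (stat_dens k (Qstar, fstar) n ys))"
  shows
    "(assumption_A1 k q lam \<pi> Qstar fstar \<longrightarrow>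
        (\<forall>U. weak_nhd l (stat_law k lam (Qstar, fstar) l) U \<longrightarrow>
           (\<exists>A\<in>sets \<pi>. A \<subseteq> {\<theta>. stat_law k lam \<theta> l \<in> U} \<and>
              (AE \<omega> in M. (\<lambda>n. posterior k \<mu> \<pi> n A (\<lambda>t\<in>{..<n}. Y t \<omega>)) \<longlonglongrightarrow> 1))))
     \<and> (assumption_A1 k q lam \<pi> Qstar fstar \<and> assumption_A2 k q l lam \<pi>f \<longrightarrow>
        (\<forall>\<epsilon>>0.
           (\<exists>A\<in>sets \<pi>. A \<subseteq> {\<theta>. D_dist k lam l \<theta> (Qstar, fstar) < \<epsilon>} \<and>
              (AE \<omega> in M. (\<lambda>n. posterior k \<mu> \<pi> n A (\<lambda>t\<in>{..<n}. Y t \<omega>)) \<longlonglongrightarrow> 1))))"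
proof -
  \<comment> \<open>(A1) is required already here, since it supplies the lower bound on the entries
    of \<open>Qstar\<close>.\<close>
  have bayes: "hmm_bayes k q lam \<pi>Q \<pi>f \<mu> Qstar fstar M Y" if "assumption_A1 k q lam \<pi> Qstar fstar"
  proof (rule hmm_bayes.intro[OF k q lam(1) priorQ(1,2) _ priorf(1,2) _ mu(1) _ _ _ obs(1)])
    show "trans_mat_lb k q Qstar" "densities k lam fstar"
      using assumption_A1_trans_mat_lb[OF that] truth by (simp_all add: Theta_def)
    show "distr M (seq_space lam n) (\<lambda>\<omega>. \<lambda>t\<in>{..<n}. Y t \<omega>) = hmm_law k lam Qstar fstar (stat_dist k Qstar) n" if "1 \<le> n" for n
      using obs(3)[rule_format, OF that] by (simp add: hmm_law_def stat_dens_def)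
  qed (use priorQ(3) priorf(3) mu(2) obs(2) in simp_all)
  have l0: "l \<noteq> 0" using l by simp
  show ?thesis
  proof (intro conjI impI allI)
    fix U assume A1: "assumption_A1 k q lam \<pi> Qstar fstar" and U: "weak_nhd l (stat_law k lam (Qstar, fstar) l) U"
    interpret HB: hmm_bayes k q lam \<pi>Q \<pi>f \<mu> Qstar fstar M Y by (rule bayes[OF A1])
    obtain G \<epsilon> where G: "finite G" "0 < \<epsilon>" "\<forall>h\<in>G. bounded_cont l h"
      and sub: "{N. prob_space N \<and> sets N = sets (\<Pi>\<^sub>M t\<in>{..<l}. (borel :: (real^'d) measure)) \<and>
          (\<forall>h\<in>G. \<bar>(\<integral>x. h x \<partial>N) - (\<integral>x. h x \<partial>stat_law k lam (Qstar, fstar) l)\<bar> < \<epsilon>)} \<subseteq> U"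
      using U unfolding weak_nhd_def by (elim exE conjE) (rule that)
    have "\<forall>h\<in>G. \<exists>B. \<forall>x. \<bar>h x\<bar> \<le> B" using G(3) by (auto simp: bounded_cont_def)
    from bchoice[OF this] obtain b where b: "\<forall>h\<in>G. \<forall>x. \<bar>h x\<bar> \<le> b h" by (rule exE)
    \<comment> \<open>A common bound for the finitely many test functions; the summand 1 keeps it
      positive even if \<open>G\<close> is empty.\<close>
    define B where "B = 1 + (\<Sum>h\<in>G. \<bar>b h\<bar>)"
    have B: "0 < B" by (auto simp: B_def intro!: add_pos_nonneg sum_nonneg)
    have bd: "\<bar>h x\<bar> \<le> B" if "h \<in> G" for h x
    proof -
      have "\<bar>h x\<bar> \<le> \<bar>b h\<bar>" using b that by (meson abs_ge_self order_trans)
      also have "\<dots> \<le> (\<Sum>h\<in>G. \<bar>b h\<bar>)" using that G(1) by (intro member_le_sum) auto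
      finally show ?thesis by (simp add: B_def)
    qed
    have meas: "h \<in> borel_measurable (seq_space lam l)" if "h \<in> G" for h
      using G(3) that lam(2) by (intro bounded_cont_measurable) auto
    let ?A = "{\<theta> \<in> space \<pi>. \<theta> \<in> Theta_lb k q lam \<and>
      (\<forall>h\<in>G. \<bar>(\<integral>ys. h ys \<partial>stat_law k lam \<theta> l) - (\<integral>ys. h ys \<partial>stat_law k lam (Qstar, fstar) l)\<bar> < \<epsilon>)}"
    have wc: "?A \<in> sets \<pi>" "AE \<omega> in M. (\<lambda>n. posterior k \<mu> \<pi> n ?A (\<lambda>t\<in>{..<n}. Y t \<omega>)) \<longlonglongrightarrow> 1"
      unfolding \<pi>_def
      by (rule HB.weak_consistency[where B = B, OF A1[unfolded \<pi>_def] support[unfolded \<pi>_def] l0 G(2,1) _ _ B];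
        (erule meas | erule bd))+
    have "?A \<subseteq> {\<theta>. stat_law k lam \<theta> l \<in> U}"
    proof
      fix \<theta> assume \<theta>: "\<theta> \<in> ?A"
      \<comment> \<open>The neighbourhood consists of measures on the Borel product, so the
        sigma-field built from \<open>lam\<close> must be identified with it.\<close>
      have "sets (stat_law k lam \<theta> l) = sets (\<Pi>\<^sub>M t\<in>{..<l}. (borel :: (real^'d) measure))"
        unfolding stat_law_def sets_density using lam(2) by (intro sets_PiM_cong) auto
      then show "\<theta> \<in> {\<theta>. stat_law k lam \<theta> l \<in> U}" using \<theta> sub HB.prob_space_stat_law[OF _ l0, of \<theta>] by blast
    qed
    with wc show "\<exists>A\<in>sets \<pi>. A \<subseteq> {\<theta>. stat_law k lam \<theta> l \<in> U} \<and>
        (AE \<omega> in M. (\<lambda>n. posterior k \<mu> \<pi> n A (\<lambda>t\<in>{..<n}. Y t \<omega>)) \<longlonglongrightarrow> 1)"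
      by (intro bexI[of _ ?A] conjI)
  next
    fix \<epsilon> :: real
    assume A: "assumption_A1 k q lam \<pi> Qstar fstar \<and> assumption_A2 k q l lam \<pi>f" and \<epsilon>: "0 < \<epsilon>"
    interpret HB: hmm_bayes k q lam \<pi>Q \<pi>f \<mu> Qstar fstar M Y by (rule bayes[OF conjunct1[OF A]])
    note sc = HB.strong_consistency[OF conjunct1[OF A, unfolded \<pi>_def] conjunct2[OF A] support[unfolded \<pi>_def] l0 \<epsilon>, folded \<pi>_def]
    show "\<exists>A\<in>sets \<pi>. A \<subseteq> {\<theta>. D_dist k lam l \<theta> (Qstar, fstar) < \<epsilon>} \<and>
        (AE \<omega> in M. (\<lambda>n. posterior k \<mu> \<pi> n A (\<lambda>t\<in>{..<n}. Y t \<omega>)) \<longlonglongrightarrow> 1)"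
      by (rule bexI[OF _ sc(1)], rule conjI[OF _ sc(2)]) blast
  qed
qed

end
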